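(* Let $\mathrm{Pe}\in\mathbb{R}$ and $D_e>0$. Let $f_\infty\in H^1_{\mathrm{per}}(\Upsilon)$, with $\rho_\infty=\int_0^{2\pi}f_\infty\,d\theta\in[0,1]$ a.e., be a non-negative periodic weak solution of $$\mathrm{Pe}\,\mathrm{div}\big((1-\rho_\infty)f_\infty\,\mathbf e(\theta)\big)=D_e\Delta f_\infty+\partial_\theta^2f_\infty,$$ i.e. for all $\phi\in H^1_{\mathrm{per}}(\Upsilon)$ there holds $$\mathrm{Pe}\int_\Upsilon(1-\rho_\infty)f_\infty\,\mathbf e(\theta)\cdot\nabla\phi\,d\xi=D_e\int_\Upsilon\nabla f_\infty\cdot\nabla\phi\,d\xi+\int_\Upsilon\partial_\theta f_\infty\,\partial_\theta\phi\,d\xi.$$ Then $f_\infty$ is a smooth periodic function on $\mathbb{R}^3$.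
   Context: $\Omega=(0,2\pi)^2$, $\Upsilon=\Omega\times(0,2\pi)=(0,2\pi)^3$, $\xi=(x,\theta)$ with $x\in\Omega$, $\theta\in(0,2\pi)$; $\mathbf e(\theta)=(\cos\theta,\sin\theta)$; $\mathrm{div},\nabla,\Delta$ act on $x$ only. $H^1_{\mathrm{per}}(\Upsilon)$ is the space of functions on $\mathbb{R}^3$ that are $2\pi$-periodic in each coordinate with finite $H^1(\Upsilon)$ norm (periodic Sobolev space). Smoothness is understood up to choice of representative. *)

theory Defs
  imports "HOL-Analysis.Analysis"
begin

primrec C_k :: "nat \<Rightarrow> ('a::euclidean_space \<Rightarrow> real) \<Rightarrow> bool" where
  "C_k 0 f \<longleftrightarrow> continuous_on UNIV f"
| "C_k (Suc k) f \<longleftrightarrow> f differentiable_on UNIV \<and>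
     (\<forall>b\<in>Basis. C_k k (\<lambda>x. frechet_derivative f (at x) b))"

definition smooth :: "('a::euclidean_space \<Rightarrow> real) \<Rightarrow> bool" where
  "smooth f \<longleftrightarrow> (\<forall>k. C_k k f)"

definition test_function :: "('a::euclidean_space \<Rightarrow> real) \<Rightarrow> bool" where
  "test_function \<psi> \<longleftrightarrow> smooth \<psi> \<and> compact (closure {x. \<psi> x \<noteq> 0})"

definition locally_integrable :: "('a::euclidean_space \<Rightarrow> real) \<Rightarrow> bool" where
  "locally_integrable f \<longleftrightarrow> (\<forall>K. compact K \<longrightarrow> set_integrable lebesgue K f)"

definition has_weak_partial ::
    "('a::euclidean_space \<Rightarrow> real) \<Rightarrow> 'a \<Rightarrow> ('a \<Rightarrow> real) \<Rightarrow> bool" where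
  "has_weak_partial f b g \<longleftrightarrow> locally_integrable f \<and> locally_integrable g \<and>
     (\<forall>\<psi>. test_function \<psi> \<longrightarrow>
        (LINT x|lebesgue. f x * frechet_derivative \<psi> (at x) b) = - (LINT x|lebesgue. g x * \<psi> x))"

text \<open>A weak partial derivative is unique up to a null set; \<open>weak_partial\<close> picks a representative.\<close>

definition weak_partial :: "'a::euclidean_space \<Rightarrow> ('a \<Rightarrow> real) \<Rightarrow> 'a \<Rightarrow> real" where
  "weak_partial b f = (SOME g. has_weak_partial f b g)"

definition square_integrable_on :: "('a::euclidean_space \<Rightarrow> real) \<Rightarrow> 'a set \<Rightarrow> bool" where
  "square_integrable_on f S \<longleftrightarrow>
     set_borel_measurable lebesgue S f \<and> set_integrable lebesgue S (\<lambda>x. (f x)\<^sup>2)"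

text \<open>Points \<open>\<xi> = (x, \<theta>)\<close> of three-dimensional space are pairs of a point of the plane and
  an angle.\<close>

type_synonym point = "(real^2) \<times> real"

definition Omega :: "(real^2) set" where
  "Omega = {x. \<forall>i. 0 < x $ i \<and> x $ i < 2 * pi}"

definition Upsilon :: "point set" where
  "Upsilon = Omega \<times> {0<..<2 * pi}"

definition periodic :: "(point \<Rightarrow> real) \<Rightarrow> bool" where
  "periodic f \<longleftrightarrow> (\<forall>b\<in>Basis. \<forall>\<xi>. f (\<xi> + (2 * pi) *\<^sub>R b) = f \<xi>)"

definition ae_periodic :: "(point \<Rightarrow> real) \<Rightarrow> bool" where
  "ae_periodic f \<longleftrightarrow> (\<forall>b\<in>Basis. AE \<xi> in lebesgue. f (\<xi> + (2 * pi) *\<^sub>R b) = f \<xi>)"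

text \<open>Elements are functions on the whole space, standing for their almost-everywhere classes. The
  weak derivatives are taken on the whole space rather than on the open cell \<open>Upsilon\<close>, which
  rules out jumps across the faces of the cell; the norm is taken over one cell.\<close>

definition H1_per :: "(point \<Rightarrow> real) set" where
  "H1_per = {f. ae_periodic f \<and> square_integrable_on f Upsilon \<and>
     (\<forall>b\<in>Basis. (\<exists>g. has_weak_partial f b g) \<and> square_integrable_on (weak_partial b f) Upsilon)}"

definition grad_x :: "(point \<Rightarrow> real) \<Rightarrow> point \<Rightarrow> real^2" where
  "grad_x f \<xi> = (\<chi> i. weak_partial (axis i 1, 0) f \<xi>)"

definition partial_theta :: "(point \<Rightarrow> real) \<Rightarrow> point \<Rightarrow> real" where
  "partial_theta f = weak_partial (0, 1) f"

definition e_dir :: "real \<Rightarrow> real^2" where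
  "e_dir \<theta> = vector [cos \<theta>, sin \<theta>]"

definition angular_density :: "(point \<Rightarrow> real) \<Rightarrow> real^2 \<Rightarrow> real" where
  "angular_density f x = (LINT \<theta>:{0<..<2 * pi}|lebesgue. f (x, \<theta>))"

definition weak_solution :: "real \<Rightarrow> real \<Rightarrow> (point \<Rightarrow> real) \<Rightarrow> bool" where
  "weak_solution Pe De f \<longleftrightarrow> (\<forall>\<phi>\<in>H1_per.
     Pe * (LINT \<xi>:Upsilon|lebesgue.
             (1 - angular_density f (fst \<xi>)) * f \<xi> * (e_dir (snd \<xi>) \<bullet> grad_x \<phi> \<xi>)) =
     De * (LINT \<xi>:Upsilon|lebesgue. grad_x f \<xi> \<bullet> grad_x \<phi> \<xi>) +
     (LINT \<xi>:Upsilon|lebesgue. partial_theta f \<xi> * partial_theta \<phi> \<xi>))"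

end

theory Submission
  imports Defs
begin

text \<open>The equation is read off in Fourier space. Integration against \<open>cos\<close> and \<open>sin\<close> of
  \<open>k \<bullet> x + n \<theta>\<close> shows that the moduli \<open>u k n\<close> of the Fourier coefficients gain one power of the weight
  \<open>wt k n = 1 + \<bar>k\<^sub>1\<bar> + \<bar>k\<^sub>2\<bar> + \<bar>n\<bar>\<close> over the coefficients of \<open>(1 - \<rho>) f\<close> at \<open>n - 1\<close> and \<open>n + 1\<close>,
  and the latter are bounded by \<open>v k n = u k n + (\<Sum>l. u l 0 * u (k - l) n)\<close> up to a constant, because \<open>\<rho>\<close> has
  only the frequencies \<open>(l, 0)\<close>. The energy bound says that \<open>wt * u\<close> is square summable, which in two
  dimensions just fails to make \<open>u l 0\<close> summable in \<open>l\<close>; using the gain once closes this gap, and from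
  then on Young's inequality for convolutions improves the weighted square summability by one power
  at a time. Hence the coefficients decay rapidly, and \<open>f\<close> agrees with its Fourier series almost
  everywhere.\<close>

section \<open>Weighted summation and the bootstrap on Fourier coefficients\<close>

text \<open>The drift carries one derivative in x, the diffusion two in every variable. Dividing by
  the symbol \<open>De * |k|^2 + n^2\<close> therefore leaves a factor of size
  \<open>1 / wt k n\<close>, which is the origin of the gain. The obstacle is the quadratic term. A
  pointwise bound on rho does not control the moduli of the coefficients of a product in weighted
  norms; absolute summability of the coefficients of one factor does (the Wiener algebra). Since rho
  depends on x alone, the convolution acts on each slice of fixed n separately. Hence summability is
  needed over the two-dimensional k only, with slice sums that are square summable in n; this mixed
  norm is what Young's inequality consumes. Taking moduli in \<open>ennreal\<close> makes the
  iteration a statement about two nonnegative arrays \<open>u\<close> and \<open>v\<close>, free of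
  convergence questions. The boundedness of rho enters elsewhere: it makes (1 - rho) f integrable
  and rho a mean-square limit of trigonometric polynomials, which is how the convolution bound is
  justified.\<close>

abbreviation esum :: "('i \<Rightarrow> ennreal) \<Rightarrow> ennreal" where
  "esum f \<equiv> (\<integral>\<^sup>+ i. f i \<partial>count_space UNIV)"

text \<open>Estimates run in \<open>ennreal\<close>, where a sum is an integral over counting
  measure and exchanging sums needs no summability hypothesis; this is the passage back to real
  sums.\<close>

lemma esum_finite_iff:
  fixes f :: "'i \<Rightarrow> real"
  assumes "\<And>i. 0 \<le> f i"
  shows "esum (\<lambda>i. ennreal (f i)) < \<infinity> \<longleftrightarrow> f summable_on UNIV"
proof -
  have "f summable_on UNIV \<longleftrightarrow> (\<lambda>i. norm (f i)) summable_on UNIV" using assms by simp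
  also have "\<dots> \<longleftrightarrow> integrable (count_space UNIV) f"
    using abs_summable_equivalent[of f UNIV] by (simp add: abs_summable_on_def)
  also have "\<dots> \<longleftrightarrow> esum (\<lambda>i. ennreal (f i)) < \<infinity>"
    using assms by (simp add: integrable_iff_bounded)
  finally show ?thesis by simp
qed

lemma esum_swap: "esum (\<lambda>x. esum (\<lambda>y. f x y)) = esum (\<lambda>y. esum (\<lambda>x. f x y))"
  using nn_integral_fst_count_space[of "\<lambda>(x, y). f x y"] nn_integral_snd_count_space[of "\<lambda>(x, y). f x y"]
  by simp

lemma esum_prod: "esum (\<lambda>(x, y). f x y) = esum (\<lambda>x. esum (\<lambda>y. f x y))"
  using nn_integral_fst_count_space[of "\<lambda>(x, y). f x y"] by simp

lemma esum_shift:
  fixes c :: "'a::ab_group_add"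
  shows "esum (\<lambda>x. f (x + c)) = esum f"
proof -
  have "bij_betw (\<lambda>x. x + c) UNIV UNIV"
    by (rule bij_betwI[where g = "\<lambda>x. x - c"]) auto
  from nn_integral_bij_count_space[OF this] show ?thesis .
qed

lemma esum_shift_diff:
  fixes c :: "'a::ab_group_add"
  shows "esum (\<lambda>x. f (x - c)) = esum f"
  using esum_shift[of f "- c"] by simp

lemma esum_reflect:
  fixes c :: "'a::ab_group_add"
  shows "esum (\<lambda>x. f (c - x)) = esum f"
proof -
  have "bij_betw (\<lambda>x. c - x) UNIV UNIV"
    by (rule bij_betwI[where g = "\<lambda>x. c - x"]) auto
  from nn_integral_bij_count_space[OF this] show ?thesis .
qed

lemma ennreal_two_mult_le: "2 * (x * y) \<le> x\<^sup>2 + (y::ennreal)\<^sup>2"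
proof (cases x; cases y)
  fix r s :: real
  assume *: "x = ennreal r" "0 \<le> r" "y = ennreal s" "0 \<le> s"
  have "2 * (x * y) = ennreal (2 * (r * s))" using * by (simp add: ennreal_mult)
  also have "\<dots> \<le> ennreal (r\<^sup>2 + s\<^sup>2)"
    using sum_squares_bound[of r s] by (intro ennreal_leI) (simp add: mult.assoc)
  also have "\<dots> = x\<^sup>2 + y\<^sup>2" using * by (simp add: ennreal_power)
  finally show ?thesis .
qed (auto simp: power2_eq_square)

lemma ennreal_two_cancel: "2 * x \<le> 2 * (y::ennreal) \<Longrightarrow> x \<le> y"
  by (subst (asm) ennreal_mult_le_mult_iff) auto

lemma esum_power2: "(esum c)\<^sup>2 = esum (\<lambda>i. esum (\<lambda>j. c i * c j))"
  by (simp add: power2_eq_square nn_integral_cmult nn_integral_multc)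

text \<open>Square out into a double sum and apply 2xy \<le> x^2 + y^2 to each pair. Without roots
  or quotients, infinite values cause no trouble.\<close>

lemma esum_Cauchy_Schwarz_weighted:
  "(esum (\<lambda>i. a i * w i))\<^sup>2 \<le> esum w * esum (\<lambda>i. (a i)\<^sup>2 * w i)"
proof (rule ennreal_two_cancel)
  have "2 * (esum (\<lambda>i. a i * w i))\<^sup>2 = esum (\<lambda>i. esum (\<lambda>j. 2 * (a i * a j) * (w i * w j)))"
    by (simp add: esum_power2 nn_integral_cmult[symmetric] mult_ac)
  also have "\<dots> \<le> esum (\<lambda>i. esum (\<lambda>j. ((a i)\<^sup>2 + (a j)\<^sup>2) * (w i * w j)))"
    by (intro nn_integral_mono mult_right_mono ennreal_two_mult_le) auto
  also have "\<dots> = esum (\<lambda>i. esum (\<lambda>j. ((a i)\<^sup>2 * w i) * w j)) + esum (\<lambda>i. esum (\<lambda>j. w i * ((a j)\<^sup>2 * w j)))"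
    by (simp add: nn_integral_add[symmetric] distrib_right distrib_left mult_ac)
  also have "\<dots> = 2 * (esum w * esum (\<lambda>i. (a i)\<^sup>2 * w i))"
    by (simp add: nn_integral_cmult nn_integral_multc mult_2 mult.commute)
  finally show "2 * (esum (\<lambda>i. a i * w i))\<^sup>2 \<le> 2 * (esum w * esum (\<lambda>i. (a i)\<^sup>2 * w i))" .
qed

text \<open>The cross term is read as the product of \<open>a i * b j\<close> and
  \<open>a j * b i\<close>, so that the squares separate into the two factors; in the weighted form
  \<open>a i\<close> is paired with \<open>a j\<close> instead.\<close>

lemma esum_Cauchy_Schwarz:
  "(esum (\<lambda>i. a i * b i))\<^sup>2 \<le> esum (\<lambda>i. (a i)\<^sup>2) * esum (\<lambda>i. (b i)\<^sup>2)"
proof (rule ennreal_two_cancel)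
  have "2 * (esum (\<lambda>i. a i * b i))\<^sup>2 = esum (\<lambda>i. esum (\<lambda>j. 2 * ((a i * b j) * (a j * b i))))"
    by (simp add: esum_power2 nn_integral_cmult[symmetric] mult_ac)
  also have "\<dots> \<le> esum (\<lambda>i. esum (\<lambda>j. (a i * b j)\<^sup>2 + (a j * b i)\<^sup>2))"
    by (intro nn_integral_mono ennreal_two_mult_le)
  also have "\<dots> = esum (\<lambda>i. esum (\<lambda>j. (a i)\<^sup>2 * (b j)\<^sup>2)) + esum (\<lambda>i. esum (\<lambda>j. (b i)\<^sup>2 * (a j)\<^sup>2))"
    by (simp add: nn_integral_add[symmetric] power_mult_distrib mult_ac)
  also have "\<dots> = 2 * (esum (\<lambda>i. (a i)\<^sup>2) * esum (\<lambda>i. (b i)\<^sup>2))"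
    by (simp add: nn_integral_cmult nn_integral_multc mult_2 mult.commute)
  finally show "2 * (esum (\<lambda>i. a i * b i))\<^sup>2 \<le> 2 * (esum (\<lambda>i. (a i)\<^sup>2) * esum (\<lambda>i. (b i)\<^sup>2))" .
qed

text \<open>Convolution with an l^1 sequence acting on l^2: Cauchy-Schwarz with the weight
  \<open>b (k - l)\<close>, whose total mass \<open>esum b\<close> does not depend on k, then
  exchange of the sums.\<close>

lemma esum_Young:
  fixes a b :: "'a::ab_group_add \<Rightarrow> ennreal"
  shows "esum (\<lambda>k. (esum (\<lambda>l. a l * b (k - l)))\<^sup>2) \<le> (esum b)\<^sup>2 * esum (\<lambda>l. (a l)\<^sup>2)"
proof -
  have "(esum (\<lambda>l. a l * b (k - l)))\<^sup>2 \<le> esum b * esum (\<lambda>l. (a l)\<^sup>2 * b (k - l))" for k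
    using esum_Cauchy_Schwarz_weighted[of a "\<lambda>l. b (k - l)"] by (simp add: esum_reflect)
  then have "esum (\<lambda>k. (esum (\<lambda>l. a l * b (k - l)))\<^sup>2) \<le> esum (\<lambda>k. esum b * esum (\<lambda>l. (a l)\<^sup>2 * b (k - l)))"
    by (intro nn_integral_mono) auto
  also have "\<dots> = esum b * esum (\<lambda>l. esum (\<lambda>k. (a l)\<^sup>2 * b (k - l)))"
    by (subst esum_swap) (simp add: nn_integral_cmult)
  also have "\<dots> = (esum b)\<^sup>2 * esum (\<lambda>l. (a l)\<^sup>2)"
    by (simp add: nn_integral_cmult nn_integral_multc esum_shift_diff power2_eq_square[of "esum b"] mult_ac)
  finally show ?thesis .
qed

lemma ennreal_add_power2_le: "(x + y)\<^sup>2 \<le> 2 * (x\<^sup>2 + (y::ennreal)\<^sup>2)"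
proof -
  have "(x + y)\<^sup>2 = (x\<^sup>2 + y\<^sup>2) + 2 * (x * y)"
    by (simp only: power2_eq_square distrib_left distrib_right mult_2 mult.commute[of y x] add_ac)
  also have "\<dots> \<le> (x\<^sup>2 + y\<^sup>2) + (x\<^sup>2 + y\<^sup>2)"
    by (intro add_left_mono ennreal_two_mult_le)
  finally show ?thesis by (simp only: mult_2)
qed

text \<open>The constant 4 instead of the sharp 3 comes from using the two-term inequality
  twice.\<close>

lemma ennreal_add3_power2_le: "(x + y + z)\<^sup>2 \<le> 4 * (x\<^sup>2 + y\<^sup>2 + (z::ennreal)\<^sup>2)"
proof -
  have "(x + y + z)\<^sup>2 \<le> 2 * ((x + y)\<^sup>2 + z\<^sup>2)" by (rule ennreal_add_power2_le)
  also have "\<dots> \<le> 2 * (2 * (x\<^sup>2 + y\<^sup>2) + 2 * z\<^sup>2)"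
    by (intro mult_left_mono add_mono ennreal_add_power2_le) (auto simp: mult_2)
  also have "\<dots> = 4 * (x\<^sup>2 + y\<^sup>2 + z\<^sup>2)"
    by (simp add: distrib_left mult.assoc[symmetric])
  finally show ?thesis .
qed

section \<open>The frequency weight and lattice sums of its inverse powers\<close>

text \<open>Comparable to the Sobolev weight sqrt (1 + |k|^2 + n^2), but linear in the absolute
  values, which makes the triangle inequality and the monotonicity in each frequency
  immediate.\<close>

definition wt :: "int \<times> int \<Rightarrow> int \<Rightarrow> real" where
  "wt k n = 1 + \<bar>of_int (fst k)\<bar> + \<bar>of_int (snd k)\<bar> + \<bar>of_int n\<bar>"

lemma wt_ge_1: "1 \<le> wt k n" by (simp add: wt_def)
lemma wt_pos: "0 < wt k n" using wt_ge_1[of k n] by simp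

text \<open>The exponent 3/2 is half of 3: an inverse cube of \<open>wt k 0\<close> splits into one
  such factor for each component of k, and 3/2 > 1 still converges.\<close>

lemma summable_on_int_powr: "(\<lambda>j::int. (1 + \<bar>of_int j\<bar>) powr (-3/2 :: real)) summable_on UNIV"
proof -
  have nat: "(\<lambda>n. (1 + real n) powr (-3/2)) summable_on UNIV"
  proof -
    have "summable (\<lambda>n. real (Suc n) powr (-3/2))"
      by (subst summable_Suc_iff) (simp add: summable_real_powr_iff)
    then show ?thesis
      by (intro norm_summable_imp_summable_on) (simp add: add.commute)
  qed
  have "(\<lambda>j::int. (1 + \<bar>of_int j\<bar>) powr (-3/2 :: real)) summable_on range int"
    by (subst summable_on_reindex) (use nat in \<open>auto simp: o_def\<close>)
  moreover have "(\<lambda>j::int. (1 + \<bar>of_int j\<bar>) powr (-3/2 :: real)) summable_on range (\<lambda>n. - int n)"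
    by (subst summable_on_reindex) (use nat in \<open>auto simp: o_def inj_on_def\<close>)
  ultimately have "(\<lambda>j::int. (1 + \<bar>of_int j\<bar>) powr (-3/2 :: real)) summable_on range int \<union> range (\<lambda>n. - int n)"
    by (rule summable_on_union)
  moreover have "range int \<union> range (\<lambda>n. - int n) = UNIV"
  proof -
    have "z \<in> range int \<union> range (\<lambda>n. - int n)" for z by (cases z rule: int_cases2) auto
    then show ?thesis by blast
  qed
  ultimately show ?thesis by simp
qed

lemma esum_int_powr: "esum (\<lambda>j::int. ennreal ((1 + \<bar>of_int j\<bar>) powr (-3/2))) < \<infinity>"
  using summable_on_int_powr by (subst esum_finite_iff) auto


lemma esum_ge: "f i \<le> esum f"
  by (rule nn_integral_ge_point) simp

text \<open>Multiplication by cos or sin of theta moves n by one, so weights at neighbouring n must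
  be comparable.\<close>

lemma wt_neighbour: "\<bar>j\<bar> \<le> 1 \<Longrightarrow> wt k n \<le> 2 * wt k (n + j)"
proof -
  assume "\<bar>j\<bar> \<le> 1"
  then have "\<bar>real_of_int j\<bar> \<le> 1" by linarith
  then have "\<bar>real_of_int n\<bar> \<le> \<bar>real_of_int n + real_of_int j\<bar> + 1" by linarith
  moreover have "0 \<le> \<bar>real_of_int (fst k)\<bar>" "0 \<le> \<bar>real_of_int (snd k)\<bar>" "0 \<le> \<bar>real_of_int n + real_of_int j\<bar>" by auto
  ultimately show ?thesis unfolding wt_def of_int_add by argo
qed

lemma wt_add_le: "wt k n \<le> wt l 0 + wt (k - l) n"
  by (simp add: wt_def)

text \<open>The square of the weight dominates the product of the two one-dimensional weights, so
  the sum of inverse cubes is bounded by a product of one-dimensional sums.\<close>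

lemma esum_wt_cube: "esum (\<lambda>k. ennreal (1 / wt k 0 ^ 3)) < \<infinity>"
proof -
  let ?g = "\<lambda>j::int. (1 + \<bar>of_int j\<bar>) powr (-3/2 :: real)"
  have le: "1 / wt (a, b) 0 ^ 3 \<le> ?g a * ?g b" for a b
  proof -
    let ?A = "1 + \<bar>of_int a :: real\<bar>" and ?B = "1 + \<bar>of_int b :: real\<bar>"
    have "?A * ?B \<le> wt (a, b) 0 ^ 2"
      by (simp add: wt_def power2_eq_square algebra_simps)
    then have "(wt (a, b) 0 ^ 2) powr (-3/2) \<le> (?A * ?B) powr (-3/2)"
      by (intro powr_mono2') auto
    also have "\<dots> = ?g a * ?g b" by (simp add: powr_mult)
    also have "(wt (a, b) 0 ^ 2) powr (-3/2) = 1 / wt (a, b) 0 ^ 3"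
    proof -
      have "(wt (a, b) 0 ^ 2) powr (-3/2) = (wt (a, b) 0 powr 2) powr (-3/2)"
        using wt_pos[of "(a, b)" 0] by simp
      also have "\<dots> = wt (a, b) 0 powr (- 3)" by (simp only: powr_powr) simp
      also have "\<dots> = 1 / wt (a, b) 0 powr 3" by (rule powr_minus_divide)
      also have "\<dots> = 1 / wt (a, b) 0 ^ 3" using wt_pos[of "(a, b)" 0] by simp
      finally show ?thesis .
    qed
    finally show ?thesis .
  qed
  have "esum (\<lambda>k. ennreal (1 / wt k 0 ^ 3)) \<le> esum (\<lambda>(a, b). ennreal (?g a) * ennreal (?g b))"
    using le by (intro nn_integral_mono) (auto simp: ennreal_mult[symmetric] split: prod.splits intro!: ennreal_leI)
  also have "\<dots> = esum (\<lambda>a. ennreal (?g a)) * esum (\<lambda>b. ennreal (?g b))"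
    by (simp add: esum_prod nn_integral_cmult nn_integral_multc)
  also have "\<dots> < \<infinity>" using esum_int_powr by (simp add: ennreal_mult_less_top)
  finally show ?thesis .
qed

text \<open>If z is the largest of the three numbers, z^2 is at least the product of the other two
  and can be traded for one more power of each. Adding the three cases makes the bound
  symmetric.\<close>

lemma inverse_squares_le_cubes:
  fixes p q s :: real
  assumes "0 < p" "0 < q" "0 < s"
  shows "1 / (p * q * s)\<^sup>2 \<le> 1 / (p ^ 3 * q ^ 3) + 1 / (q ^ 3 * s ^ 3) + 1 / (p ^ 3 * s ^ 3)"
proof -
  have *: "1 / (x * y * z)\<^sup>2 \<le> 1 / (x ^ 3 * y ^ 3)" if "x \<le> z" "y \<le> z" "0 < x" "0 < y" for x y z :: real
  proof -
    have "x * y \<le> z * z" using that by (intro mult_mono) auto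
    then have "(x * y)\<^sup>2 * (x * y) \<le> (x * y)\<^sup>2 * (z * z)" by (intro mult_left_mono) auto
    then have "x ^ 3 * y ^ 3 \<le> (x * y * z)\<^sup>2"
      by (simp add: power2_eq_square power3_eq_cube mult_ac)
    then show ?thesis using that by (intro divide_left_mono) auto
  qed
  have nn: "0 \<le> 1 / (p ^ 3 * q ^ 3)" "0 \<le> 1 / (q ^ 3 * s ^ 3)" "0 \<le> 1 / (p ^ 3 * s ^ 3)"
    using assms by auto
  consider "p \<le> s" "q \<le> s" | "q \<le> p" "s \<le> p" | "p \<le> q" "s \<le> q" by linarith
  then show ?thesis
  proof cases
    case 1 then show ?thesis using *[of p s q] assms nn by linarith
  next
    case 2
    then have "1 / (q * s * p)\<^sup>2 \<le> 1 / (q ^ 3 * s ^ 3)" using *[of q p s] assms by simp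
    moreover have "q * s * p = p * q * s" by simp
    ultimately have "1 / (p * q * s)\<^sup>2 \<le> 1 / (q ^ 3 * s ^ 3)" by simp
    then show ?thesis using nn by linarith
  next
    case 3
    then have "1 / (p * s * q)\<^sup>2 \<le> 1 / (p ^ 3 * s ^ 3)" using *[of p q s] assms by simp
    moreover have "p * s * q = p * q * s" by simp
    ultimately have "1 / (p * q * s)\<^sup>2 \<le> 1 / (p ^ 3 * s ^ 3)" by simp
    then show ?thesis using nn by linarith
  qed
qed

text \<open>On the two-dimensional lattice the exponent 2 is exactly the one at which a single
  factor fails to be summable. The three coupled squares are replaced by products of two cubes, and
  a shift of one variable decouples each product.\<close>

lemma esum_inverse_squares:
  "esum (\<lambda>l. esum (\<lambda>m. ennreal (1 / (wt l 0 * wt m 0 * wt (l + m) 0)\<^sup>2))) < \<infinity>"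
proof -
  let ?c = "\<lambda>k. ennreal (1 / wt k 0 ^ 3)"
  have "ennreal (1 / (wt l 0 * wt m 0 * wt (l + m) 0)\<^sup>2)
      \<le> ?c l * ?c m + ?c m * ?c (m + l) + ?c l * ?c (m + l)" for l m
    using ennreal_leI[OF inverse_squares_le_cubes[OF wt_pos[of l 0] wt_pos[of m 0] wt_pos[of "l + m" 0]]]
    by (simp add: ennreal_mult[symmetric] ennreal_plus[symmetric] wt_pos less_imp_le add.commute del: ennreal_plus)
  then have "esum (\<lambda>l. esum (\<lambda>m. ennreal (1 / (wt l 0 * wt m 0 * wt (l + m) 0)\<^sup>2)))
      \<le> esum (\<lambda>l. esum (\<lambda>m. ?c l * ?c m + ?c m * ?c (m + l) + ?c l * ?c (m + l)))"
    by (intro nn_integral_mono)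
  also have "\<dots> = esum (\<lambda>l. esum (\<lambda>m. ?c l * ?c m)) + esum (\<lambda>l. esum (\<lambda>m. ?c m * ?c (m + l)))
      + esum (\<lambda>l. esum (\<lambda>m. ?c l * ?c (m + l)))"
    by (simp add: nn_integral_add)
  also have "esum (\<lambda>l. esum (\<lambda>m. ?c m * ?c (m + l))) = esum ?c * esum ?c"
  proof (subst esum_swap)
    have "esum (\<lambda>l. ?c (m + l)) = esum ?c" for m
      using esum_shift[of ?c m] by (simp add: add.commute)
    then show "esum (\<lambda>m. esum (\<lambda>l. ?c m * ?c (m + l))) = esum ?c * esum ?c"
      by (simp add: nn_integral_cmult nn_integral_multc)
  qed
  also have "esum (\<lambda>l. esum (\<lambda>m. ?c l * ?c (m + l))) = esum ?c * esum ?c"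
    using esum_shift[of ?c] by (simp add: nn_integral_cmult nn_integral_multc)
  also have "esum (\<lambda>l. esum (\<lambda>m. ?c l * ?c m)) = esum ?c * esum ?c"
    by (simp add: nn_integral_cmult nn_integral_multc)
  also have "esum ?c * esum ?c + esum ?c * esum ?c + esum ?c * esum ?c < \<infinity>"
    using esum_wt_cube by (simp add: ennreal_mult_less_top)
  finally show ?thesis .
qed


lemma wt_pow_neighbour: "\<bar>j\<bar> \<le> 1 \<Longrightarrow> wt k n ^ s \<le> 2 ^ s * wt k (n + j) ^ s"
  using power_mono[OF wt_neighbour[of j k n], of s] wt_pos[of k n] by (simp add: power_mult_distrib)

text \<open>A Leibniz rule on the Fourier side: at the price of \<open>2 ^ s\<close> the weight
  falls on one of the two frequencies adding up to k. All of n stays with the second one, because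
  rho has no frequency in theta.\<close>

lemma wt_pow_add_le: "wt k n ^ s \<le> 2 ^ s * (wt l 0 ^ s + wt (k - l) n ^ s)"
proof -
  let ?x = "wt l 0" and ?y = "wt (k - l) n"
  have "wt k n ^ s \<le> (2 * max ?x ?y) ^ s"
    using wt_add_le[of k n l] wt_pos[of k n] by (intro power_mono) auto
  also have "\<dots> \<le> 2 ^ s * (?x ^ s + ?y ^ s)"
    using wt_pos[of l 0] wt_pos[of "k - l" n] by (simp add: power_mult_distrib max_def)
  finally show ?thesis .
qed

section \<open>The bootstrap for nonnegative coefficient arrays\<close>

context
  fixes u v :: "int \<times> int \<Rightarrow> int \<Rightarrow> ennreal" and C :: real
  assumes v_def: "\<And>k n. v k n = u k n + esum (\<lambda>l. u l 0 * u (k - l) n)"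
    and energy: "esum (\<lambda>n. esum (\<lambda>k. (ennreal (wt k n) * u k n)\<^sup>2)) < \<infinity>"
    and gain: "\<And>k n. u k n \<le> ennreal C * (ennreal (1 / wt k n) * (v k (n - 1) + v k n + v k (n + 1)))"
begin

text \<open>The energy bound alone misses the summability of \<open>u k n\<close> in \<open>k\<close> by a logarithm. One use of the gain
  reduces it to the convergence of the double sum of \<open>1 / (wt l 0 * wt m 0 * wt (l + m) 0)\<^sup>2\<close>.\<close>

lemma esum_slice_sums: "esum (\<lambda>n. (esum (\<lambda>k. u k n))\<^sup>2) < \<infinity>"
proof -
  define D where "D n = esum (\<lambda>k. (ennreal (wt k n) * u k n)\<^sup>2)" for n
  define W where "W k = ennreal (1 / wt k 0)" for k
  define R where "R n = esum (\<lambda>k. W k * v k n)" for n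
  define Z where "Z = esum (\<lambda>l. esum (\<lambda>m. ennreal (1 / (wt l 0 * wt m 0 * wt (l + m) 0)\<^sup>2)))"
  define Q where "Q = esum (\<lambda>k. ennreal (1 / wt k 0 ^ 3))"
  have D: "esum D < \<infinity>" using energy by (simp add: D_def[abs_def])
  have D0: "D 0 < \<infinity>" using esum_ge[of D 0] D by (rule le_less_trans)
  have Q: "Q < \<infinity>" unfolding Q_def by (rule esum_wt_cube)
  have Z: "Z < \<infinity>" unfolding Z_def by (rule esum_inverse_squares)
  have slice: "esum (\<lambda>k. (ennreal (wt k 0) * u k n)\<^sup>2) \<le> D n" for n
    unfolding D_def
    by (intro nn_integral_mono power_mono mult_right_mono ennreal_leI) (auto simp: wt_def)
  \<comment> \<open>Linear part of \<open>v\<close>: one inverse weight comes from \<open>W\<close>,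
    a second is split off from the energy, and inverse fourth powers are summable in the
    plane.\<close>
  have lin: "(esum (\<lambda>k. W k * u k n))\<^sup>2 \<le> Q * D n" for n
  proof -
    have "esum (\<lambda>k. W k * u k n) = esum (\<lambda>k. ennreal (1 / wt k 0 ^ 2) * (ennreal (wt k 0) * u k n))"
      unfolding W_def using wt_pos
      by (intro nn_integral_cong)
        (simp add: mult.assoc[symmetric] ennreal_mult[symmetric] less_imp_le power2_eq_square)
    then have "(esum (\<lambda>k. W k * u k n))\<^sup>2
        \<le> esum (\<lambda>k. (ennreal (1 / wt k 0 ^ 2))\<^sup>2) * esum (\<lambda>k. (ennreal (wt k 0) * u k n)\<^sup>2)"
      using esum_Cauchy_Schwarz by simp
    also have "\<dots> \<le> Q * D n"
    proof (intro mult_mono slice)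
      have "(1 / wt k 0 ^ 2)\<^sup>2 \<le> 1 / wt k 0 ^ 3" for k
        using power_increasing[OF _ wt_ge_1[of k 0], of 3 4] wt_pos[of k 0]
        by (simp add: power_divide divide_left_mono)
      then show "esum (\<lambda>k. (ennreal (1 / wt k 0 ^ 2))\<^sup>2) \<le> Q"
        unfolding Q_def using wt_pos
        by (intro nn_integral_mono) (simp add: ennreal_power less_imp_le ennreal_leI)
    qed auto
    finally show ?thesis .
  qed
  \<comment> \<open>Bilinear part: with k = l + m, the inverse weight \<open>W k\<close> joins the
    two inverse weights split off from the energies of both factors. This produces the triple
    product summed in \<open>Z\<close>.\<close>
  have bil: "(esum (\<lambda>k. W k * esum (\<lambda>l. u l 0 * u (k - l) n)))\<^sup>2 \<le> Z * (D 0 * D n)" for n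
  proof -
    let ?a = "\<lambda>(l, m). ennreal (1 / (wt l 0 * wt m 0 * wt (l + m) 0))"
    let ?b = "\<lambda>(l, m). (ennreal (wt l 0) * u l 0) * (ennreal (wt m 0) * u m n)"
    have "esum (\<lambda>k. W k * esum (\<lambda>l. u l 0 * u (k - l) n))
        = esum (\<lambda>l. esum (\<lambda>k. W k * (u l 0 * u (k - l) n)))"
      by (subst esum_swap) (simp add: nn_integral_cmult)
    also have "\<dots> = esum (\<lambda>l. esum (\<lambda>m. W (m + l) * (u l 0 * u m n)))"
    proof (rule nn_integral_cong)
      fix l
      show "esum (\<lambda>k. W k * (u l 0 * u (k - l) n)) = esum (\<lambda>m. W (m + l) * (u l 0 * u m n))"
        using esum_shift_diff[of "\<lambda>m. W (m + l) * (u l 0 * u m n)" l] by simp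
    qed
    also have "\<dots> = esum (\<lambda>p. ?a p * ?b p)"
    proof -
      have "W (m + l) * (u l 0 * u m n)
          = ennreal (1 / (wt l 0 * wt m 0 * wt (l + m) 0)) * ((ennreal (wt l 0) * u l 0) * (ennreal (wt m 0) * u m n))" for l m
      proof -
        have pos: "0 < wt l 0" "0 < wt m 0" "0 < wt (l + m) 0" by (rule wt_pos)+
        then have "W (m + l) = ennreal (1 / (wt l 0 * wt m 0 * wt (l + m) 0)) * (ennreal (wt l 0) * ennreal (wt m 0))"
          by (simp add: W_def ennreal_mult[symmetric] less_imp_le add.commute)
        then show ?thesis by (simp add: mult_ac)
      qed
      then show ?thesis by (simp add: esum_prod[symmetric] split_def)
    qed
    finally have "(esum (\<lambda>k. W k * esum (\<lambda>l. u l 0 * u (k - l) n)))\<^sup>2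
        \<le> esum (\<lambda>p. (?a p)\<^sup>2) * esum (\<lambda>p. (?b p)\<^sup>2)"
      using esum_Cauchy_Schwarz[of ?a ?b] by simp
    also have "esum (\<lambda>p. (?a p)\<^sup>2) = Z"
      unfolding Z_def esum_prod[symmetric] using wt_pos
      by (intro nn_integral_cong) (auto simp: ennreal_power less_imp_le power_divide)
    also have "esum (\<lambda>p. (?b p)\<^sup>2)
        = esum (\<lambda>(l, m). (ennreal (wt l 0) * u l 0)\<^sup>2 * (ennreal (wt m 0) * u m n)\<^sup>2)"
      by (intro nn_integral_cong) (auto simp: power_mult_distrib)
    also have "\<dots> = D 0 * esum (\<lambda>m. (ennreal (wt m 0) * u m n)\<^sup>2)"
      by (simp add: D_def esum_prod nn_integral_cmult nn_integral_multc)
    also have "Z * \<dots> \<le> Z * (D 0 * D n)" by (intro mult_left_mono slice) auto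
    finally show ?thesis .
  qed
  \<comment> \<open>The bound is linear in \<open>D n\<close>, so summing over n costs the energy
    once more, while \<open>D 0\<close> is just a finite constant.\<close>
  have R: "(R n)\<^sup>2 \<le> 2 * (Q + Z * D 0) * D n" for n
  proof -
    have "R n = esum (\<lambda>k. W k * u k n) + esum (\<lambda>k. W k * esum (\<lambda>l. u l 0 * u (k - l) n))"
      by (simp add: R_def v_def distrib_left nn_integral_add)
    then have "(R n)\<^sup>2 \<le> 2 * ((esum (\<lambda>k. W k * u k n))\<^sup>2 + (esum (\<lambda>k. W k * esum (\<lambda>l. u l 0 * u (k - l) n)))\<^sup>2)"
      by (simp only: ennreal_add_power2_le)
    also have "\<dots> \<le> 2 * (Q * D n + Z * (D 0 * D n))"
      by (intro mult_left_mono add_mono lin bil) auto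
    finally show ?thesis by (simp add: distrib_left distrib_right mult_ac)
  qed
  have R_sum: "esum (\<lambda>n. (R n)\<^sup>2) < \<infinity>"
  proof -
    have "esum (\<lambda>n. (R n)\<^sup>2) \<le> esum (\<lambda>n. 2 * (Q + Z * D 0) * D n)"
      by (intro nn_integral_mono R)
    also have "\<dots> = 2 * (Q + Z * D 0) * esum D" by (simp add: nn_integral_cmult)
    also have "\<dots> < \<infinity>" using D D0 Q Z by (simp add: ennreal_mult_less_top)
    finally show ?thesis .
  qed
  have "(esum (\<lambda>k. u k n))\<^sup>2 \<le> (ennreal C)\<^sup>2 * (4 * ((R (n - 1))\<^sup>2 + (R n)\<^sup>2 + (R (n + 1))\<^sup>2))" for n
  proof -
    have "u k n \<le> ennreal C * (W k * (v k (n - 1) + v k n + v k (n + 1)))" for k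
    proof -
      have "1 / wt k n \<le> 1 / wt k 0" using wt_pos[of k 0] by (intro divide_left_mono) (auto simp: wt_def)
      then have "ennreal (1 / wt k n) \<le> W k" unfolding W_def by (rule ennreal_leI)
      then show ?thesis
        by (intro order_trans[OF gain] mult_left_mono mult_right_mono) auto
    qed
    then have "esum (\<lambda>k. u k n) \<le> esum (\<lambda>k. ennreal C * (W k * (v k (n - 1) + v k n + v k (n + 1))))"
      by (intro nn_integral_mono)
    also have "\<dots> = ennreal C * (R (n - 1) + R n + R (n + 1))"
      by (simp add: R_def nn_integral_cmult nn_integral_add distrib_left)
    finally have "(esum (\<lambda>k. u k n))\<^sup>2 \<le> (ennreal C * (R (n - 1) + R n + R (n + 1)))\<^sup>2"
      by (rule power_mono) simp
    also have "\<dots> \<le> (ennreal C)\<^sup>2 * (4 * ((R (n - 1))\<^sup>2 + (R n)\<^sup>2 + (R (n + 1))\<^sup>2))"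
      unfolding power_mult_distrib by (intro mult_left_mono ennreal_add3_power2_le) auto
    finally show ?thesis .
  qed
  then have "esum (\<lambda>n. (esum (\<lambda>k. u k n))\<^sup>2)
      \<le> esum (\<lambda>n. (ennreal C)\<^sup>2 * (4 * ((R (n - 1))\<^sup>2 + (R n)\<^sup>2 + (R (n + 1))\<^sup>2)))"
    by (intro nn_integral_mono)
  also have "\<dots> = (ennreal C)\<^sup>2 * (4 * (esum (\<lambda>n. (R n)\<^sup>2) + esum (\<lambda>n. (R n)\<^sup>2) + esum (\<lambda>n. (R n)\<^sup>2)))"
    using esum_shift_diff[of "\<lambda>n. (R n)\<^sup>2" 1] esum_shift[of "\<lambda>n. (R n)\<^sup>2" 1]
    by (simp add: nn_integral_cmult nn_integral_add)
  also have "\<dots> < \<infinity>"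
    using R_sum by (simp add: ennreal_mult_less_top power2_eq_square)
  finally show ?thesis .
qed

text \<open>The weight on \<open>v\<close> is moved onto one factor of each convolution. That factor
  is in weighted l^2 by induction; the other is summable over k by \<open>esum_slice_sums\<close>,
  as Young's inequality requires. The factor \<open>1 / wt k n\<close> of the gain then pays for the
  step from s to \<open>Suc s\<close>.\<close>

lemma esum_weighted_power:
  assumes "1 \<le> s"
  shows "esum (\<lambda>n. esum (\<lambda>k. (ennreal (wt k n ^ s) * u k n)\<^sup>2)) < \<infinity>"
  using assms
proof (induction s rule: dec_induct)
  case base
  then show ?case using energy by simp
next
  case (step s)
  define S where "S = esum (\<lambda>n. esum (\<lambda>k. (ennreal (wt k n ^ s) * u k n)\<^sup>2))"
  define T where "T n = esum (\<lambda>k. u k n)" for n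
  have S: "S < \<infinity>" using step.IH by (simp add: S_def)
  have T: "esum (\<lambda>n. (T n)\<^sup>2) < \<infinity>" using esum_slice_sums by (simp add: T_def)
  have T0: "(T 0)\<^sup>2 < \<infinity>" using esum_ge[of "\<lambda>n. (T n)\<^sup>2" 0] T by (rule le_less_trans)
  have S0: "esum (\<lambda>k. (ennreal (wt k 0 ^ s) * u k 0)\<^sup>2) \<le> S"
    unfolding S_def by (rule esum_ge[of "\<lambda>n. esum (\<lambda>k. (ennreal (wt k n ^ s) * u k n)\<^sup>2)" 0])
  define V where "V n = esum (\<lambda>k. (ennreal (wt k n ^ s) * v k n)\<^sup>2)" for n
  have V: "esum V < \<infinity>"
  proof -
    \<comment> \<open>\<open>?P\<close> has the weight on the factor coming from rho,
      \<open>?R\<close> on the one coming from f.\<close>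
    let ?P = "\<lambda>n k. esum (\<lambda>l. (ennreal (wt l 0 ^ s) * u l 0) * u (k - l) n)"
    let ?R = "\<lambda>n k. esum (\<lambda>l. (ennreal (wt l n ^ s) * u l n) * u (k - l) 0)"
    have v_le: "ennreal (wt k n ^ s) * v k n
        \<le> ennreal (wt k n ^ s) * u k n + ennreal (2 ^ s) * ?P n k + ennreal (2 ^ s) * ?R n k" for k n
    proof -
      have "ennreal (wt k n ^ s) * esum (\<lambda>l. u l 0 * u (k - l) n)
          \<le> esum (\<lambda>l. ennreal (2 ^ s) * ((ennreal (wt l 0 ^ s) * u l 0) * u (k - l) n)
               + ennreal (2 ^ s) * ((ennreal (wt (k - l) n ^ s) * u (k - l) n) * u l 0))"
        unfolding nn_integral_cmult[OF borel_measurable_count_space, symmetric]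
      proof (intro nn_integral_mono)
        fix l
        have "ennreal (wt k n ^ s) \<le> ennreal (2 ^ s) * (ennreal (wt l 0 ^ s) + ennreal (wt (k - l) n ^ s))"
          using ennreal_leI[OF wt_pow_add_le[of k n s l]] wt_pos
          by (simp add: ennreal_mult less_imp_le)
        then have "ennreal (wt k n ^ s) * (u l 0 * u (k - l) n)
            \<le> (ennreal (2 ^ s) * (ennreal (wt l 0 ^ s) + ennreal (wt (k - l) n ^ s))) * (u l 0 * u (k - l) n)"
          by (rule mult_right_mono) simp
        then show "ennreal (wt k n ^ s) * (u l 0 * u (k - l) n)
          \<le> ennreal (2 ^ s) * ((ennreal (wt l 0 ^ s) * u l 0) * u (k - l) n)
               + ennreal (2 ^ s) * ((ennreal (wt (k - l) n ^ s) * u (k - l) n) * u l 0)"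
          by (simp add: distrib_left distrib_right mult_ac)
      qed
      also have "\<dots> = ennreal (2 ^ s) * ?P n k
          + ennreal (2 ^ s) * esum (\<lambda>l. (ennreal (wt (k - l) n ^ s) * u (k - l) n) * u l 0)"
        by (simp add: nn_integral_add nn_integral_cmult)
      \<comment> \<open>Replacing l by k - l puts the weighted factor first, the l^2 position in
        \<open>esum_Young\<close>.\<close>
      also have "esum (\<lambda>l. (ennreal (wt (k - l) n ^ s) * u (k - l) n) * u l 0) = ?R n k"
        using esum_reflect[of "\<lambda>l. (ennreal (wt l n ^ s) * u l n) * u (k - l) 0" k] by simp
      finally show ?thesis by (simp add: v_def distrib_left add.assoc add_left_mono)
    qed
    have "V n \<le> 4 * (esum (\<lambda>k. (ennreal (wt k n ^ s) * u k n)\<^sup>2)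
        + (ennreal (2 ^ s))\<^sup>2 * ((T n)\<^sup>2 * S)
        + (ennreal (2 ^ s))\<^sup>2 * ((T 0)\<^sup>2 * esum (\<lambda>k. (ennreal (wt k n ^ s) * u k n)\<^sup>2)))" for n
    proof -
      have "V n \<le> esum (\<lambda>k. 4 * ((ennreal (wt k n ^ s) * u k n)\<^sup>2
          + (ennreal (2 ^ s) * ?P n k)\<^sup>2 + (ennreal (2 ^ s) * ?R n k)\<^sup>2))"
        unfolding V_def
        by (intro nn_integral_mono order_trans[OF power_mono[OF v_le] ennreal_add3_power2_le]) simp
      also have "\<dots> = 4 * (esum (\<lambda>k. (ennreal (wt k n ^ s) * u k n)\<^sup>2)
          + (ennreal (2 ^ s))\<^sup>2 * esum (\<lambda>k. (?P n k)\<^sup>2) + (ennreal (2 ^ s))\<^sup>2 * esum (\<lambda>k. (?R n k)\<^sup>2))"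
        by (simp add: nn_integral_add nn_integral_cmult power_mult_distrib)
      also have "\<dots> \<le> 4 * (esum (\<lambda>k. (ennreal (wt k n ^ s) * u k n)\<^sup>2)
        + (ennreal (2 ^ s))\<^sup>2 * ((T n)\<^sup>2 * S)
        + (ennreal (2 ^ s))\<^sup>2 * ((T 0)\<^sup>2 * esum (\<lambda>k. (ennreal (wt k n ^ s) * u k n)\<^sup>2)))"
      proof (intro mult_left_mono add_mono order_refl)
        \<comment> \<open>The two uses of Young differ in their dependence on n: here
          \<open>T n\<close> varies and is square summable, against the fixed slice 0; in the next
          one \<open>T 0\<close> is fixed and the weighted slice n is summed.\<close>
        show "esum (\<lambda>k. (?P n k)\<^sup>2) \<le> (T n)\<^sup>2 * S"
          using esum_Young[of "\<lambda>l. ennreal (wt l 0 ^ s) * u l 0" "\<lambda>l. u l n"] S0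
          unfolding T_def by (meson mult_left_mono order_trans zero_le)
        show "esum (\<lambda>k. (?R n k)\<^sup>2) \<le> (T 0)\<^sup>2 * esum (\<lambda>k. (ennreal (wt k n ^ s) * u k n)\<^sup>2)"
          using esum_Young[of "\<lambda>l. ennreal (wt l n ^ s) * u l n" "\<lambda>l. u l 0"]
          unfolding T_def .
      qed auto
      finally show ?thesis .
    qed
    then have "esum V \<le> esum (\<lambda>n. 4 * (esum (\<lambda>k. (ennreal (wt k n ^ s) * u k n)\<^sup>2)
        + (ennreal (2 ^ s))\<^sup>2 * ((T n)\<^sup>2 * S)
        + (ennreal (2 ^ s))\<^sup>2 * ((T 0)\<^sup>2 * esum (\<lambda>k. (ennreal (wt k n ^ s) * u k n)\<^sup>2))))"
      by (intro nn_integral_mono)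
    also have "\<dots> = 4 * (S + (ennreal (2 ^ s))\<^sup>2 * (esum (\<lambda>n. (T n)\<^sup>2) * S) + (ennreal (2 ^ s))\<^sup>2 * ((T 0)\<^sup>2 * S))"
      unfolding S_def by (simp add: nn_integral_add nn_integral_cmult nn_integral_multc)
    also have "\<dots> < \<infinity>"
      using S T T0 by (simp add: ennreal_mult_less_top power2_eq_square[of "ennreal _"])
    finally show ?thesis .
  qed
  let ?c = "ennreal C * ennreal (2 ^ s)"
  let ?y = "\<lambda>k n. ennreal (wt k n ^ s) * v k n"
  have u_le: "ennreal (wt k n ^ Suc s) * u k n \<le> ?c * (?y k (n - 1) + ?y k n + ?y k (n + 1))" for k n
  proof -
    have *: "ennreal (wt k n ^ s) \<le> ennreal (2 ^ s) * ennreal (wt k (n + j) ^ s)" if "\<bar>j\<bar> \<le> 1" for j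
      using ennreal_leI[OF wt_pow_neighbour[OF that, of k n s]] wt_pos
      by (simp add: ennreal_mult less_imp_le)
    have "ennreal (wt k n ^ Suc s) * u k n
        \<le> ennreal (wt k n ^ Suc s) * (ennreal C * (ennreal (1 / wt k n) * (v k (n - 1) + v k n + v k (n + 1))))"
      by (intro mult_left_mono gain) auto
    also have "\<dots> = ennreal C * ((ennreal (wt k n ^ Suc s) * ennreal (1 / wt k n)) * (v k (n - 1) + v k n + v k (n + 1)))"
      by (simp only: mult_ac)
    also have "ennreal (wt k n ^ Suc s) * ennreal (1 / wt k n) = ennreal (wt k n ^ s)"
      using wt_pos[of k n] by (simp add: ennreal_mult[symmetric] less_imp_le)
    also have "ennreal C * (ennreal (wt k n ^ s) * (v k (n - 1) + v k n + v k (n + 1)))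
        \<le> ennreal C * (ennreal (2 ^ s) * ennreal (wt k (n - 1) ^ s) * v k (n - 1)
            + ennreal (2 ^ s) * ennreal (wt k n ^ s) * v k n
            + ennreal (2 ^ s) * ennreal (wt k (n + 1) ^ s) * v k (n + 1))"
      unfolding distrib_left
      using *[of "- 1"] *[of 0] *[of 1] by (intro add_mono mult_left_mono mult_right_mono) auto
    finally show ?thesis by (simp add: distrib_left mult_ac)
  qed
  have "esum (\<lambda>k. (ennreal (wt k n ^ Suc s) * u k n)\<^sup>2) \<le> ?c\<^sup>2 * (4 * (V (n - 1) + V n + V (n + 1)))" for n
  proof -
    have "(ennreal (wt k n ^ Suc s) * u k n)\<^sup>2
        \<le> ?c\<^sup>2 * (4 * ((?y k (n - 1))\<^sup>2 + (?y k n)\<^sup>2 + (?y k (n + 1))\<^sup>2))" for k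
    proof -
      have "(ennreal (wt k n ^ Suc s) * u k n)\<^sup>2 \<le> (?c * (?y k (n - 1) + ?y k n + ?y k (n + 1)))\<^sup>2"
        by (rule power_mono[OF u_le]) simp
      also have "\<dots> = ?c\<^sup>2 * (?y k (n - 1) + ?y k n + ?y k (n + 1))\<^sup>2"
        by (rule power_mult_distrib)
      also have "\<dots> \<le> ?c\<^sup>2 * (4 * ((?y k (n - 1))\<^sup>2 + (?y k n)\<^sup>2 + (?y k (n + 1))\<^sup>2))"
        by (intro mult_left_mono ennreal_add3_power2_le) auto
      finally show ?thesis .
    qed
    then have "esum (\<lambda>k. (ennreal (wt k n ^ Suc s) * u k n)\<^sup>2)
        \<le> esum (\<lambda>k. ?c\<^sup>2 * (4 * ((?y k (n - 1))\<^sup>2 + (?y k n)\<^sup>2 + (?y k (n + 1))\<^sup>2)))"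
      by (intro nn_integral_mono)
    also have "\<dots> = ?c\<^sup>2 * (4 * (V (n - 1) + V n + V (n + 1)))"
      unfolding V_def by (simp add: nn_integral_add nn_integral_cmult)
    finally show ?thesis .
  qed
  then have "esum (\<lambda>n. esum (\<lambda>k. (ennreal (wt k n ^ Suc s) * u k n)\<^sup>2))
      \<le> esum (\<lambda>n. ?c\<^sup>2 * (4 * (V (n - 1) + V n + V (n + 1))))"
    by (intro nn_integral_mono)
  also have "\<dots> = ?c\<^sup>2 * (4 * (esum V + esum V + esum V))"
    using esum_shift_diff[of V 1] esum_shift[of V 1]
    by (simp add: nn_integral_add nn_integral_cmult)
  also have "\<dots> < \<infinity>"
    using V by (simp add: ennreal_mult_less_top power2_eq_square[of "_ * _"])
  finally show ?case .
qed

end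

section \<open>Smooth functions and a smooth step\<close>

text \<open>The recursion of \<open>C_k\<close> speaks about \<open>frechet_derivative\<close>; by
  uniqueness of derivatives any explicitly known derivative may stand in for it, so the usual
  derivative rules drive the inductions below.\<close>

lemma C_k_Suc_I:
  assumes "\<And>x. (f has_derivative f' x) (at x)" "\<And>b. b \<in> Basis \<Longrightarrow> C_k k (\<lambda>x. f' x b)"
  shows "C_k (Suc k) f"
proof -
  have "frechet_derivative f (at x) = f' x" for x
    using frechet_derivative_at[OF assms(1)] by simp
  then show ?thesis
    using assms by (auto simp: differentiable_on_def differentiable_def intro: has_derivative_at_withinI)
qed

lemma C_k_Suc_D:
  assumes "C_k (Suc k) f"
  shows "(f has_derivative frechet_derivative f (at x)) (at x)"
    and "b \<in> Basis \<Longrightarrow> C_k k (\<lambda>x. frechet_derivative f (at x) b)"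
  using assms by (auto simp: differentiable_on_def frechet_derivative_works)

lemma C_k_Suc_imp: "C_k (Suc k) f \<Longrightarrow> C_k k f"
proof (induction k arbitrary: f)
  case 0
  then show ?case by (auto simp: differentiable_imp_continuous_on)
next
  case (Suc k)
  show ?case
    by (rule C_k_Suc_I[OF C_k_Suc_D(1)[OF Suc.prems]]) (use Suc.IH C_k_Suc_D(2)[OF Suc.prems] in blast)
qed

lemma C_k_continuous: "C_k k f \<Longrightarrow> continuous_on UNIV f"
  by (induction k) (auto dest: C_k_Suc_imp differentiable_imp_continuous_on)

lemma C_k_const: "C_k k (\<lambda>x. c)"
proof (induction k arbitrary: c)
  case (Suc k)
  show ?case by (rule C_k_Suc_I[where f' = "\<lambda>x h. 0"]) (use Suc in auto)
qed auto

lemma C_k_add: "C_k k f \<Longrightarrow> C_k k g \<Longrightarrow> C_k k (\<lambda>x. f x + g x)"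
proof (induction k arbitrary: f g)
  case (Suc k)
  show ?case
    by (rule C_k_Suc_I[OF has_derivative_add[OF C_k_Suc_D(1)[OF Suc.prems(1)] C_k_Suc_D(1)[OF Suc.prems(2)]]])
      (use Suc.IH Suc.prems C_k_Suc_D(2) in blast)
qed (auto intro!: continuous_intros)

lemma C_k_mult: "C_k k f \<Longrightarrow> C_k k g \<Longrightarrow> C_k k (\<lambda>x. f x * g x)"
proof (induction k arbitrary: f g)
  case (Suc k)
  show ?case
    by (rule C_k_Suc_I[OF has_derivative_mult[OF C_k_Suc_D(1)[OF Suc.prems(1)] C_k_Suc_D(1)[OF Suc.prems(2)]]])
      (intro C_k_add Suc.IH C_k_Suc_imp[OF Suc.prems(1)] C_k_Suc_imp[OF Suc.prems(2)]
        C_k_Suc_D(2)[OF Suc.prems(1)] C_k_Suc_D(2)[OF Suc.prems(2)])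
qed (auto intro!: continuous_intros)

lemma C_k_minus: "C_k k f \<Longrightarrow> C_k k (\<lambda>x. - f x)"
  using C_k_mult[OF C_k_const[of k "- 1"], of f] by simp

lemma C_k_diff: "C_k k f \<Longrightarrow> C_k k g \<Longrightarrow> C_k k (\<lambda>x. f x - g x)"
  using C_k_add[OF _ C_k_minus, of k f g] by simp

lemma C_k_prod: "(\<And>i. i \<in> I \<Longrightarrow> C_k k (f i)) \<Longrightarrow> C_k k (\<lambda>x. \<Prod>i\<in>I. f i x)"
  by (induction I rule: infinite_finite_induct) (auto intro: C_k_const C_k_mult)

lemma C_k_inverse:
  assumes "\<And>x. f x \<noteq> 0"
  shows "C_k k f \<Longrightarrow> C_k k (\<lambda>x. inverse (f x))"
proof (induction k)
  case 0
  then show ?case using assms by (auto intro!: continuous_intros)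
next
  case (Suc k)
  have "((\<lambda>x. inverse (f x)) has_derivative
      (\<lambda>h. - (inverse (f x) * frechet_derivative f (at x) h * inverse (f x)))) (at x)" for x
    by (rule Deriv.has_derivative_inverse[OF assms C_k_Suc_D(1)[OF Suc.prems]])
  then show ?case
    by (rule C_k_Suc_I) (intro C_k_minus C_k_mult Suc.IH C_k_Suc_imp[OF Suc.prems] C_k_Suc_D(2)[OF Suc.prems])
qed

lemma C_k_Suc_real_I:
  fixes f :: "real \<Rightarrow> real"
  assumes "\<And>x. (f has_real_derivative f' x) (at x)" "C_k k f'"
  shows "C_k (Suc k) f"
  by (rule C_k_Suc_I[OF assms(1)[unfolded has_field_derivative_def]]) (use assms(2) in auto)

lemma C_k_compose_affine:
  fixes \<eta> :: "real \<Rightarrow> real"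
  shows "C_k k \<eta> \<Longrightarrow> C_k k (\<lambda>x. \<eta> (x \<bullet> v + a))"
proof (induction k arbitrary: \<eta>)
  case 0
  then show ?case by (auto intro!: continuous_on_compose2[of UNIV \<eta>] continuous_intros)
next
  case (Suc k)
  let ?D = "\<lambda>t. frechet_derivative \<eta> (at t)"
  have "((\<lambda>x. \<eta> (x \<bullet> v + a)) has_derivative (\<lambda>h. ?D (x \<bullet> v + a) (h \<bullet> v))) (at x)" for x
    by (rule has_derivative_compose[OF _ C_k_Suc_D(1)[OF Suc.prems]])
      (auto intro!: derivative_eq_intros)
  moreover have lin: "?D t s = s * ?D t 1" for t s
    using linear_scale[OF has_derivative_linear[OF C_k_Suc_D(1)[OF Suc.prems, of t]], of s 1] by simp
  ultimately have "((\<lambda>x. \<eta> (x \<bullet> v + a)) has_derivative (\<lambda>h. (h \<bullet> v) * ?D (x \<bullet> v + a) 1)) (at x)" for x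
    by (subst (asm) lin)
  then show ?case
    by (rule C_k_Suc_I) (intro C_k_mult C_k_const Suc.IH[where \<eta> = "\<lambda>t. ?D t 1"] C_k_Suc_D(2)[OF Suc.prems], simp)
qed

lemma C_k_sin_cos: "C_k k (sin :: real \<Rightarrow> real) \<and> C_k k (cos :: real \<Rightarrow> real)"
proof (induction k)
  case (Suc k)
  have "C_k (Suc k) (sin :: real \<Rightarrow> real)"
    by (rule C_k_Suc_real_I[where f' = cos]) (use Suc in \<open>auto intro: derivative_eq_intros\<close>)
  moreover have "C_k (Suc k) (cos :: real \<Rightarrow> real)"
    by (rule C_k_Suc_real_I[where f' = "\<lambda>x. - sin x"]) (use Suc in \<open>auto intro: derivative_eq_intros C_k_minus\<close>)
  ultimately show ?case ..
qed (auto intro!: continuous_intros)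

section \<open>A function flat at the origin and a smooth step\<close>

text \<open>All derivatives of \<open>exp (- (1 / t))\<close> are again of the form \<open>poly p (1 / t) * exp (- (1 / t))\<close>.\<close>

definition flat :: "real poly \<Rightarrow> real \<Rightarrow> real" where
  "flat p t = (if t \<le> 0 then 0 else poly p (1 / t) * exp (- (1 / t)))"

lemma tendsto_poly_exp_neg: "((\<lambda>s. poly p s * exp (- s)) \<longlongrightarrow> (0::real)) at_top"
proof (induction p)
  case (pCons a p)
  have "((\<lambda>s. poly (pCons a p) s * exp (- s)) \<longlongrightarrow> 0) at_top"
  proof -
    have "((\<lambda>s. \<Sum>i\<le>degree (pCons a p). coeff (pCons a p) i * (s ^ i / exp s)) \<longlongrightarrow>
        (\<Sum>i\<le>degree (pCons a p). coeff (pCons a p) i * 0)) at_top"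
      by (intro tendsto_sum tendsto_mult tendsto_const tendsto_power_div_exp_0)
    moreover have "(\<lambda>s. \<Sum>i\<le>degree (pCons a p). coeff (pCons a p) i * (s ^ i / exp s))
        = (\<lambda>s. poly (pCons a p) s * exp (- s))"
      by (intro ext) (simp only: poly_altdef sum_distrib_right exp_minus field_class.field_divide_inverse mult.assoc)
    ultimately show ?thesis by simp
  qed
  then show ?case .
qed auto

text \<open>In the variable s = 1 / t the operator d/dt is -s^2 d/ds, which turns p(s) exp(-s) into
  s^2 (p - p')(s) exp(-s); \<open>[:0, 0, 1:]\<close> is s^2.\<close>

lemma DERIV_flat: "(flat p has_real_derivative flat ([:0, 0, 1:] * (p - pderiv p)) t) (at t)"
proof -
  consider "t < 0" | "t > 0" | "t = 0" by linarith
  then show ?thesis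
  proof cases
    case 1
    have "((\<lambda>_. 0) has_real_derivative 0) (at t)" by simp
    then have "(flat p has_real_derivative 0) (at t)"
      by (rule has_field_derivative_transform_within_open[where S = "{..<0}"])
        (use 1 in \<open>auto simp: flat_def\<close>)
    then show ?thesis using 1 by (simp add: flat_def)
  next
    case 2
    have "((\<lambda>t. poly p (1 / t) * exp (- (1 / t))) has_real_derivative
        flat ([:0, 0, 1:] * (p - pderiv p)) t) (at t)"
      using 2
      by (auto intro!: derivative_eq_intros DERIV_chain2[OF poly_DERIV] simp: flat_def)
        (simp add: field_simps power2_eq_square)
    then show ?thesis
      by (rule has_field_derivative_transform_within_open[where S = "{0<..}"])
        (use 2 in \<open>auto simp: flat_def\<close>)
  next
    case 3
    have "((\<lambda>h. flat p h / h) \<longlongrightarrow> 0) (at 0)"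
    proof (rule filterlim_split_at)
      show "((\<lambda>h. flat p h / h) \<longlongrightarrow> 0) (at_left 0)"
        by (rule tendsto_eventually) (auto simp: flat_def eventually_at_filter)
      \<comment> \<open>From the right the difference quotient at 0 is s p(s) exp(-s) with s = 1 /
        h, again a polynomial times a decaying exponential.\<close>
      have "((\<lambda>h. poly (pCons 0 p) (inverse h) * exp (- (inverse h))) \<longlongrightarrow> 0) (at_right 0)"
        by (rule filterlim_compose[OF tendsto_poly_exp_neg filterlim_inverse_at_top_right])
      then show "((\<lambda>h. flat p h / h) \<longlongrightarrow> 0) (at_right 0)"
        by (rule Lim_transform_eventually)
          (auto simp: flat_def eventually_at_filter divide_inverse)
    qed
    then show ?thesis using 3 by (simp add: DERIV_def flat_def)
  qed
qed

lemma C_k_flat: "C_k k (flat p)"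
proof (induction k arbitrary: p)
  case 0
  then show ?case
    by (auto intro!: continuous_at_imp_continuous_on DERIV_isCont[OF DERIV_flat])
next
  case (Suc k)
  show ?case by (rule C_k_Suc_real_I[OF DERIV_flat Suc.IH])
qed

text \<open>The standard smooth transition from 0 to 1 on the unit interval. The denominator is
  positive because t and 1 - t are never both nonpositive.\<close>

definition step :: "real \<Rightarrow> real" where
  "step t = flat 1 t * inverse (flat 1 t + flat 1 (1 - t))"

lemma flat_1_pos: "0 < t \<Longrightarrow> 0 < flat 1 t" and flat_nonpos: "t \<le> 0 \<Longrightarrow> flat p t = 0"
  by (auto simp: flat_def)

lemma flat_1_nonneg: "0 \<le> flat 1 t" by (simp add: flat_def)

lemma step_nonpos: "t \<le> 0 \<Longrightarrow> step t = 0"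
  by (simp add: step_def flat_nonpos)

lemma step_ge_1: "1 \<le> t \<Longrightarrow> step t = 1"
  using flat_1_pos[of t] by (simp add: step_def flat_nonpos)

lemma C_k_step: "C_k k step"
proof -
  have "flat 1 t + flat 1 (1 - t) \<noteq> 0" for t
    using flat_1_pos[of t] flat_1_pos[of "1 - t"] flat_1_nonneg[of t] flat_1_nonneg[of "1 - t"] by linarith
  moreover have "C_k k (\<lambda>t. flat 1 (1 - t))"
    using C_k_compose_affine[OF C_k_flat, of k 1 "- 1 :: real" 1] by (simp add: add.commute[of _ 1])
  ultimately have "C_k k (\<lambda>t. flat 1 t * inverse (flat 1 t + flat 1 (1 - t)))"
    by (intro C_k_mult C_k_inverse C_k_add C_k_flat)
  then show ?thesis by (simp add: step_def[abs_def])
qed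

section \<open>Trigonometric polynomials on the torus\<close>

lemma Basis_point: "b \<in> (Basis :: point set) \<longleftrightarrow> b = (axis 1 1, 0) \<or> b = (axis 2 1, 0) \<or> b = (0, 1)"
  by (auto simp: Basis_prod_def Basis_vec_def exhaust_2 UNIV_2)

lemma Basis_point_eq: "(Basis :: point set) = {(axis 1 1, 0), (axis 2 1, 0), (0, 1)}"
  using Basis_point by auto

lemma Upsilon_iff: "\<xi> \<in> Upsilon \<longleftrightarrow> (\<forall>b\<in>Basis. 0 < \<xi> \<bullet> b \<and> \<xi> \<bullet> b < 2 * pi)"
  by (cases \<xi>) (simp add: Basis_point_eq Upsilon_def Omega_def inner_axis forall_2 conj_ac)

lemma Upsilon_eq_box: "Upsilon = box 0 ((2 * pi) *\<^sub>R \<Sum>Basis)"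
  by (auto simp: set_eq_iff Upsilon_iff mem_box inner_sum_left inner_Basis)

lemma open_Upsilon: "open Upsilon" and bounded_Upsilon: "bounded Upsilon"
  by (auto simp: Upsilon_eq_box)

lemma Upsilon_lmeasurable: "Upsilon \<in> lmeasurable"
  by (simp add: Upsilon_eq_box)

lemma Upsilon_sets [simp]: "Upsilon \<in> sets lebesgue" "Upsilon \<in> sets lborel" "Upsilon \<in> sets borel"
  using open_Upsilon by auto

abbreviation cell :: "point measure" where
  "cell \<equiv> lebesgue_on Upsilon"

lemma finite_measure_cell: "finite_measure cell"
  using finite_measure_lebesgue_on[OF Upsilon_lmeasurable] .

definition freq :: "(int \<times> int) \<times> int \<Rightarrow> point" where
  "freq k = (vector [of_int (fst (fst k)), of_int (snd (fst k))], of_int (snd k))"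

lemma inner_freq: "freq k \<bullet> \<xi> = of_int (fst (fst k)) * (fst \<xi> $ 1) + of_int (snd (fst k)) * (fst \<xi> $ 2) + of_int (snd k) * snd \<xi>"
  by (simp add: freq_def inner_prod_def inner_vec_def sum_2)

lemma freq_add: "freq (k + l) = freq k + freq l"
  by (simp add: freq_def vec_eq_iff forall_2 prod_eq_iff)

lemma freq_minus: "freq (- k) = - freq k"
  by (simp add: freq_def vec_eq_iff forall_2 prod_eq_iff)

lemma freq_0 [simp]: "freq 0 = 0"
  by (simp add: freq_def vec_eq_iff forall_2 prod_eq_iff)

definition expo :: "(int \<times> int) \<times> int \<Rightarrow> point \<Rightarrow> complex" where
  "expo k \<xi> = cis (freq k \<bullet> \<xi>)"

lemma norm_expo [simp]: "norm (expo k \<xi>) = 1" by (simp add: expo_def)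
lemma expo_0 [simp]: "expo 0 \<xi> = 1" by (simp add: expo_def)
lemma expo_add: "expo (k + l) \<xi> = expo k \<xi> * expo l \<xi>" by (simp add: expo_def freq_add inner_add_left cis_mult)
lemma expo_minus: "expo (- k) \<xi> = cnj (expo k \<xi>)" by (simp add: expo_def freq_minus cis_cnj)

lemma continuous_expo: "continuous_on S (expo k)"
  unfolding expo_def by (intro continuous_intros)

text \<open>The inductive form gives the closure properties by rule induction; the representation as
  one finite sum with given coefficients is recovered in \<open>trig_finite_sum\<close>.\<close>

inductive trig :: "(point \<Rightarrow> complex) \<Rightarrow> bool" where
  trig_expo: "trig (\<lambda>\<xi>. c * expo k \<xi>)"
| trig_add: "trig p \<Longrightarrow> trig q \<Longrightarrow> trig (\<lambda>\<xi>. p \<xi> + q \<xi>)"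

lemma trig_const: "trig (\<lambda>\<xi>. c)"
  using trig_expo[of c 0] by simp

lemma trig_cmult: "trig p \<Longrightarrow> trig (\<lambda>\<xi>. c * p \<xi>)"
proof (induction rule: trig.induct)
  case (trig_expo d k)
  then show ?case using trig.trig_expo[of "c * d" k] by (simp add: mult.assoc)
next
  case (trig_add p q)
  then show ?case using trig.trig_add[OF trig_add.IH] by (simp add: distrib_left)
qed

lemma trig_sum: "(\<And>i. i \<in> I \<Longrightarrow> trig (p i)) \<Longrightarrow> trig (\<lambda>\<xi>. \<Sum>i\<in>I. p i \<xi>)"
  by (induction I rule: infinite_finite_induct) (auto intro: trig_add trig_const)

lemma trig_mult_expo: "trig p \<Longrightarrow> trig (\<lambda>\<xi>. p \<xi> * expo k \<xi>)"
proof (induction rule: trig.induct)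
  case (trig_expo c l)
  then show ?case using trig.trig_expo[of c "l + k"] by (simp add: mult.assoc expo_add)
next
  case (trig_add p q)
  then show ?case using trig.trig_add[OF trig_add.IH] by (simp add: distrib_right)
qed

lemma trig_mult: "trig q \<Longrightarrow> trig p \<Longrightarrow> trig (\<lambda>\<xi>. p \<xi> * q \<xi>)"
proof (induction rule: trig.induct)
  case (trig_expo c l)
  then show ?case using trig_cmult[OF trig_mult_expo[of p l], of c] by (simp add: mult_ac)
next
  case (trig_add q r)
  then show ?case using trig.trig_add[OF trig_add.IH] by (simp add: distrib_left)
qed

lemma continuous_trig: "trig p \<Longrightarrow> continuous_on S p"
  by (induction rule: trig.induct) (auto intro!: continuous_intros continuous_expo)

lemma trig_finite_sum:
  "trig p \<Longrightarrow> \<exists>F c. finite F \<and> p = (\<lambda>\<xi>. \<Sum>k\<in>F. c k * expo k \<xi>)"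
proof (induction rule: trig.induct)
  case (trig_expo c k)
  show ?case by (rule exI[of _ "{k}"], rule exI[of _ "\<lambda>_. c"]) simp
next
  case (trig_add p q)
  then obtain F c G d where *: "finite F" "p = (\<lambda>\<xi>. \<Sum>k\<in>F. c k * expo k \<xi>)"
    "finite G" "q = (\<lambda>\<xi>. \<Sum>k\<in>G. d k * expo k \<xi>)" by blast
  let ?e = "\<lambda>k. (if k \<in> F then c k else 0) + (if k \<in> G then d k else 0)"
  have "(\<Sum>k\<in>F \<union> G. ?e k * expo k \<xi>) = p \<xi> + q \<xi>" for \<xi>
    unfolding *(2,4) distrib_right sum.distrib
    by (intro arg_cong2[of _ _ _ _ "(+)"] sum.mono_neutral_cong_right) (use *(1,3) in auto)
  then show ?case using *(1,3) by (intro exI[of _ "F \<union> G"] exI[of _ ?e]) auto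
qed

section \<open>Approximation by trigonometric polynomials\<close>

text \<open>Realises the torus as a compact subset of a Euclidean space, where Stone-Weierstrass for
  polynomials applies.\<close>

definition torus_map :: "point \<Rightarrow> complex \<times> complex \<times> complex" where
  "torus_map \<xi> = (expo ((1, 0), 0) \<xi>, expo ((0, 1), 0) \<xi>, expo ((0, 0), 1) \<xi>)"

lemma trig_Re_expo: "trig (\<lambda>\<xi>. of_real (Re (expo k \<xi>)))"
proof -
  have "of_real (Re (expo k \<xi>)) = (1/2) * expo k \<xi> + (1/2) * expo (- k) \<xi>" for \<xi>
    by (simp add: expo_minus complex_eq_iff)
  then show ?thesis using trig_add[OF trig_expo trig_expo, of "1/2" k "1/2" "- k"] by simp
qed

lemma trig_Im_expo: "trig (\<lambda>\<xi>. of_real (Im (expo k \<xi>)))"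
proof -
  have "of_real (Im (expo k \<xi>)) = (- \<i>/2) * expo k \<xi> + (\<i>/2) * expo (- k) \<xi>" for \<xi>
    by (simp add: expo_minus complex_eq_iff)
  then show ?thesis using trig_add[OF trig_expo trig_expo, of "- \<i>/2" k "\<i>/2" "- k"] by simp
qed

text \<open>The coordinates of \<open>torus_map\<close> are real and imaginary parts of
  exponentials, hence trigonometric polynomials, and these form an algebra.\<close>

lemma trig_polynomial_torus_map:
  "real_polynomial_function p \<Longrightarrow> trig (\<lambda>\<xi>. of_real (p (torus_map \<xi>)))"
proof (induction rule: real_polynomial_function.induct)
  case (linear L)
  then interpret bounded_linear L .
  have L: "L y = (\<Sum>b\<in>Basis. L b * (y \<bullet> b))" for y
  proof -
    have "L y = L (\<Sum>b\<in>Basis. (y \<bullet> b) *\<^sub>R b)" by (simp add: euclidean_representation)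
    then show ?thesis by (simp add: sum scaleR mult.commute)
  qed
  have "trig (\<lambda>\<xi>. of_real (L b) * of_real (torus_map \<xi> \<bullet> b))" if "b \<in> Basis" for b
  proof -
    have "trig (\<lambda>\<xi>. of_real (torus_map \<xi> \<bullet> b))"
      using that trig_Re_expo trig_Im_expo
      unfolding Basis_prod_def Basis_complex_def torus_map_def by (elim UnE imageE insertE) simp_all
    then show ?thesis by (rule trig_cmult)
  qed
  then have "trig (\<lambda>\<xi>. \<Sum>b\<in>Basis. of_real (L b) * of_real (torus_map \<xi> \<bullet> b))"
    by (rule trig_sum)
  then show ?case by (subst L) (simp only: of_real_sum of_real_mult)
next
  case (const c)
  show ?case by (rule trig_const)
next
  case (add f g)
  then show ?case using trig_add by simp
next
  case (mult f g)
  then show ?case using trig_mult by simp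
qed

text \<open>Strict inequalities for a alone already give |a - b| < 2 pi, which rules out the
  identification of the two end points.\<close>

lemma cis_eq_in_period:
  assumes "cis a = cis b" "0 < a" "a < 2 * pi" "0 \<le> b" "b \<le> 2 * pi"
  shows "a = b"
proof -
  have "cos a = cos b" "sin a = sin b" using assms(1) by (simp_all add: complex_eq_iff)
  then obtain n :: int where n: "a = b + 2 * pi * n"
    using sin_cos_eq_iff[of a b] by (metis mult.commute mult.left_commute)
  have "\<bar>a - b\<bar> < 2 * pi" using assms(2-) by (simp add: abs_less_iff)
  then have "\<bar>2 * pi * n\<bar> < 2 * pi * 1" using n by simp
  then have "\<bar>real_of_int n\<bar> < 1" by (simp add: abs_mult)
  then have "n = 0" by linarith
  then show ?thesis using n by simp
qed

lemma torus_map_inj: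
  assumes "torus_map \<xi> = torus_map \<zeta>" "\<xi> \<in> Upsilon" "\<zeta> \<in> cbox 0 ((2 * pi) *\<^sub>R \<Sum>Basis)"
  shows "\<xi> = \<zeta>"
proof -
  have z: "\<forall>b\<in>Basis. 0 \<le> \<zeta> \<bullet> b \<and> \<zeta> \<bullet> b \<le> 2 * pi"
    using assms(3) by (auto simp: mem_box inner_sum_left inner_Basis)
  have "cis (fst \<xi> $ 1) = cis (fst \<zeta> $ 1)" "cis (fst \<xi> $ 2) = cis (fst \<zeta> $ 2)" "cis (snd \<xi>) = cis (snd \<zeta>)"
    using assms(1) by (simp_all add: torus_map_def expo_def inner_freq)
  then have c: "cis (\<xi> \<bullet> b) = cis (\<zeta> \<bullet> b)" if "b \<in> Basis" for b
    using that by (auto simp: Basis_point inner_prod_def inner_axis)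
  show ?thesis
  proof (rule euclidean_eqI)
    fix b :: point assume b: "b \<in> Basis"
    show "\<xi> \<bullet> b = \<zeta> \<bullet> b"
      by (rule cis_eq_in_period[OF c[OF b]]) (use assms(2) z b in \<open>auto simp: Upsilon_iff\<close>)
  qed
qed

text \<open>A function vanishing on the faces descends to a continuous function on the torus, which
  Stone-Weierstrass approximates by polynomials in the coordinates of
  \<open>torus_map\<close>.\<close>

lemma trig_approx_continuous:
  fixes w :: "point \<Rightarrow> real"
  assumes "continuous_on UNIV w" "\<And>\<xi>. \<xi> \<notin> Upsilon \<Longrightarrow> w \<xi> = 0" "0 < e"
  obtains p where "trig p" "\<And>\<xi>. \<xi> \<in> Upsilon \<Longrightarrow> norm (p \<xi> - of_real (w \<xi>)) < e"
proof -
  define S :: "point set" where "S = cbox 0 ((2 * pi) *\<^sub>R \<Sum>Basis)"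
  \<comment> \<open>A section of \<open>torus_map\<close> over the closed cell, in general
    discontinuous; only its composition with w has to be continuous.\<close>
  define q where "q y = (SOME \<xi>. \<xi> \<in> S \<and> torus_map \<xi> = y)" for y
  have US: "Upsilon \<subseteq> S" unfolding S_def Upsilon_eq_box by (rule box_subset_cbox)
  have q: "q (torus_map \<xi>) \<in> S \<and> torus_map (q (torus_map \<xi>)) = torus_map \<xi>" if "\<xi> \<in> S" for \<xi>
    unfolding q_def by (rule someI[of _ \<xi>]) (use that in auto)
  \<comment> \<open>Two points of the closed cell with the same image coincide as soon as one is
    interior; otherwise both lie on faces, where w is 0.\<close>
  have wq: "w (q (torus_map \<xi>)) = w \<xi>" if "\<xi> \<in> S" for \<xi>
  proof (cases "\<xi> \<in> Upsilon \<or> q (torus_map \<xi>) \<in> Upsilon")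
    case True
    then have "q (torus_map \<xi>) = \<xi>"
      using torus_map_inj q[OF that] that unfolding S_def by metis
    then show ?thesis by simp
  next
    case False
    then show ?thesis using assms(2) by simp
  qed
  have cont: "continuous_on S torus_map"
    unfolding torus_map_def[abs_def] by (intro continuous_intros continuous_expo)
  have "compact S" unfolding S_def by simp
  \<comment> \<open>A continuous map from a compact set is a quotient map onto its image, so
    preimages under \<open>torus_map\<close> decide openness there.\<close>
  have "continuous_on (torus_map ` S) (\<lambda>y. w (q y))"
    unfolding continuous_on_open_gen[of "\<lambda>y. w (q y)" "torus_map ` S" UNIV, simplified]
  proof (intro allI impI)
    fix U :: "real set" assume "open U"
    let ?V = "torus_map ` S \<inter> (\<lambda>y. w (q y)) -` U"
    have "S \<inter> torus_map -` ?V = S \<inter> w -` U"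
    proof (rule set_eqI)
      fix \<xi> show "\<xi> \<in> S \<inter> torus_map -` ?V \<longleftrightarrow> \<xi> \<in> S \<inter> w -` U"
        using wq[of \<xi>] by (cases "\<xi> \<in> S") simp_all
    qed
    moreover have "openin (top_of_set S) (S \<inter> w -` U)"
      using continuous_on_subset[OF assms(1), of S] \<open>open U\<close>
      by (auto simp: continuous_on_open_gen[of w S UNIV, simplified])
    ultimately show "openin (top_of_set (torus_map ` S)) ?V"
      using Abstract_Topology_2.continuous_imp_quotient_map[OF cont refl \<open>compact S\<close>, of ?V] by simp
  qed
  then obtain g where g: "real_polynomial_function g" "\<And>y. y \<in> torus_map ` S \<Longrightarrow> \<bar>w (q y) - g y\<bar> < e"
    using Stone_Weierstrass_real_polynomial_function[OF compact_continuous_image[OF cont \<open>compact S\<close>] _ \<open>0 < e\<close>]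
    by metis
  show thesis
  proof
    show "trig (\<lambda>\<xi>. of_real (g (torus_map \<xi>)))" by (rule trig_polynomial_torus_map[OF g(1)])
    fix \<xi> assume "\<xi> \<in> Upsilon"
    then have "\<bar>w \<xi> - g (torus_map \<xi>)\<bar> < e" using g(2) wq US by (metis image_eqI subsetD)
    then show "norm (complex_of_real (g (torus_map \<xi>)) - of_real (w \<xi>)) < e"
      by (simp only: of_real_diff[symmetric] norm_of_real abs_minus_commute)
  qed
qed

text \<open>A measurable function is an almost everywhere limit of continuous ones. Truncating these
  at B and cutting them off near the faces makes them approximable; the approximation error 1 / (n +
  1) accounts for the bound \<open>B + 1\<close>.\<close>

lemma trig_approx_bounded:
  fixes s :: "point \<Rightarrow> real"
  assumes s: "s \<in> borel_measurable lebesgue" and B: "\<And>\<xi>. \<bar>s \<xi>\<bar> \<le> B"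
  shows "\<exists>p. (\<forall>n. trig (p n)) \<and> (\<forall>n. \<forall>\<xi>\<in>Upsilon. norm (p n \<xi>) \<le> B + 1) \<and>
    (AE \<xi> in lebesgue. \<xi> \<in> Upsilon \<longrightarrow> (\<lambda>n. p n \<xi>) \<longlonglongrightarrow> of_real (s \<xi>))"
proof -
  have "0 \<le> B" using B[of 0] by linarith
  have "s measurable_on UNIV"
    using s lebesgue_measurable_imp_measurable_on[of s UNIV] by simp
  then obtain N g where N: "negligible N" and gc: "\<And>n. continuous_on UNIV (g n)"
    and g: "\<And>x. x \<notin> N \<Longrightarrow> (\<lambda>n. g n x) \<longlonglongrightarrow> s x"
    unfolding measurable_on_def by auto
  \<comment> \<open>The cutoff vanishes outside the open cell and is eventually 1 at each of its
    points.\<close>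
  define c where "c n \<xi> = min 1 (real n * infdist \<xi> (- Upsilon))" for n \<xi>
  define w where "w n \<xi> = c n \<xi> * max (- B) (min B (g n \<xi>))" for n \<xi>
  have "(0, 1) \<in> (Basis :: point set)" by (simp add: Basis_point)
  then have "0 \<in> - Upsilon" unfolding Upsilon_iff Compl_iff by force
  then have ne: "- Upsilon \<noteq> {}" by blast
  have "continuous_on UNIV (w n)" for n
    unfolding w_def[abs_def] c_def by (intro continuous_intros gc)
  moreover have "w n \<xi> = 0" if "\<xi> \<notin> Upsilon" for n \<xi>
    using that by (simp add: w_def c_def)
  ultimately have "\<exists>p. trig p \<and> (\<forall>\<xi>\<in>Upsilon. norm (p \<xi> - of_real (w n \<xi>)) < 1 / real (Suc n))" for n
    using trig_approx_continuous[of "w n" "1 / real (Suc n)"] by (metis of_nat_0_less_iff zero_less_Suc zero_less_divide_1_iff)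
  then obtain p where p: "\<And>n. trig (p n)"
    "\<And>n \<xi>. \<xi> \<in> Upsilon \<Longrightarrow> norm (p n \<xi> - of_real (w n \<xi>)) < 1 / real (Suc n)" by metis
  have w_le: "\<bar>w n \<xi>\<bar> \<le> B" for n \<xi>
  proof -
    have "\<bar>c n \<xi>\<bar> \<le> 1" by (auto simp: c_def abs_le_iff infdist_nonneg intro: order_trans[of "-1" 0])
    moreover have "\<bar>max (- B) (min B (g n \<xi>))\<bar> \<le> B" using \<open>0 \<le> B\<close> by auto
    ultimately show ?thesis
      unfolding w_def abs_mult using mult_mono[of "\<bar>c n \<xi>\<bar>" 1] by fastforce
  qed
  show ?thesis
  proof (intro exI[of _ p] conjI allI ballI)
    show "trig (p n)" for n by (rule p)
    show "norm (p n \<xi>) \<le> B + 1" if "\<xi> \<in> Upsilon" for n \<xi>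
    proof -
      have "norm (p n \<xi>) \<le> norm (p n \<xi> - of_real (w n \<xi>)) + norm (complex_of_real (w n \<xi>))"
        using norm_triangle_ineq[of "p n \<xi> - of_real (w n \<xi>)" "of_real (w n \<xi>)"] by simp
      also have "\<dots> \<le> 1 / real (Suc n) + B"
        using p(2)[OF that, of n] w_le by (intro add_mono) auto
      also have "\<dots> \<le> B + 1" by simp
      finally show ?thesis .
    qed
    have "(\<lambda>n. p n \<xi>) \<longlonglongrightarrow> of_real (s \<xi>)" if "\<xi> \<notin> N" "\<xi> \<in> Upsilon" for \<xi>
    proof -
      have pos: "infdist \<xi> (- Upsilon) > 0"
      proof -
        have "infdist \<xi> (- Upsilon) \<noteq> 0"
          using in_closed_iff_infdist_zero[of "- Upsilon" \<xi>] ne that(2) open_Upsilon by auto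
        then show ?thesis using infdist_nonneg[of \<xi> "- Upsilon"] by linarith
      qed
      have "(\<lambda>n. c n \<xi>) \<longlonglongrightarrow> 1"
      proof (rule tendsto_eventually)
        obtain m :: nat where m: "1 \<le> real m * infdist \<xi> (- Upsilon)"
          using reals_Archimedean3[OF pos] less_imp_le by blast
        have "c n \<xi> = 1" if "m \<le> n" for n
        proof -
          have "real m * infdist \<xi> (- Upsilon) \<le> real n * infdist \<xi> (- Upsilon)"
            using that pos by (intro mult_right_mono) auto
          then show ?thesis using m by (simp add: c_def)
        qed
        then show "\<forall>\<^sub>F n in sequentially. c n \<xi> = 1" by (auto simp: eventually_sequentially)
      qed
      moreover have "(\<lambda>n. max (- B) (min B (g n \<xi>))) \<longlonglongrightarrow> max (- B) (min B (s \<xi>))"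
        by (intro tendsto_intros g that)
      moreover have "max (- B) (min B (s \<xi>)) = s \<xi>" using B[of \<xi>] by auto
      ultimately have "(\<lambda>n. w n \<xi>) \<longlonglongrightarrow> 1 * s \<xi>" unfolding w_def by (intro tendsto_mult) auto
      then have "(\<lambda>n. complex_of_real (w n \<xi>)) \<longlonglongrightarrow> of_real (s \<xi>)" by (intro tendsto_of_real) simp
      moreover have "(\<lambda>n. p n \<xi> - of_real (w n \<xi>)) \<longlonglongrightarrow> 0"
        by (rule Lim_null_comparison[OF _ LIMSEQ_inverse_real_of_nat])
          (use p(2)[OF that(2)] in \<open>auto intro!: always_eventually less_imp_le simp: inverse_eq_divide\<close>)
      ultimately show ?thesis using tendsto_add by fastforce
    qed
    moreover have "AE \<xi> in lebesgue. \<xi> \<notin> N"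
      using N by (simp add: negligible_iff_null_sets AE_not_in)
    ultimately show "AE \<xi> in lebesgue. \<xi> \<in> Upsilon \<longrightarrow> (\<lambda>n. p n \<xi>) \<longlonglongrightarrow> of_real (s \<xi>)"
      by (auto elim: eventually_mono)
  qed
qed

section \<open>Uniqueness of Fourier coefficients of integrable functions\<close>

lemma AE_cell_iff: "(AE \<xi> in cell. P \<xi>) \<longleftrightarrow> (AE \<xi> in lebesgue. \<xi> \<in> Upsilon \<longrightarrow> P \<xi>)"
  by (simp add: AE_restrict_space_iff)

lemma measurable_cell_continuous:
  fixes p :: "point \<Rightarrow> 'a::{second_countable_topology, t2_space}"
  assumes "continuous_on UNIV p" shows "p \<in> borel_measurable cell"
  using borel_measurable_continuous_onI[OF assms] by (simp add: measurable_restrict_space1 measurable_completion)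

lemma measurable_expo_cell [measurable]: "expo k \<in> borel_measurable cell"
  by (rule measurable_cell_continuous[OF continuous_expo])

lemma integrable_mult_expo:
  "integrable cell h \<Longrightarrow> integrable cell (\<lambda>\<xi>. h \<xi> * expo k \<xi>)"
  by (rule Bochner_Integration.integrable_bound) (auto simp: norm_mult)

lemma integral_trig_eq_0:
  fixes h :: "point \<Rightarrow> complex"
  assumes "integrable cell h" "\<And>k. (LINT \<xi>|cell. h \<xi> * expo k \<xi>) = 0" "trig p"
  shows "integrable cell (\<lambda>\<xi>. h \<xi> * p \<xi>)" "(LINT \<xi>|cell. h \<xi> * p \<xi>) = 0"
proof -
  have "integrable cell (\<lambda>\<xi>. h \<xi> * p \<xi>) \<and> (LINT \<xi>|cell. h \<xi> * p \<xi>) = 0"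
    using assms(3)
  proof (induction rule: trig.induct)
    case (trig_expo c k)
    have "(\<lambda>\<xi>. h \<xi> * (c * expo k \<xi>)) = (\<lambda>\<xi>. c * (h \<xi> * expo k \<xi>))" by (simp add: mult_ac)
    then show ?case using assms(2)[of k] integrable_mult_expo[OF assms(1), of k] by simp
  next
    case (trig_add p q)
    then show ?case by (simp add: distrib_left)
  qed
  then show "integrable cell (\<lambda>\<xi>. h \<xi> * p \<xi>)" "(LINT \<xi>|cell. h \<xi> * p \<xi>) = 0" by auto
qed

text \<open>Duality with the bounded function sgn h, which suits an h that is merely integrable: h
  is orthogonal to trigonometric polynomials converging boundedly to sgn h, so dominated convergence
  gives that |h| has integral 0.\<close>

theorem fourier_uniqueness:
  fixes h :: "point \<Rightarrow> real"
  assumes h: "integrable cell h" and z: "\<And>k. (LINT \<xi>|cell. of_real (h \<xi>) * expo k \<xi>) = 0"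
  shows "AE \<xi> in cell. h \<xi> = 0"
proof -
  define s where "s \<xi> = (if \<xi> \<in> Upsilon then sgn (h \<xi>) else 0)" for \<xi>
  have "h \<in> borel_measurable cell" using h by auto
  then have "(\<lambda>\<xi>. sgn (h \<xi>)) \<in> borel_measurable cell" by measurable
  then have sm: "s \<in> borel_measurable lebesgue"
    unfolding s_def[abs_def] by (subst borel_measurable_if) auto
  have s1: "\<bar>s \<xi>\<bar> \<le> 1" for \<xi> by (simp add: s_def sgn_real_def)
  obtain p where p: "\<And>n. trig (p n)" "\<And>n \<xi>. \<xi> \<in> Upsilon \<Longrightarrow> norm (p n \<xi>) \<le> 1 + 1"
    "AE \<xi> in lebesgue. \<xi> \<in> Upsilon \<longrightarrow> (\<lambda>n. p n \<xi>) \<longlonglongrightarrow> of_real (s \<xi>)"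
    using trig_approx_bounded[OF sm s1] by blast
  have "(\<lambda>n. LINT \<xi>|cell. of_real (h \<xi>) * p n \<xi>) \<longlonglongrightarrow> (LINT \<xi>|cell. complex_of_real (h \<xi>) * of_real (s \<xi>))"
  proof (rule integral_dominated_convergence[where w = "\<lambda>\<xi>. 2 * \<bar>h \<xi>\<bar>"])
    show "(\<lambda>\<xi>. complex_of_real (h \<xi>) * p n \<xi>) \<in> borel_measurable cell" for n
      using h measurable_cell_continuous[OF continuous_trig[OF p(1)]] by auto
    have "s \<in> borel_measurable cell"
      using \<open>s \<in> borel_measurable lebesgue\<close> by (rule measurable_restrict_space1)
    then show "(\<lambda>\<xi>. complex_of_real (h \<xi>) * of_real (s \<xi>)) \<in> borel_measurable cell"
      using h by auto
    show "integrable cell (\<lambda>\<xi>. 2 * \<bar>h \<xi>\<bar>)" using h by auto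
    show "AE \<xi> in cell. (\<lambda>n. complex_of_real (h \<xi>) * p n \<xi>) \<longlonglongrightarrow> complex_of_real (h \<xi>) * of_real (s \<xi>)"
      unfolding AE_cell_iff using p(3) by (auto elim!: eventually_mono intro!: tendsto_mult)
    show "AE \<xi> in cell. norm (complex_of_real (h \<xi>) * p n \<xi>) \<le> 2 * \<bar>h \<xi>\<bar>" for n
      unfolding AE_cell_iff
      by (rule AE_I2) (use p(2)[of _ n] in \<open>auto simp: norm_mult mult.commute[of 2] intro!: mult_left_mono\<close>)
  qed
  moreover have "(LINT \<xi>|cell. of_real (h \<xi>) * p n \<xi>) = 0" for n
    by (rule integral_trig_eq_0(2)[OF _ z p(1)]) (use h in auto)
  ultimately have "(LINT \<xi>|cell. complex_of_real (h \<xi>) * of_real (s \<xi>)) = 0"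
    by (simp add: LIMSEQ_const_iff)
  moreover have "(LINT \<xi>|cell. complex_of_real (h \<xi>) * of_real (s \<xi>)) = of_real (LINT \<xi>|cell. \<bar>h \<xi>\<bar>)"
    unfolding integral_complex_of_real[symmetric]
    by (rule Bochner_Integration.integral_cong) (auto simp: s_def sgn_real_def simp flip: of_real_mult)
  ultimately have "(LINT \<xi>|cell. \<bar>h \<xi>\<bar>) = 0" by simp
  then show ?thesis
    using h integral_nonneg_eq_0_iff_AE[of cell "\<lambda>\<xi>. \<bar>h \<xi>\<bar>"] by auto
qed

section \<open>Lattice translations\<close>

lemma distr_lebesgue_translate: "distr lebesgue lebesgue (\<lambda>x. x + v) = (lebesgue :: 'a::euclidean_space measure)"
  and measurable_lebesgue_translate: "(\<lambda>x. x + v) \<in> lebesgue \<rightarrow>\<^sub>M (lebesgue :: 'a measure)"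
proof -
  have eq: "(\<lambda>x. v + (\<Sum>j\<in>Basis. (1 * (x \<bullet> j)) *\<^sub>R j)) = (\<lambda>x::'a. x + v)"
    by (simp add: euclidean_representation add.commute)
  show m: "(\<lambda>x. x + v) \<in> lebesgue \<rightarrow>\<^sub>M (lebesgue :: 'a measure)"
    using lebesgue_affine_measurable[of "\<lambda>_. 1" v] unfolding eq by simp
  have "lebesgue = density (distr lebesgue lebesgue (\<lambda>x::'a. x + v)) (\<lambda>_. 1)"
    using lebesgue_affine_euclidean[of "\<lambda>_. 1" v] unfolding eq by (simp add: one_ennreal_def)
  then show "distr lebesgue lebesgue (\<lambda>x. x + v) = (lebesgue :: 'a measure)"
    by (simp add: density_1)
qed

lemma integral_lebesgue_translate:
  fixes h :: "'a::euclidean_space \<Rightarrow> 'b::{banach, second_countable_topology}"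
  assumes "h \<in> borel_measurable lebesgue"
  shows "(LINT x|lebesgue. h (x + v)) = (LINT x|lebesgue. h x)"
  using integral_distr[OF measurable_lebesgue_translate assms, of v]
  by (simp add: distr_lebesgue_translate)

lemma integrable_lebesgue_translate:
  fixes h :: "'a::euclidean_space \<Rightarrow> 'b::{banach, second_countable_topology}"
  assumes "integrable lebesgue h"
  shows "integrable lebesgue (\<lambda>x. h (x + v))"
  using integrable_distr[OF measurable_lebesgue_translate, of v h] assms
  by (simp add: distr_lebesgue_translate)

lemma AE_lebesgue_translate:
  assumes "AE x in (lebesgue :: 'a::euclidean_space measure). P x"
  shows "AE x in lebesgue. P (x + v)"
  by (rule AE_distrD[OF measurable_lebesgue_translate, of P v, unfolded distr_lebesgue_translate, OF assms])

definition lattice :: "(int \<times> int) \<times> int \<Rightarrow> point" where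
  "lattice k = (2 * pi) *\<^sub>R freq k"

text \<open>The almost everywhere periods of h form a group, by translation invariance of null sets,
  and it contains the generators of the lattice.\<close>

lemma ae_periodic_lattice:
  assumes "ae_periodic h"
  shows "AE \<xi> in lebesgue. h (\<xi> + lattice k) = h \<xi>"
proof -
  define G where "G = {v. AE \<xi> in lebesgue. h (\<xi> + v) = h \<xi>}"
  have add: "v + v' \<in> G" if "v \<in> G" "v' \<in> G" for v v'
  proof -
    have "AE \<xi> in lebesgue. h (\<xi> + v' + v) = h (\<xi> + v')"
      using AE_lebesgue_translate[of "\<lambda>\<xi>. h (\<xi> + v) = h \<xi>" v'] that(1) by (simp add: G_def)
    moreover have "AE \<xi> in lebesgue. h (\<xi> + v') = h \<xi>" using that(2) by (simp add: G_def)
    ultimately have "AE \<xi> in lebesgue. h (\<xi> + (v + v')) = h \<xi>"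
      by eventually_elim (simp add: add_ac)
    then show ?thesis by (simp add: G_def)
  qed
  have minus: "- v \<in> G" if "v \<in> G" for v
    using AE_lebesgue_translate[of "\<lambda>\<xi>. h (\<xi> + v) = h \<xi>" "- v"] that by (simp add: G_def eq_commute)
  have zero: "0 \<in> G" by (simp add: G_def)
  have nat: "real n *\<^sub>R v \<in> G" if "v \<in> G" for n v
    by (induction n) (use zero add that in \<open>auto simp: scaleR_left_distrib\<close>)
  have int: "real_of_int m *\<^sub>R v \<in> G" if "v \<in> G" for m v
    using nat[OF that, of "nat m"] minus[OF nat[OF that, of "nat (- m)"]] by (cases "0 \<le> m") auto
  have base: "(2 * pi) *\<^sub>R b \<in> G" if "b \<in> Basis" for b
    using assms that by (simp add: ae_periodic_def G_def)
  have "lattice k = real_of_int (fst (fst k)) *\<^sub>R (2 * pi) *\<^sub>R (axis 1 1, 0)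
      + real_of_int (snd (fst k)) *\<^sub>R (2 * pi) *\<^sub>R (axis 2 1, 0) + real_of_int (snd k) *\<^sub>R (2 * pi) *\<^sub>R (0, 1)"
    by (simp add: lattice_def freq_def vec_eq_iff forall_2 axis_def)
  also have "\<dots> \<in> G" by (intro add int base) (auto simp: Basis_point)
  finally show ?thesis by (simp add: G_def)
qed

section \<open>Tiling of space by translates of the cell\<close>

definition cell_index :: "point \<Rightarrow> (int \<times> int) \<times> int" where
  "cell_index \<xi> = ((\<lfloor>fst \<xi> $ 1 / (2 * pi)\<rfloor>, \<lfloor>fst \<xi> $ 2 / (2 * pi)\<rfloor>), \<lfloor>snd \<xi> / (2 * pi)\<rfloor>)"

lemma AE_not_on_faces: "AE \<xi> in (lebesgue :: point measure). \<forall>b\<in>Basis. \<forall>m::int. \<xi> \<bullet> b \<noteq> 2 * pi * m"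
proof -
  have "AE \<xi> in (lebesgue :: point measure). \<xi> \<bullet> b \<noteq> 2 * pi * m" if "b \<in> Basis" for b and m :: int
    using AE_not_in[of "{\<xi>. \<xi> \<bullet> b = 2 * pi * m}" lebesgue] negligible_standard_hyperplane[OF that]
    by (simp add: negligible_iff_null_sets)
  then show ?thesis by (intro AE_finite_allI AE_all_countable[THEN iffD2] allI) auto
qed

lemma period_index:
  assumes "\<And>m::int. t \<noteq> 2 * pi * m"
  shows "0 < t - 2 * pi * of_int m \<and> t - 2 * pi * of_int m < 2 * pi \<longleftrightarrow> m = \<lfloor>t / (2 * pi)\<rfloor>"
proof -
  have "m = \<lfloor>t / (2 * pi)\<rfloor> \<longleftrightarrow> of_int m \<le> t / (2 * pi) \<and> t / (2 * pi) < of_int m + 1"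
    using floor_eq_iff[of "t / (2 * pi)" m] by (simp add: eq_commute)
  also have "\<dots> \<longleftrightarrow> 0 \<le> t - 2 * pi * of_int m \<and> t - 2 * pi * of_int m < 2 * pi"
    by (simp add: field_simps)
  finally show ?thesis using assms[of m] by auto
qed

lemma cell_index:
  assumes "\<forall>b\<in>Basis. \<forall>m::int. \<xi> \<bullet> b \<noteq> 2 * pi * m"
  shows "\<xi> - lattice k \<in> Upsilon \<longleftrightarrow> k = cell_index \<xi>"
proof -
  have "\<xi> \<bullet> (axis 1 1, 0) \<noteq> 2 * pi * m" "\<xi> \<bullet> (axis 2 1, 0) \<noteq> 2 * pi * m" "\<xi> \<bullet> (0, 1) \<noteq> 2 * pi * m" for m :: int
    using assms by (auto simp: Basis_point)
  then have *: "fst \<xi> $ 1 \<noteq> 2 * pi * m" "fst \<xi> $ 2 \<noteq> 2 * pi * m" "snd \<xi> \<noteq> 2 * pi * m" for m :: int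
    by (auto simp: inner_prod_def inner_axis)
  have "\<xi> - lattice k \<in> Upsilon \<longleftrightarrow>
      (0 < fst \<xi> $ 1 - 2 * pi * of_int (fst (fst k)) \<and> fst \<xi> $ 1 - 2 * pi * of_int (fst (fst k)) < 2 * pi) \<and>
      (0 < fst \<xi> $ 2 - 2 * pi * of_int (snd (fst k)) \<and> fst \<xi> $ 2 - 2 * pi * of_int (snd (fst k)) < 2 * pi) \<and>
      (0 < snd \<xi> - 2 * pi * of_int (snd k) \<and> snd \<xi> - 2 * pi * of_int (snd k) < 2 * pi)"
    by (cases \<xi>) (auto simp: Upsilon_def Omega_def lattice_def freq_def forall_2)
  also have "\<dots> \<longleftrightarrow> k = cell_index \<xi>"
    unfolding period_index[OF *(1)] period_index[OF *(2)] period_index[OF *(3)] cell_index_def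
    by (auto simp: prod_eq_iff)
  finally show ?thesis .
qed

text \<open>Countably many translates of the open cell cover everything but the faces, which form a
  null set.\<close>

lemma AE_from_cells:
  assumes "\<And>k. AE \<xi> in lebesgue. \<xi> \<in> Upsilon \<longrightarrow> P (\<xi> + lattice k)"
  shows "AE \<xi> in lebesgue. P \<xi>"
proof -
  have "AE \<xi> in lebesgue. \<forall>k. \<xi> - lattice k \<in> Upsilon \<longrightarrow> P \<xi>"
  proof (rule AE_all_countable[THEN iffD2], rule allI)
    fix k
    show "AE \<xi> in lebesgue. \<xi> - lattice k \<in> Upsilon \<longrightarrow> P \<xi>"
      using AE_lebesgue_translate[OF assms[of k], of "- lattice k"] by simp
  qed
  with AE_not_on_faces show ?thesis
    by eventually_elim (use cell_index in blast)
qed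

text \<open>Cut the integral along the cells, translate each piece back and use the periodicity of
  h. The support of w has side 4 pi and meets eight cells up to null sets, so the sum over
  translates is finite.\<close>

lemma integral_periodize:
  fixes h w :: "point \<Rightarrow> real"
  assumes h: "ae_periodic h" "h \<in> borel_measurable lebesgue"
    and w: "w \<in> borel_measurable lebesgue" "integrable lebesgue (\<lambda>\<xi>. h \<xi> * w \<xi>)"
    and supp: "\<And>\<xi>. \<not> (\<forall>b\<in>Basis. 0 \<le> \<xi> \<bullet> b \<and> \<xi> \<bullet> b \<le> 4 * pi) \<Longrightarrow> w \<xi> = 0"
  shows "(LINT \<xi>|lebesgue. h \<xi> * w \<xi>) = (LINT \<xi>|cell. h \<xi> * (\<Sum>k\<in>({0, 1} \<times> {0, 1}) \<times> {0, 1}. w (\<xi> + lattice k)))"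
proof -
  let ?J = "({0, 1} \<times> {0, 1}) \<times> {0, 1} :: ((int \<times> int) \<times> int) set"
  let ?g = "\<lambda>\<xi>. h \<xi> * w \<xi>"
  have AE_sum: "AE \<xi> in lebesgue. ?g \<xi> = (\<Sum>k\<in>?J. indicator Upsilon (\<xi> - lattice k) * ?g \<xi>)"
    using AE_not_on_faces
  proof eventually_elim
    case (elim \<xi>)
    have "cell_index \<xi> \<in> ?J" if "w \<xi> \<noteq> 0"
    proof -
      have bd: "0 \<le> \<xi> \<bullet> b \<and> \<xi> \<bullet> b \<le> 4 * pi" if "b \<in> Basis" for b
        using supp[of \<xi>] \<open>w \<xi> \<noteq> 0\<close> that by blast
      have "\<lfloor>(\<xi> \<bullet> b) / (2 * pi)\<rfloor> \<in> {0, 1}" if "b \<in> Basis" for b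
      proof -
        \<comment> \<open>The end point 4 pi would have cell index 2; it lies on a face and is
          excluded almost everywhere.\<close>
        have "\<xi> \<bullet> b \<noteq> 4 * pi" using bspec[OF elim that] spec[of _ "2::int"] by fastforce
        then have "0 \<le> (\<xi> \<bullet> b) / (2 * pi)" "(\<xi> \<bullet> b) / (2 * pi) < 2"
          using bd[OF that] by (auto simp: field_simps)
        then show ?thesis by (simp add: floor_eq_iff) linarith
      qed
      note fl = this
      show ?thesis
        using fl[of "(axis 1 1, 0)"] fl[of "(axis 2 1, 0)"] fl[of "(0, 1)"]
        by (auto simp: cell_index_def Basis_point inner_prod_def inner_axis)
    qed
    then have "?g \<xi> = (\<Sum>k\<in>?J. if k = cell_index \<xi> then ?g \<xi> else 0)"
      by (auto simp: sum.delta')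
    also have "\<dots> = (\<Sum>k\<in>?J. indicator Upsilon (\<xi> - lattice k) * ?g \<xi>)"
      using cell_index[OF elim] by (intro sum.cong) (auto simp: indicator_def)
    finally show ?case .
  qed
  have ind_meas: "(\<lambda>\<xi>. indicator Upsilon (\<xi> - lattice k) :: real) \<in> borel_measurable lebesgue" for k
  proof -
    have "indicator Upsilon \<in> borel_measurable (lebesgue :: point measure)"
      by (rule borel_measurable_indicator[OF Upsilon_sets(1)])
    from measurable_compose[OF measurable_lebesgue_translate[of "- lattice k"] this] show ?thesis by simp
  qed
  have int_k: "integrable lebesgue (\<lambda>\<xi>. indicator Upsilon (\<xi> - lattice k) * ?g \<xi>)" for k
    by (rule Bochner_Integration.integrable_bound[OF w(2)])
      (use ind_meas[of k] w(1) h(2) in \<open>auto simp: indicator_def intro!: AE_I2\<close>)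
  have int_k': "integrable lebesgue (\<lambda>\<xi>. indicator Upsilon \<xi> * ?g (\<xi> + lattice k))" for k
    using integrable_lebesgue_translate[OF int_k[of k], of "lattice k"] by simp
  have cell_eq: "(LINT \<xi>|lebesgue. indicator Upsilon \<xi> * u \<xi>) = (LINT \<xi>|cell. u \<xi>)" for u :: "point \<Rightarrow> real"
    by (subst integral_restrict_space) (auto simp: set_lebesgue_integral_def)
  have cell_int: "integrable lebesgue (\<lambda>\<xi>. indicator Upsilon \<xi> * u \<xi>) \<longleftrightarrow> integrable cell u" for u :: "point \<Rightarrow> real"
    by (subst integrable_restrict_space) auto
  have AE_k: "AE \<xi> in cell. ?g (\<xi> + lattice k) = h \<xi> * w (\<xi> + lattice k)" for k
    unfolding AE_cell_iff using ae_periodic_lattice[OF h(1), of k] by eventually_elim simp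
  have meas: "(\<lambda>\<xi>. h \<xi> * w (\<xi> + lattice k)) \<in> borel_measurable cell" for k
    using measurable_compose[OF measurable_lebesgue_translate w(1), of "lattice k"] h(2)
    by (intro borel_measurable_times measurable_restrict_space1) auto
  have ck: "integrable cell (\<lambda>\<xi>. ?g (\<xi> + lattice k))" for k
    using int_k' cell_int by blast
  have ck': "integrable cell (\<lambda>\<xi>. h \<xi> * w (\<xi> + lattice k))" for k
    by (rule integrable_cong_AE_imp[OF ck meas AE_k])
  have "(LINT \<xi>|lebesgue. ?g \<xi>) = (LINT \<xi>|lebesgue. (\<Sum>k\<in>?J. indicator Upsilon (\<xi> - lattice k) * ?g \<xi>))"
    by (rule integral_cong_AE[OF borel_measurable_integrable[OF w(2)]
          borel_measurable_sum[OF borel_measurable_integrable[OF int_k]] AE_sum])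
  also have "\<dots> = (\<Sum>k\<in>?J. LINT \<xi>|lebesgue. indicator Upsilon (\<xi> - lattice k) * ?g \<xi>)"
    by (rule Bochner_Integration.integral_sum) (rule int_k)
  also have "\<dots> = (\<Sum>k\<in>?J. LINT \<xi>|cell. h \<xi> * w (\<xi> + lattice k))"
  proof (rule sum.cong[OF refl])
    fix k
    have "(LINT \<xi>|lebesgue. indicator Upsilon (\<xi> - lattice k) * ?g \<xi>)
        = (LINT \<xi>|lebesgue. indicator Upsilon \<xi> * ?g (\<xi> + lattice k))"
      using integral_lebesgue_translate[of "\<lambda>\<xi>. indicator Upsilon (\<xi> - lattice k) * ?g \<xi>" "lattice k"] int_k[of k]
      by simp
    also have "\<dots> = (LINT \<xi>|cell. ?g (\<xi> + lattice k))" by (rule cell_eq)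
    also have "\<dots> = (LINT \<xi>|cell. h \<xi> * w (\<xi> + lattice k))"
      by (rule integral_cong_AE[OF borel_measurable_integrable[OF ck] meas AE_k])
    finally show "(LINT \<xi>|lebesgue. indicator Upsilon (\<xi> - lattice k) * ?g \<xi>) = (LINT \<xi>|cell. h \<xi> * w (\<xi> + lattice k))" .
  qed
  also have "\<dots> = (LINT \<xi>|cell. (\<Sum>k\<in>?J. h \<xi> * w (\<xi> + lattice k)))"
    by (rule Bochner_Integration.integral_sum[symmetric]) (rule ck')
  finally show ?thesis by (simp only: sum_distrib_left)
qed

section \<open>Test functions\<close>

lemma smooth_continuous: "smooth f \<Longrightarrow> continuous_on S f"
  using continuous_on_subset[OF C_k_continuous[of 0 f]] unfolding smooth_def by blast

lemma smooth_has_derivative: "smooth f \<Longrightarrow> (f has_derivative frechet_derivative f (at x)) (at x)"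
  using C_k_Suc_D(1)[of 0 f] by (auto simp: smooth_def)

lemma smooth_partial: "smooth f \<Longrightarrow> b \<in> Basis \<Longrightarrow> smooth (\<lambda>x. frechet_derivative f (at x) b)"
  using C_k_Suc_D(2)[of _ f b] unfolding smooth_def by blast

lemma smooth_mult: "smooth f \<Longrightarrow> smooth g \<Longrightarrow> smooth (\<lambda>x. f x * g x)"
  by (simp add: smooth_def C_k_mult)

lemma C_k_translate: "C_k k f \<Longrightarrow> C_k k (\<lambda>x. f (x + v))"
proof (induction k arbitrary: f)
  case 0
  then show ?case by (auto intro!: continuous_on_compose2[of UNIV f] continuous_intros)
next
  case (Suc k)
  have "((\<lambda>x. f (x + v)) has_derivative frechet_derivative f (at (x + v))) (at x)" for x
    by (rule has_derivative_compose[OF _ C_k_Suc_D(1)[OF Suc.prems]]) (auto intro!: derivative_eq_intros)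
  then show ?case
    by (rule C_k_Suc_I) (use Suc.IH C_k_Suc_D(2)[OF Suc.prems] in blast)
qed

lemma smooth_translate: "smooth f \<Longrightarrow> smooth (\<lambda>x. f (x + v))"
  by (simp add: smooth_def C_k_translate)

lemma frechet_derivative_translate:
  assumes "smooth f"
  shows "frechet_derivative (\<lambda>x. f (x + v)) (at x) = frechet_derivative f (at (x + v))"
proof -
  have "((\<lambda>x. f (x + v)) has_derivative frechet_derivative f (at (x + v))) (at x)"
    by (rule has_derivative_compose[OF _ smooth_has_derivative[OF assms]]) (auto intro!: derivative_eq_intros)
  then show ?thesis by (rule frechet_derivative_at[symmetric])
qed

lemma frechet_derivative_mult:
  assumes "smooth f" "smooth g"
  shows "frechet_derivative (\<lambda>x. f x * g x) (at x) b = f x * frechet_derivative g (at x) b + frechet_derivative f (at x) b * g x"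
  using frechet_derivative_at[OF has_derivative_mult[OF smooth_has_derivative[OF assms(1)] smooth_has_derivative[OF assms(2)]], of x]
  by (metis (no_types, lifting))

lemma test_functionI: "smooth f \<Longrightarrow> bounded {x. f x \<noteq> 0} \<Longrightarrow> test_function f"
  by (simp add: test_function_def compact_closure)

lemma test_function_smooth: "test_function f \<Longrightarrow> smooth f"
  by (simp add: test_function_def)

lemma test_function_bounded: "test_function f \<Longrightarrow> bounded {x. f x \<noteq> 0}"
  using compact_closure by (auto simp: test_function_def)

lemma test_function_mult: "test_function f \<Longrightarrow> smooth g \<Longrightarrow> test_function (\<lambda>x. f x * g x)"
  by (rule test_functionI[OF smooth_mult[OF test_function_smooth] bounded_subset[OF test_function_bounded]]) auto

lemma test_function_translate:
  assumes "test_function f"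
  shows "test_function (\<lambda>x. f (x + v))"
proof (rule test_functionI)
  show "smooth (\<lambda>x. f (x + v))" by (rule smooth_translate[OF test_function_smooth[OF assms]])
  have "{x. f (x + v) \<noteq> 0} \<subseteq> (\<lambda>x. - v + x) ` {x. f x \<noteq> 0}"
  proof
    fix x assume "x \<in> {x. f (x + v) \<noteq> 0}"
    then show "x \<in> (\<lambda>x. - v + x) ` {x. f x \<noteq> 0}" by (intro image_eqI[of _ _ "x + v"]) auto
  qed
  then show "bounded {x. f (x + v) \<noteq> 0}"
    using bounded_translation[OF test_function_bounded[OF assms]] bounded_subset by blast
qed

lemma frechet_derivative_outside_support:
  assumes "x \<notin> closure {x. f x \<noteq> 0}"
  shows "frechet_derivative f (at x) b = (0::real)"
proof -
  have "((\<lambda>_. 0) has_derivative (\<lambda>_. 0)) (at x)" by simp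
  then have "(f has_derivative (\<lambda>_. 0)) (at x)"
  proof (rule has_derivative_transform_within_open[where s = "- closure {x. f x \<noteq> 0}"])
    fix y assume "y \<in> - closure {x. f x \<noteq> 0}"
    then show "0 = f y" using closure_subset[of "{x. f x \<noteq> 0}"] by auto
  qed (use assms in auto)
  then have "(\<lambda>_. 0) = frechet_derivative f (at x)" by (rule frechet_derivative_at)
  then show ?thesis by (metis)
qed

section \<open>Pairing locally integrable functions with test functions\<close>

lemma locally_integrable_measurable:
  assumes "locally_integrable h"
  shows "h \<in> borel_measurable lebesgue"
proof (rule borel_measurable_LIMSEQ_metric[where f = "\<lambda>n x. indicator (cball 0 (real n)) x *\<^sub>R h x"])
  show "(\<lambda>x. indicator (cball 0 (real n)) x *\<^sub>R h x) \<in> borel_measurable lebesgue" for n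
  proof -
    have "set_integrable lebesgue (cball 0 (real n)) h"
      using assms by (simp add: locally_integrable_def)
    then show ?thesis unfolding set_integrable_def by (rule borel_measurable_integrable)
  qed
  fix x :: 'a
  obtain m :: nat where "norm x \<le> real m" using real_arch_simple by blast
  then have "indicator (cball 0 (real n)) x *\<^sub>R h x = h x" if "m \<le> n" for n
    using that by (auto simp: indicator_def)
  then show "(\<lambda>n. indicator (cball 0 (real n)) x *\<^sub>R h x) \<longlonglongrightarrow> h x"
    by (intro tendsto_eventually) (auto simp: eventually_sequentially)
qed

lemma continuous_borel_measurable_lebesgue:
  fixes w :: "'a::euclidean_space \<Rightarrow> real"
  shows "continuous_on UNIV w \<Longrightarrow> w \<in> borel_measurable lebesgue"
  by (simp add: borel_measurable_continuous_onI measurable_completion)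

lemma integrable_mult_compact_support:
  fixes h w :: "'a::euclidean_space \<Rightarrow> real"
  assumes "locally_integrable h" "continuous_on UNIV w" "compact K" "\<And>x. x \<notin> K \<Longrightarrow> w x = 0"
  shows "integrable lebesgue (\<lambda>x. h x * w x)"
proof -
  have "compact (w ` K)"
    using assms(2,3) compact_continuous_image continuous_on_subset by blast
  then obtain B where B: "\<And>x. x \<in> K \<Longrightarrow> \<bar>w x\<bar> \<le> B"
    using compact_imp_bounded[of "w ` K"] by (auto simp: bounded_iff)
  have "integrable lebesgue (\<lambda>x. (indicator K x *\<^sub>R h x) * B)"
    using assms(1,3) by (intro integrable_mult_left) (auto simp: locally_integrable_def set_integrable_def)
  then show ?thesis
  proof (rule Bochner_Integration.integrable_bound)
    show "(\<lambda>x. h x * w x) \<in> borel_measurable lebesgue"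
      using locally_integrable_measurable[OF assms(1)] continuous_borel_measurable_lebesgue[OF assms(2)] by simp
    show "AE x in lebesgue. norm (h x * w x) \<le> norm ((indicator K x *\<^sub>R h x) * B)"
    proof (rule AE_I2)
      fix x
      show "norm (h x * w x) \<le> norm ((indicator K x *\<^sub>R h x) * B)"
      proof (cases "x \<in> K")
        case True
        then have "\<bar>w x\<bar> \<le> \<bar>B\<bar>" using B[of x] by linarith
        then show ?thesis using True by (simp add: abs_mult mult_left_mono)
      qed (simp add: assms(4))
    qed
  qed
qed

lemma locally_integrable_continuous:
  fixes w :: "'a::euclidean_space \<Rightarrow> real"
  assumes "continuous_on UNIV w"
  shows "locally_integrable w"
proof -
  have "set_integrable lebesgue K w" if "compact K" for K
    using borel_integrable_compact[OF that continuous_on_subset[OF assms]]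
      by (subst set_integrable_def) (simp add: integrable_completion)
  then show ?thesis by (simp add: locally_integrable_def)
qed

lemma integrable_mult_test:
  assumes "locally_integrable h" "test_function f"
  shows "integrable lebesgue (\<lambda>x. h x * f x)"
    and "b \<in> Basis \<Longrightarrow> integrable lebesgue (\<lambda>x. h x * frechet_derivative f (at x) b)"
proof -
  have K: "compact (closure {x. f x \<noteq> 0})" using assms(2) by (simp add: test_function_def)
  show "integrable lebesgue (\<lambda>x. h x * f x)"
    by (rule integrable_mult_compact_support[OF assms(1) smooth_continuous[OF test_function_smooth[OF assms(2)]] K])
      (use closure_subset[of "{x. f x \<noteq> 0}"] in auto)
  show "integrable lebesgue (\<lambda>x. h x * frechet_derivative f (at x) b)" if "b \<in> Basis"
    by (rule integrable_mult_compact_support[OF assms(1)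
          smooth_continuous[OF smooth_partial[OF test_function_smooth[OF assms(2)] that]] K])
      (rule frechet_derivative_outside_support)
qed

text \<open>The difference quotients of a test function have integral zero and converge boundedly.\<close>

lemma integral_partial_test_function:
  fixes f :: "'a::euclidean_space \<Rightarrow> real"
  assumes f: "test_function f" and b: "b \<in> Basis"
  shows "(LINT x|lebesgue. frechet_derivative f (at x) b) = 0"
proof -
  let ?D = "\<lambda>x. frechet_derivative f (at x) b"
  note sf = test_function_smooth[OF f]
  have li1: "locally_integrable (\<lambda>x::'a. 1)" by (rule locally_integrable_continuous) simp
  have int_f: "integrable lebesgue f" and int_D: "integrable lebesgue ?D"
    using integrable_mult_test[OF li1 f] b by simp_all
  have K: "compact (closure {x. f x \<noteq> 0})" using f by (simp add: test_function_def)
  obtain R where R: "\<And>x. f x \<noteq> 0 \<Longrightarrow> norm x \<le> R"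
    using test_function_bounded[OF f] by (auto simp: bounded_iff)
  have "compact (?D ` closure {x. f x \<noteq> 0})"
    using K smooth_continuous[OF smooth_partial[OF sf b]] compact_continuous_image by blast
  then have "bounded (?D ` closure {x. f x \<noteq> 0})" by (rule compact_imp_bounded)
  then obtain B where "\<forall>y\<in>?D ` closure {x. f x \<noteq> 0}. norm y \<le> B" unfolding bounded_iff by blast
  then have B0: "\<And>x. x \<in> closure {x. f x \<noteq> 0} \<Longrightarrow> \<bar>?D x\<bar> \<le> B" by auto
  have B: "\<bar>?D x\<bar> \<le> \<bar>B\<bar>" for x
    using B0[of x] frechet_derivative_outside_support[of x f b] by fastforce
  define q where "q n x = real (Suc n) * (f (x + (1 / real (Suc n)) *\<^sub>R b) - f x)" for n x
  have int_q: "integrable lebesgue (q n)" for n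
    unfolding q_def[abs_def]
    by (rule integrable_mult_right, rule Bochner_Integration.integrable_diff[OF integrable_lebesgue_translate[OF int_f] int_f])
  have q0: "(LINT x|lebesgue. q n x) = 0" for n
  proof -
    have "(LINT x|lebesgue. f (x + (1 / real (Suc n)) *\<^sub>R b)) = (LINT x|lebesgue. f x)"
      using int_f by (intro integral_lebesgue_translate) auto
    then show ?thesis
      unfolding q_def integral_mult_right_zero
        Bochner_Integration.integral_diff[OF integrable_lebesgue_translate[OF int_f] int_f] by simp
  qed
  have der: "((\<lambda>t. f (x + t *\<^sub>R b)) has_real_derivative ?D (x + t *\<^sub>R b)) (at t)" for x t
  proof -
    have "((\<lambda>t. f (x + t *\<^sub>R b)) has_derivative (\<lambda>s. frechet_derivative f (at (x + t *\<^sub>R b)) (s *\<^sub>R b))) (at t)"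
      by (rule has_derivative_compose[OF _ smooth_has_derivative[OF sf]]) (auto intro!: derivative_eq_intros)
    moreover have "frechet_derivative f (at (x + t *\<^sub>R b)) (s *\<^sub>R b) = ?D (x + t *\<^sub>R b) * s" for s
      using linear_scale[OF has_derivative_linear[OF smooth_has_derivative[OF sf]], of "x + t *\<^sub>R b" s b] by simp
    ultimately show ?thesis by (simp add: has_field_derivative_def)
  qed
  have qmvt: "\<exists>s. q n x = ?D (x + s *\<^sub>R b)" for n x
  proof -
    have "0 < 1 / real (Suc n)" by simp
    from MVT2[OF this, of "\<lambda>t. f (x + t *\<^sub>R b)" "\<lambda>t. ?D (x + t *\<^sub>R b)"] der
    obtain s where "f (x + (1 / real (Suc n)) *\<^sub>R b) - f (x + 0 *\<^sub>R b) = (1 / real (Suc n) - 0) * ?D (x + s *\<^sub>R b)"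
      by blast
    then have "q n x = ?D (x + s *\<^sub>R b)" by (simp add: q_def)
    then show ?thesis ..
  qed
  \<comment> \<open>Dominated convergence: the mean value theorem bounds the quotients by a bound
    for the derivative, and increments of length at most 1 keep them supported in the ball of radius
    \<open>R + 1\<close>.\<close>
  have "(\<lambda>n. LINT x|lebesgue. q n x) \<longlonglongrightarrow> (LINT x|lebesgue. ?D x)"
  proof (rule integral_dominated_convergence[where w = "\<lambda>x. indicator (cball 0 (R + 1)) x * \<bar>B\<bar>"])
    show "integrable lebesgue (\<lambda>x::'a. indicator (cball 0 (R + 1)) x * \<bar>B\<bar>)"
      using integrable_real_indicator[of "cball 0 (R + 1)" lebesgue] emeasure_compact_finite[of "cball (0::'a) (R + 1)"]
      by (intro integrable_mult_left) auto
    show "AE x in lebesgue. (\<lambda>n. q n x) \<longlonglongrightarrow> ?D x"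
    proof (rule AE_I2)
      fix x
      have "((\<lambda>h. (f (x + (0 + h) *\<^sub>R b) - f (x + 0 *\<^sub>R b)) / h) \<longlongrightarrow> ?D (x + 0 *\<^sub>R b)) (at 0)"
        using der[of x 0] unfolding DERIV_def .
      then have "((\<lambda>h. (f (x + h *\<^sub>R b) - f x) / h) \<longlongrightarrow> ?D x) (at 0)" by simp
      moreover have "filterlim (\<lambda>n. 1 / real (Suc n)) (at 0) sequentially"
        using LIMSEQ_inverse_real_of_nat by (auto simp: filterlim_at inverse_eq_divide)
      ultimately have "(\<lambda>n. (f (x + (1 / real (Suc n)) *\<^sub>R b) - f x) / (1 / real (Suc n))) \<longlonglongrightarrow> ?D x"
        by (rule filterlim_compose)
      then show "(\<lambda>n. q n x) \<longlonglongrightarrow> ?D x" by (simp add: q_def mult.commute)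
    qed
    show "AE x in lebesgue. norm (q n x) \<le> indicator (cball 0 (R + 1)) x * \<bar>B\<bar>" for n
    proof (rule AE_I2)
      fix x
      have le: "norm (q n x) \<le> \<bar>B\<bar>" using qmvt[of n x] B by auto
      show "norm (q n x) \<le> indicator (cball 0 (R + 1)) x * \<bar>B\<bar>"
      proof (cases "norm x \<le> R + 1")
        case True then show ?thesis using le by simp
      next
        case False
        have "norm x \<le> norm (x + (1 / real (Suc n)) *\<^sub>R b) + norm ((1 / real (Suc n)) *\<^sub>R b)"
          using norm_triangle_ineq4[of "x + (1 / real (Suc n)) *\<^sub>R b" "(1 / real (Suc n)) *\<^sub>R b"] by simp
        also have "norm ((1 / real (Suc n)) *\<^sub>R b) \<le> 1" using b by simp
        finally have "norm (x + (1 / real (Suc n)) *\<^sub>R b) > R" using False by simp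
        then have "f (x + (1 / real (Suc n)) *\<^sub>R b) = 0" "f x = 0" using R False by force+
        then show ?thesis by (simp add: q_def)
      qed
    qed
  qed (use int_q int_D in auto)
  then show ?thesis by (simp add: q0 LIMSEQ_const_iff)
qed

section \<open>Uniqueness of weak derivatives\<close>

text \<open>The free phase covers sine and cosine at once: differentiation shifts it by \<open>pi / 2\<close>.\<close>

definition wave :: "(int \<times> int) \<times> int \<Rightarrow> real \<Rightarrow> point \<Rightarrow> real" where
  "wave k c \<xi> = cos (\<xi> \<bullet> freq k + c)"

lemma smooth_wave: "smooth (wave k c)"
  using C_k_compose_affine[of _ cos "freq k" c] C_k_sin_cos unfolding smooth_def wave_def[abs_def] by blast

lemma abs_wave_le: "\<bar>wave k c \<xi>\<bar> \<le> 1"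
  by (simp add: wave_def)

lemma frechet_derivative_wave: "frechet_derivative (wave k c) (at \<xi>) b = (b \<bullet> freq k) * wave k (c + pi / 2) \<xi>"
proof -
  have "(wave k c has_derivative (\<lambda>h. (h \<bullet> freq k) * wave k (c + pi / 2) \<xi>)) (at \<xi>)"
    unfolding wave_def[abs_def]
    by (auto intro!: derivative_eq_intros simp: cos_add sin_add fun_eq_iff algebra_simps)
  from frechet_derivative_at[OF this] show ?thesis by metis
qed

lemma inner_lattice_freq: "lattice l \<bullet> freq k = 2 * pi * of_int
    (fst (fst l) * fst (fst k) + snd (fst l) * snd (fst k) + snd l * snd k)"
  by (simp add: lattice_def freq_def inner_vec_def sum_2 algebra_simps)

lemma wave_lattice: "wave k c (\<xi> + lattice l) = wave k c \<xi>"
proof -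
  obtain m :: int where m: "lattice l \<bullet> freq k = 2 * pi * of_int m" using inner_lattice_freq by blast
  have "wave k c (\<xi> + lattice l) = cos ((\<xi> \<bullet> freq k + c) + 2 * pi * of_int m)"
    by (simp only: wave_def inner_add_left m add_ac)
  also have "\<dots> = wave k c \<xi>"
    unfolding wave_def cos_add using sin_int_2pin[of m] cos_int_2pin[of m] by simp
  finally show ?thesis .
qed

lemma lattice_Basis:
  assumes "b \<in> Basis" obtains l where "(2 * pi) *\<^sub>R b = lattice l"
proof -
  have "\<exists>l. (2 * pi) *\<^sub>R b = lattice l"
    using assms unfolding Basis_point
  proof (elim disjE)
    assume "b = (axis 1 1, 0)"
    then show ?thesis by (intro exI[of _ "((1, 0), 0)"]) (simp add: lattice_def freq_def vec_eq_iff forall_2 axis_def)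
  next
    assume "b = (axis 2 1, 0)"
    then show ?thesis by (intro exI[of _ "((0, 1), 0)"]) (simp add: lattice_def freq_def vec_eq_iff forall_2 axis_def)
  next
    assume "b = (0, 1)"
    then show ?thesis by (intro exI[of _ "((0, 0), 1)"]) (simp add: lattice_def freq_def vec_eq_iff forall_2 axis_def)
  qed
  then show ?thesis using that by blast
qed

lemma integral_expo_eq_waves:
  assumes "integrable cell h"
  shows "(LINT \<xi>|cell. of_real (h \<xi>) * expo k \<xi>) =
    Complex (LINT \<xi>|cell. h \<xi> * wave k 0 \<xi>) (LINT \<xi>|cell. h \<xi> * wave k (- pi / 2) \<xi>)"
proof -
  have int: "integrable cell (\<lambda>\<xi>. complex_of_real (h \<xi>) * expo k \<xi>)"
    by (rule integrable_mult_expo) (use assms in auto)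
  have "Re (LINT \<xi>|cell. of_real (h \<xi>) * expo k \<xi>) = (LINT \<xi>|cell. Re (of_real (h \<xi>) * expo k \<xi>))"
    by (rule integral_Re[symmetric, OF int])
  moreover have "Im (LINT \<xi>|cell. of_real (h \<xi>) * expo k \<xi>) = (LINT \<xi>|cell. Im (of_real (h \<xi>) * expo k \<xi>))"
    by (rule integral_Im[symmetric, OF int])
  ultimately show ?thesis
    by (simp add: complex_eq_iff expo_def wave_def inner_commute cos_diff)
qed

definition bump :: "point \<Rightarrow> real" where
  "bump \<xi> = (\<Prod>b\<in>Basis. flat 1 (\<xi> \<bullet> b) * flat 1 (2 * pi - \<xi> \<bullet> b))"

lemma bump_eq_0_iff: "bump \<xi> = 0 \<longleftrightarrow> \<xi> \<notin> Upsilon"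
proof -
  have "flat 1 t = 0 \<longleftrightarrow> t \<le> 0" for t
    using flat_1_pos[of t] flat_nonpos[of t 1] by force
  then show ?thesis by (auto simp: bump_def Upsilon_iff not_less)
qed

lemma test_function_bump: "test_function bump"
proof (rule test_functionI)
  have "C_k k (\<lambda>\<xi>::point. flat 1 (\<xi> \<bullet> b) * flat 1 (2 * pi - \<xi> \<bullet> b))" for k b
    using C_k_mult[OF C_k_compose_affine[OF C_k_flat, of k 1 b 0] C_k_compose_affine[OF C_k_flat, of k 1 "- b" "2 * pi"]]
    by simp
  then have "C_k k bump" for k unfolding bump_def[abs_def] by (rule C_k_prod)
  then show "smooth bump" by (simp add: smooth_def)
  show "bounded {x. bump x \<noteq> 0}" using bounded_Upsilon by (simp add: bump_eq_0_iff)
qed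

lemma integral_eq_cell:
  fixes u :: "point \<Rightarrow> real"
  assumes "\<And>\<xi>. \<xi> \<notin> Upsilon \<Longrightarrow> u \<xi> = 0"
  shows "(LINT \<xi>|lebesgue. u \<xi>) = (LINT \<xi>|cell. u \<xi>)"
proof -
  have "(LINT \<xi>|cell. u \<xi>) = (LINT \<xi>|lebesgue. indicator Upsilon \<xi> *\<^sub>R u \<xi>)"
    by (subst integral_restrict_space) (auto simp: set_lebesgue_integral_def)
  also have "\<dots> = (LINT \<xi>|lebesgue. u \<xi>)"
    by (rule Bochner_Integration.integral_cong) (use assms in \<open>auto simp: indicator_def\<close>)
  finally show ?thesis by simp
qed

lemma integrable_cellI:
  fixes u :: "point \<Rightarrow> real"
  assumes "integrable lebesgue u"
  shows "integrable cell u"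
  using integrable_mult_indicator[OF Upsilon_sets(1) assms] by (simp add: integrable_restrict_space)

text \<open>On each cell, all Fourier coefficients of the product with a positive bump vanish.\<close>

lemma weakly_null_AE_0:
  fixes h :: "point \<Rightarrow> real"
  assumes h: "locally_integrable h" and null: "\<And>\<psi>. test_function \<psi> \<Longrightarrow> (LINT \<xi>|lebesgue. h \<xi> * \<psi> \<xi>) = 0"
  shows "AE \<xi> in lebesgue. h \<xi> = 0"
proof (rule AE_from_cells)
  fix l
  let ?v = "lattice l"
  let ?g = "\<lambda>\<xi>. h (\<xi> + ?v) * bump \<xi>"
  have test: "test_function (\<lambda>\<xi>. bump (\<xi> - ?v) * wave k c (\<xi> - ?v))" for k c
    using test_function_translate[OF test_function_mult[OF test_function_bump smooth_wave[of k c]], of "- ?v"] by simp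
  have z: "(LINT \<xi>|cell. ?g \<xi> * wave k c \<xi>) = 0" for k c
  proof -
    have int: "integrable lebesgue (\<lambda>\<xi>. h \<xi> * (bump (\<xi> - ?v) * wave k c (\<xi> - ?v)))"
      by (rule integrable_mult_test(1)[OF h test])
    have "(LINT \<xi>|cell. ?g \<xi> * wave k c \<xi>) = (LINT \<xi>|lebesgue. ?g \<xi> * wave k c \<xi>)"
      by (rule integral_eq_cell[symmetric]) (simp add: bump_eq_0_iff)
    also have "\<dots> = (LINT \<xi>|lebesgue. h \<xi> * (bump (\<xi> - ?v) * wave k c (\<xi> - ?v)))"
      using integral_lebesgue_translate[OF borel_measurable_integrable[OF int], of ?v] by (simp add: mult.assoc)
    also have "\<dots> = 0" by (rule null[OF test])
    finally show ?thesis .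
  qed
  have int_g: "integrable cell ?g"
  proof -
    have "integrable lebesgue (\<lambda>\<xi>. h \<xi> * bump (\<xi> - ?v))"
      using integrable_mult_test(1)[OF h test_function_translate[OF test_function_bump, of "- ?v"]] by simp
    from integrable_cellI[OF integrable_lebesgue_translate[OF this, of ?v]] show ?thesis by simp
  qed
  have "AE \<xi> in cell. ?g \<xi> = 0"
    by (rule fourier_uniqueness[OF int_g]) (simp only: integral_expo_eq_waves[OF int_g] z complex_eq_iff complex.sel zero_complex.sel)
  then show "AE \<xi> in lebesgue. \<xi> \<in> Upsilon \<longrightarrow> h (\<xi> + ?v) = 0"
    unfolding AE_cell_iff by eventually_elim (simp add: bump_eq_0_iff)
qed

lemma locally_integrable_diff:
  "locally_integrable g \<Longrightarrow> locally_integrable h \<Longrightarrow> locally_integrable (\<lambda>x. g x - h x)"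
  by (auto simp: locally_integrable_def)

section \<open>Uniqueness, translation and periodicity of weak derivatives\<close>

text \<open>\<open>weak_partial\<close> is an arbitrary choice; uniqueness is what ties it, almost
  everywhere, to any derivative computed by hand.\<close>

lemma has_weak_partial_unique:
  fixes f :: "point \<Rightarrow> real"
  assumes "has_weak_partial f b g" "has_weak_partial f b h"
  shows "AE \<xi> in lebesgue. g \<xi> = h \<xi>"
proof -
  have li: "locally_integrable g" "locally_integrable h" using assms by (auto simp: has_weak_partial_def)
  have "AE \<xi> in lebesgue. g \<xi> - h \<xi> = 0"
  proof (rule weakly_null_AE_0[OF locally_integrable_diff[OF li]])
    fix \<psi> :: "point \<Rightarrow> real" assume \<psi>: "test_function \<psi>"
    have "- (LINT x|lebesgue. g x * \<psi> x) = - (LINT x|lebesgue. h x * \<psi> x)"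
      using assms[unfolded has_weak_partial_def, THEN conjunct2, THEN conjunct2, rule_format, OF \<psi>] by simp
    then have "(LINT x|lebesgue. g x * \<psi> x) = (LINT x|lebesgue. h x * \<psi> x)" by simp
    then show "(LINT x|lebesgue. (g x - h x) * \<psi> x) = 0"
      using integrable_mult_test(1)[OF li(1) \<psi>] integrable_mult_test(1)[OF li(2) \<psi>]
      by (simp add: left_diff_distrib)
  qed
  then show ?thesis by simp
qed

lemma locally_integrable_translate:
  assumes "locally_integrable h"
  shows "locally_integrable (\<lambda>x. h (x + v))"
proof -
  have "set_integrable lebesgue K (\<lambda>x. h (x + v))" if K: "compact K" for K
  proof -
    have "compact ((\<lambda>x. v + x) ` K)" by (rule compact_translation[OF K])
    then have "integrable lebesgue (\<lambda>x. indicator ((\<lambda>x. v + x) ` K) x *\<^sub>R h x)"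
      using assms unfolding locally_integrable_def set_integrable_def by blast
    from integrable_lebesgue_translate[OF this, of v]
    have "integrable lebesgue (\<lambda>x. indicator ((\<lambda>x. v + x) ` K) (x + v) *\<^sub>R h (x + v))" .
    moreover have "indicator ((\<lambda>x. v + x) ` K) (x + v) = (indicator K x :: real)" for x
      by (auto simp: indicator_def image_iff add.commute)
    ultimately show ?thesis by (simp add: set_integrable_def)
  qed
  then show ?thesis by (simp add: locally_integrable_def)
qed

lemma has_weak_partial_translate:
  assumes "has_weak_partial f b g" "b \<in> Basis"
  shows "has_weak_partial (\<lambda>x. f (x + v)) b (\<lambda>x. g (x + v))"
  unfolding has_weak_partial_def
proof (intro conjI allI impI)
  have li: "locally_integrable f" "locally_integrable g" using assms by (auto simp: has_weak_partial_def)
  then show "locally_integrable (\<lambda>x. f (x + v))" "locally_integrable (\<lambda>x. g (x + v))"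
    by (auto intro: locally_integrable_translate)
  fix \<psi> :: "'a \<Rightarrow> real" assume \<psi>: "test_function \<psi>"
  have t: "test_function (\<lambda>x. \<psi> (x - v))" using test_function_translate[OF \<psi>, of "- v"] by simp
  have fd: "frechet_derivative (\<lambda>x. \<psi> (x - v)) (at x) = frechet_derivative \<psi> (at (x - v))" for x
    using frechet_derivative_translate[OF test_function_smooth[OF \<psi>], of "- v"] by simp
  have "(LINT x|lebesgue. f (x + v) * frechet_derivative \<psi> (at x) b)
      = (LINT x|lebesgue. f x * frechet_derivative (\<lambda>x. \<psi> (x - v)) (at x) b)"
    using integral_lebesgue_translate[OF borel_measurable_integrable[OF integrable_mult_test(2)[OF li(1) t assms(2)]], of v]
    by (simp add: fd)
  also have "\<dots> = - (LINT x|lebesgue. g x * \<psi> (x - v))"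
    using assms(1) t by (simp add: has_weak_partial_def)
  also have "(LINT x|lebesgue. g x * \<psi> (x - v)) = (LINT x|lebesgue. g (x + v) * \<psi> x)"
    using integral_lebesgue_translate[OF borel_measurable_integrable[OF integrable_mult_test(1)[OF li(2) t]], of v]
    by simp
  finally show "(LINT x|lebesgue. f (x + v) * frechet_derivative \<psi> (at x) b) = - (LINT x|lebesgue. g (x + v) * \<psi> x)" .
qed

lemma has_weak_partial_AE_cong:
  assumes "has_weak_partial f b g" "locally_integrable f'" "AE x in lebesgue. f x = f' x" "b \<in> Basis"
  shows "has_weak_partial f' b g"
  unfolding has_weak_partial_def
proof (intro conjI allI impI)
  show "locally_integrable f'" by fact
  show "locally_integrable g" using assms by (auto simp: has_weak_partial_def)
  fix \<psi> :: "'a \<Rightarrow> real" assume \<psi>: "test_function \<psi>"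
  have li: "locally_integrable f" using assms by (auto simp: has_weak_partial_def)
  have "(LINT x|lebesgue. f' x * frechet_derivative \<psi> (at x) b) = (LINT x|lebesgue. f x * frechet_derivative \<psi> (at x) b)"
  proof (rule integral_cong_AE[OF borel_measurable_integrable[OF integrable_mult_test(2)[OF assms(2) \<psi> assms(4)]]
        borel_measurable_integrable[OF integrable_mult_test(2)[OF li \<psi> assms(4)]]])
    show "AE x in lebesgue. f' x * frechet_derivative \<psi> (at x) b = f x * frechet_derivative \<psi> (at x) b"
      using assms(3) by eventually_elim simp
  qed
  then show "(LINT x|lebesgue. f' x * frechet_derivative \<psi> (at x) b) = - (LINT x|lebesgue. g x * \<psi> x)"
    using assms(1) \<psi> by (simp add: has_weak_partial_def)
qed

text \<open>The translate of g is a weak derivative of the translate of f, which agrees with f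
  almost everywhere; uniqueness then identifies it with g.\<close>

lemma ae_periodic_weak_partial:
  assumes "ae_periodic f" "has_weak_partial f b g" "b \<in> Basis"
  shows "ae_periodic g"
  unfolding ae_periodic_def
proof
  fix b' :: point assume b': "b' \<in> Basis"
  have li: "locally_integrable f" using assms by (auto simp: has_weak_partial_def)
  have "has_weak_partial f b (\<lambda>\<xi>. g (\<xi> + (2 * pi) *\<^sub>R b'))"
    by (rule has_weak_partial_AE_cong[OF has_weak_partial_translate[OF assms(2,3)] li _ assms(3)])
      (use assms(1) b' in \<open>auto simp: ae_periodic_def\<close>)
  from has_weak_partial_unique[OF this assms(2)] show "AE \<xi> in lebesgue. g (\<xi> + (2 * pi) *\<^sub>R b') = g \<xi>" .
qed

text \<open>Integration by parts is the vanishing of the integral of the derivative of the test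
  function \<open>\<psi> x * f x\<close>.\<close>

lemma has_weak_partial_smooth:
  fixes f :: "'a::euclidean_space \<Rightarrow> real"
  assumes "smooth f" "b \<in> Basis"
  shows "has_weak_partial f b (\<lambda>x. frechet_derivative f (at x) b)"
  unfolding has_weak_partial_def
proof (intro conjI allI impI)
  show li: "locally_integrable f" "locally_integrable (\<lambda>x. frechet_derivative f (at x) b)"
    using assms by (auto intro!: locally_integrable_continuous smooth_continuous smooth_partial)
  fix \<psi> :: "'a \<Rightarrow> real" assume \<psi>: "test_function \<psi>"
  have "test_function (\<lambda>x. \<psi> x * f x)" by (rule test_function_mult[OF \<psi> assms(1)])
  from integral_partial_test_function[OF this assms(2)]
  have "(LINT x|lebesgue. f x * frechet_derivative \<psi> (at x) b + frechet_derivative f (at x) b * \<psi> x) = 0"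
    by (simp add: frechet_derivative_mult[OF test_function_smooth[OF \<psi>] assms(1)] mult.commute add.commute)
  then show "(LINT x|lebesgue. f x * frechet_derivative \<psi> (at x) b) = - (LINT x|lebesgue. frechet_derivative f (at x) b * \<psi> x)"
    using integrable_mult_test(2)[OF li(1) \<psi> assms(2)] integrable_mult_test(1)[OF li(2) \<psi>] by simp
qed

section \<open>Weak derivatives of periodic functions and Fourier coefficients\<close>

lemma weak_partial_H1_per:
  assumes "f \<in> H1_per" "b \<in> Basis"
  shows "has_weak_partial f b (weak_partial b f)"
proof -
  obtain g where "has_weak_partial f b g" using assms by (auto simp: H1_per_def)
  then show ?thesis unfolding weak_partial_def by (rule someI[of "has_weak_partial f b"])
qed

lemma weak_partial_smooth:
  fixes f :: "point \<Rightarrow> real"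
  assumes "smooth f" "b \<in> Basis"
  shows "AE \<xi> in lebesgue. weak_partial b f \<xi> = frechet_derivative f (at \<xi>) b"
    and "has_weak_partial f b (weak_partial b f)"
proof -
  note * = has_weak_partial_smooth[OF assms]
  show "has_weak_partial f b (weak_partial b f)"
    unfolding weak_partial_def by (rule someI[of "has_weak_partial f b", OF *])
  from has_weak_partial_unique[OF this *]
  show "AE \<xi> in lebesgue. weak_partial b f \<xi> = frechet_derivative f (at \<xi>) b" .
qed

lemma set_integrable_iff_cell: "set_integrable lebesgue Upsilon u \<longleftrightarrow> integrable cell (u :: point \<Rightarrow> real)"
  by (simp add: set_integrable_def integrable_restrict_space)

lemma square_integrable_on_cell_iff:
  "square_integrable_on u Upsilon \<longleftrightarrow> u \<in> borel_measurable cell \<and> integrable cell (\<lambda>\<xi>. (u \<xi>)\<^sup>2)"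
  by (simp add: square_integrable_on_def set_integrable_iff_cell set_borel_measurable_def
      borel_measurable_restrict_space_iff)

lemma integrable_cell_bounded:
  fixes u :: "point \<Rightarrow> real"
  assumes "u \<in> borel_measurable cell" "AE \<xi> in cell. \<bar>u \<xi>\<bar> \<le> B"
  shows "integrable cell u"
  using finite_measure.integrable_const_bound[OF finite_measure_cell, of u B] assms by simp

lemma square_integrable_imp_integrable:
  fixes u :: "point \<Rightarrow> real"
  assumes "u \<in> borel_measurable cell" "integrable cell (\<lambda>\<xi>. (u \<xi>)\<^sup>2)"
  shows "integrable cell u"
proof -
  have "integrable cell (\<lambda>\<xi>. 1 + (u \<xi>)\<^sup>2)"
    using assms(2) integrable_cell_bounded[of "\<lambda>_. 1" 1] by simp
  then show ?thesis
  proof (rule Bochner_Integration.integrable_bound)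
    have "\<bar>t\<bar> \<le> 1 + t\<^sup>2" for t :: real
    proof -
      have "0 \<le> (\<bar>t\<bar> - 1)\<^sup>2 + t\<^sup>2 + 1" by simp
      also have "\<dots> = 2 * (1 + t\<^sup>2 - \<bar>t\<bar>)" by (simp add: power2_eq_square algebra_simps)
      finally show ?thesis by simp
    qed
    then show "AE \<xi> in cell. norm (u \<xi>) \<le> norm (1 + (u \<xi>)\<^sup>2)"
      by (intro AE_I2) (simp add: abs_of_nonneg add_nonneg_nonneg)
  qed (rule assms)
qed

lemma wave_measurable: "wave k c \<in> borel_measurable cell"
  by (rule measurable_cell_continuous[OF smooth_continuous[OF smooth_wave]])

lemma integrable_mult_wave:
  "integrable cell h \<Longrightarrow> integrable cell (\<lambda>\<xi>. h \<xi> * wave k c \<xi>)"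
  by (rule Bochner_Integration.integrable_bound)
    (auto intro!: AE_I2 borel_measurable_times wave_measurable mult_left_le simp: abs_mult abs_wave_le)

lemma periodic_imp_ae_periodic:
  assumes "\<And>\<xi> l. f (\<xi> + lattice l) = f \<xi>"
  shows "ae_periodic f"
  unfolding ae_periodic_def
proof
  fix b :: point assume "b \<in> Basis"
  then obtain l where "(2 * pi) *\<^sub>R b = lattice l" by (rule lattice_Basis)
  then show "AE \<xi> in lebesgue. f (\<xi> + (2 * pi) *\<^sub>R b) = f \<xi>" using assms by simp
qed

lemma AE_weak_partial_wave:
  "b \<in> Basis \<Longrightarrow> AE \<xi> in lebesgue. weak_partial b (wave k c) \<xi> = (b \<bullet> freq k) * wave k (c + pi / 2) \<xi>"
  using weak_partial_smooth(1)[OF smooth_wave] by (simp add: frechet_derivative_wave)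

text \<open>Makes the waves admissible in the weak formulation. The chosen weak derivative is square
  integrable on the cell because it equals a bounded function almost everywhere.\<close>

lemma wave_H1_per: "wave k c \<in> H1_per"
  unfolding H1_per_def
proof (intro CollectI conjI ballI)
  have bounded_sq: "square_integrable_on u Upsilon"
    if "u \<in> borel_measurable cell" "AE \<xi> in cell. \<bar>u \<xi>\<bar> \<le> B" for u B
    unfolding square_integrable_on_cell_iff
  proof (intro conjI that(1) integrable_cell_bounded)
    show "AE \<xi> in cell. \<bar>(u \<xi>)\<^sup>2\<bar> \<le> B\<^sup>2"
      using that(2) by eventually_elim (simp add: power2_le_iff_abs_le abs_le_square_iff[symmetric])
  qed (use that(1) in auto)
  show "ae_periodic (wave k c)" by (rule periodic_imp_ae_periodic[OF wave_lattice])
  show "square_integrable_on (wave k c) Upsilon"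
    by (rule bounded_sq[OF wave_measurable, of _ _ 1]) (simp add: abs_wave_le)
  fix b :: point assume b: "b \<in> Basis"
  show "\<exists>g. has_weak_partial (wave k c) b g" by (rule exI[of "has_weak_partial (wave k c) b", OF has_weak_partial_smooth[OF smooth_wave b]])
  show "square_integrable_on (weak_partial b (wave k c)) Upsilon"
  proof (rule bounded_sq)
    have "locally_integrable (weak_partial b (wave k c))"
      using weak_partial_smooth(2)[OF smooth_wave b] by (simp add: has_weak_partial_def)
    then show "weak_partial b (wave k c) \<in> borel_measurable cell"
      by (intro measurable_restrict_space1 locally_integrable_measurable)
    show "AE \<xi> in cell. \<bar>weak_partial b (wave k c) \<xi>\<bar> \<le> \<bar>b \<bullet> freq k\<bar>"
      unfolding AE_cell_iff using AE_weak_partial_wave[OF b, of k c]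
      by eventually_elim (simp add: abs_mult mult_left_le abs_wave_le)
  qed
qed

section \<open>A partition of unity under the lattice, and integration by parts on the cell\<close>

text \<open>The lattice translates of \<open>partition_fn\<close> sum to one on the cell, so testing against its product with
  a periodic function turns integrals over the whole space into integrals over one cell.\<close>

definition pulse :: "real \<Rightarrow> real" where
  "pulse t = step t - step (t - 2 * pi)"

definition partition_fn :: "point \<Rightarrow> real" where
  "partition_fn \<xi> = (\<Prod>b\<in>Basis. pulse (\<xi> \<bullet> b))"

lemma pulse_eq_0: "\<not> (0 \<le> t \<and> t \<le> 4 * pi) \<Longrightarrow> pulse t = 0"
proof -
  assume *: "\<not> (0 \<le> t \<and> t \<le> 4 * pi)"
  have "1 \<le> 2 * pi" using pi_gt3 by linarith
  show ?thesis
  proof (cases "t < 0")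
    case True
    then have "t - 2 * pi \<le> 0" using pi_gt_zero by linarith
    then show ?thesis using True by (simp add: pulse_def step_nonpos)
  next
    case False
    then have "1 \<le> t" "1 \<le> t - 2 * pi" using * \<open>1 \<le> 2 * pi\<close> by linarith+
    then show ?thesis by (simp add: pulse_def step_ge_1)
  qed
qed

text \<open>The sum telescopes to \<open>step (t + 2 * pi) - step (t - 2 * pi)\<close>, whose
  arguments lie in the ranges where \<open>step\<close> is 1 and 0.\<close>

lemma pulse_add_period:
  assumes "0 < t" "t < 2 * pi"
  shows "pulse t + pulse (t + 2 * pi) = 1"
proof -
  have "1 \<le> t + 2 * pi" using assms pi_gt3 by linarith
  then show ?thesis using assms by (simp add: pulse_def step_nonpos step_ge_1)
qed

lemma partition_fn_eq_0: "\<not> (\<forall>b\<in>Basis. 0 \<le> \<xi> \<bullet> b \<and> \<xi> \<bullet> b \<le> 4 * pi) \<Longrightarrow> partition_fn \<xi> = 0"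
  unfolding partition_fn_def using pulse_eq_0 by (intro prod_zero) auto

lemma support_partition_fn: "{\<xi>. partition_fn \<xi> \<noteq> 0} \<subseteq> cbox 0 ((4 * pi) *\<^sub>R \<Sum>Basis)"
proof
  fix \<xi> assume "\<xi> \<in> {\<xi>. partition_fn \<xi> \<noteq> 0}"
  then have "\<forall>b\<in>Basis. 0 \<le> \<xi> \<bullet> b \<and> \<xi> \<bullet> b \<le> 4 * pi" using partition_fn_eq_0 by blast
  then show "\<xi> \<in> cbox 0 ((4 * pi) *\<^sub>R \<Sum>Basis)" by (simp add: mem_box inner_sum_left inner_Basis)
qed

lemma test_function_partition_fn: "test_function partition_fn"
proof (rule test_functionI)
  have "C_k k (\<lambda>\<xi>::point. pulse (\<xi> \<bullet> b))" for k b
    using C_k_diff[OF C_k_compose_affine[OF C_k_step, of k b 0] C_k_compose_affine[OF C_k_step, of k b "- 2 * pi"]]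
    by (simp add: pulse_def)
  then have "C_k k partition_fn" for k unfolding partition_fn_def[abs_def] by (rule C_k_prod)
  then show "smooth partition_fn" by (simp add: smooth_def)
  show "bounded {\<xi>. partition_fn \<xi> \<noteq> 0}" by (rule bounded_subset[OF bounded_cbox support_partition_fn])
qed

abbreviation near_cells :: "((int \<times> int) \<times> int) set" where
  "near_cells \<equiv> ({0, 1} \<times> {0, 1}) \<times> {0, 1}"

lemma sum_partition_fn:
  assumes "\<xi> \<in> Upsilon"
  shows "(\<Sum>k\<in>near_cells. partition_fn (\<xi> + lattice k)) = 1"
proof -
  have ax: "axis 1 1 \<noteq> (axis 2 1 :: real^2)" by (simp add: axis_eq_axis)
  have prod: "partition_fn \<zeta> = pulse (fst \<zeta> $ 1) * pulse (fst \<zeta> $ 2) * pulse (snd \<zeta>)" for \<zeta>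
    using ax by (simp add: partition_fn_def Basis_point_eq inner_prod_def inner_axis)
  let ?a = "fst \<xi> $ 1" and ?b = "fst \<xi> $ 2" and ?c = "snd \<xi>"
  have "partition_fn (\<xi> + lattice ((i, j), l)) = pulse (?a + 2 * pi * i) * pulse (?b + 2 * pi * j) * pulse (?c + 2 * pi * l)"
    for i j l :: int by (simp add: prod lattice_def freq_def)
  then have "(\<Sum>k\<in>near_cells. partition_fn (\<xi> + lattice k))
      = (pulse ?a + pulse (?a + 2 * pi)) * (pulse ?b + pulse (?b + 2 * pi)) * (pulse ?c + pulse (?c + 2 * pi))"
    by (simp add: sum.cartesian_product[symmetric] split_def sum.Sigma[symmetric] algebra_simps)
  also have "\<dots> = 1"
    using assms by (subst (1 2 3) pulse_add_period) (auto simp: Upsilon_def Omega_def)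
  finally show ?thesis .
qed

text \<open>The sum of the translates is constant on the open cell, so its derivative vanishes
  there.\<close>

lemma sum_partial_partition_fn:
  assumes "\<xi> \<in> Upsilon"
  shows "(\<Sum>k\<in>near_cells. frechet_derivative partition_fn (at (\<xi> + lattice k)) b) = 0"
proof -
  note sm = test_function_smooth[OF test_function_partition_fn]
  have "((\<lambda>\<zeta>. \<Sum>k\<in>near_cells. partition_fn (\<zeta> + lattice k)) has_derivative
      (\<lambda>h. \<Sum>k\<in>near_cells. frechet_derivative partition_fn (at (\<xi> + lattice k)) h)) (at \<xi>)"
  proof (rule has_derivative_sum)
    fix k
    show "((\<lambda>\<zeta>. partition_fn (\<zeta> + lattice k)) has_derivative frechet_derivative partition_fn (at (\<xi> + lattice k))) (at \<xi>)"
      using smooth_has_derivative[OF smooth_translate[OF sm, of "lattice k"], of \<xi>]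
      by (simp only: frechet_derivative_translate[OF sm])
  qed
  moreover have "((\<lambda>\<zeta>. \<Sum>k\<in>near_cells. partition_fn (\<zeta> + lattice k)) has_derivative (\<lambda>h. 0)) (at \<xi>)"
    by (rule has_derivative_transform_within_open[OF has_derivative_const open_Upsilon assms])
      (simp only: sum_partition_fn)
  ultimately have "(\<lambda>h. \<Sum>k\<in>near_cells. frechet_derivative partition_fn (at (\<xi> + lattice k)) h) = (\<lambda>h. 0)"
    by (rule has_derivative_unique)
  then show ?thesis by metis
qed

text \<open>Integration by parts without boundary terms. The test function is
  \<open>partition_fn\<close> times the wave; after periodization the derivatives of
  \<open>partition_fn\<close> cancel and only the derivative of the wave survives.\<close>

lemma integral_weak_partial_wave:
  assumes f: "f \<in> H1_per" and b: "b \<in> Basis"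
  shows "(LINT \<xi>|cell. weak_partial b f \<xi> * wave k c \<xi>) = - (b \<bullet> freq k) * (LINT \<xi>|cell. f \<xi> * wave k (c + pi / 2) \<xi>)"
proof -
  let ?g = "weak_partial b f"
  let ?\<psi> = "\<lambda>\<xi>. partition_fn \<xi> * wave k c \<xi>"
  let ?D = "\<lambda>\<xi>. frechet_derivative ?\<psi> (at \<xi>) b"
  note wp = weak_partial_H1_per[OF f b]
  have li: "locally_integrable f" "locally_integrable ?g" using wp by (auto simp: has_weak_partial_def)
  have per: "ae_periodic f" using f by (simp add: H1_per_def)
  have perg: "ae_periodic ?g" by (rule ae_periodic_weak_partial[OF per wp b])
  have \<psi>: "test_function ?\<psi>" by (rule test_function_mult[OF test_function_partition_fn smooth_wave])
  note sm = test_function_smooth[OF test_function_partition_fn]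
  have D: "?D \<xi> = partition_fn \<xi> * ((b \<bullet> freq k) * wave k (c + pi / 2) \<xi>) + frechet_derivative partition_fn (at \<xi>) b * wave k c \<xi>" for \<xi>
    by (simp add: frechet_derivative_mult[OF sm smooth_wave] frechet_derivative_wave)
  have supp: "?\<psi> \<xi> = 0" "?D \<xi> = 0" if "\<not> (\<forall>b\<in>Basis. 0 \<le> \<xi> \<bullet> b \<and> \<xi> \<bullet> b \<le> 4 * pi)" for \<xi>
  proof -
    show "?\<psi> \<xi> = 0" using partition_fn_eq_0[OF that] by simp
    have "closure {x. partition_fn x \<noteq> 0} \<subseteq> cbox 0 ((4 * pi) *\<^sub>R \<Sum>Basis)"
      by (rule closure_minimal[OF support_partition_fn closed_cbox])
    moreover have "\<xi> \<notin> cbox 0 ((4 * pi) *\<^sub>R \<Sum>Basis)"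
      using that by (auto simp: mem_box inner_sum_left inner_Basis)
    ultimately have "frechet_derivative partition_fn (at \<xi>) b = 0"
      by (intro frechet_derivative_outside_support) auto
    then show "?D \<xi> = 0" using partition_fn_eq_0[OF that] by (simp only: D mult_zero_left add_0_left)
  qed
  have "(LINT \<xi>|lebesgue. f \<xi> * ?D \<xi>) = (LINT \<xi>|cell. f \<xi> * (\<Sum>l\<in>near_cells. ?D (\<xi> + lattice l)))"
    by (rule integral_periodize[OF per locally_integrable_measurable[OF li(1)]
          continuous_borel_measurable_lebesgue[OF smooth_continuous[OF smooth_partial[OF test_function_smooth[OF \<psi>] b]]]
          integrable_mult_test(2)[OF li(1) \<psi> b] supp(2)])
  also have "\<dots> = (LINT \<xi>|cell. (b \<bullet> freq k) * (f \<xi> * wave k (c + pi / 2) \<xi>))"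
  proof (rule Bochner_Integration.integral_cong[OF refl])
    fix \<xi> assume "\<xi> \<in> space cell"
    then have \<xi>: "\<xi> \<in> Upsilon" by simp
    have "(\<Sum>l\<in>near_cells. ?D (\<xi> + lattice l))
        = (\<Sum>l\<in>near_cells. partition_fn (\<xi> + lattice l)) * ((b \<bullet> freq k) * wave k (c + pi / 2) \<xi>)
        + (\<Sum>l\<in>near_cells. frechet_derivative partition_fn (at (\<xi> + lattice l)) b) * wave k c \<xi>"
      unfolding D wave_lattice sum.distrib sum_distrib_right by (rule refl)
    then show "f \<xi> * (\<Sum>l\<in>near_cells. ?D (\<xi> + lattice l)) = (b \<bullet> freq k) * (f \<xi> * wave k (c + pi / 2) \<xi>)"
      unfolding sum_partition_fn[OF \<xi>] sum_partial_partition_fn[OF \<xi>] by simp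
  qed
  also have "\<dots> = (b \<bullet> freq k) * (LINT \<xi>|cell. f \<xi> * wave k (c + pi / 2) \<xi>)" by simp
  finally have 1: "(LINT \<xi>|lebesgue. f \<xi> * ?D \<xi>) = (b \<bullet> freq k) * (LINT \<xi>|cell. f \<xi> * wave k (c + pi / 2) \<xi>)" .
  have "(LINT \<xi>|lebesgue. ?g \<xi> * ?\<psi> \<xi>) = (LINT \<xi>|cell. ?g \<xi> * (\<Sum>l\<in>near_cells. ?\<psi> (\<xi> + lattice l)))"
    by (rule integral_periodize[OF perg locally_integrable_measurable[OF li(2)]
          continuous_borel_measurable_lebesgue[OF smooth_continuous[OF test_function_smooth[OF \<psi>]]]
          integrable_mult_test(1)[OF li(2) \<psi>] supp(1)])
  also have "\<dots> = (LINT \<xi>|cell. ?g \<xi> * wave k c \<xi>)"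
  proof (rule Bochner_Integration.integral_cong[OF refl])
    fix \<xi> assume "\<xi> \<in> space cell"
    then have \<xi>: "\<xi> \<in> Upsilon" by simp
    show "?g \<xi> * (\<Sum>l\<in>near_cells. ?\<psi> (\<xi> + lattice l)) = ?g \<xi> * wave k c \<xi>"
      unfolding wave_lattice sum_distrib_right[symmetric] sum_partition_fn[OF \<xi>] by simp
  qed
  finally have 2: "(LINT \<xi>|lebesgue. ?g \<xi> * ?\<psi> \<xi>) = (LINT \<xi>|cell. ?g \<xi> * wave k c \<xi>)" .
  have "(LINT \<xi>|lebesgue. f \<xi> * ?D \<xi>) = - (LINT \<xi>|lebesgue. ?g \<xi> * ?\<psi> \<xi>)"
    using wp[unfolded has_weak_partial_def, THEN conjunct2, THEN conjunct2, rule_format, OF \<psi>] .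
  then show ?thesis unfolding 1 2 by simp
qed

lemma freq_eq_0_iff: "freq k = 0 \<longleftrightarrow> k = 0"
  by (auto simp: freq_def prod_eq_iff vec_eq_iff forall_2)

text \<open>Orthogonality from integration by parts: the constant 1 is \<open>wave 0 0\<close>, its
  weak derivative is 0, and some component of the frequency can be divided out.\<close>

lemma integral_wave_0:
  assumes "k \<noteq> 0"
  shows "(LINT \<xi>|cell. wave k c \<xi>) = 0"
proof -
  obtain b :: point where b: "b \<in> Basis" "b \<bullet> freq k \<noteq> 0"
    using assms euclidean_all_zero_iff[of "freq k"] by (auto simp: freq_eq_0_iff inner_commute)
  have "AE \<xi> in cell. weak_partial b (wave 0 0) \<xi> = 0"
    unfolding AE_cell_iff using AE_weak_partial_wave[OF b(1), of 0 0] by eventually_elim simp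
  then have "(LINT \<xi>|cell. weak_partial b (wave 0 0) \<xi> * wave k (c - pi / 2) \<xi>) = 0"
    by (intro integral_eq_zero_AE) (auto elim!: eventually_mono)
  then show ?thesis
    using integral_weak_partial_wave[OF wave_H1_per b(1), of 0 0 k "c - pi / 2"] b(2)
    by (simp add: wave_def[of 0 0])
qed

lemma integral_expo: "(LINT \<xi>|cell. expo k \<xi>) = (if k = 0 then of_real (measure lebesgue Upsilon) else 0)"
proof (cases "k = 0")
  case True
  then show ?thesis by (simp add: measure_restrict_space scaleR_conv_of_real)
next
  case False
  have "integrable cell (\<lambda>_. 1 :: real)" by (rule integrable_cell_bounded[where B = 1]) auto
  from integral_expo_eq_waves[OF this, of k] show ?thesis
    using False by (simp add: integral_wave_0 complex_eq_iff)
qed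

section \<open>Square integrable functions: Bessel and convolution estimates\<close>

text \<open>The integral is not normalised: the k-th term of the Fourier series has coefficient
  \<open>coef h k / vol\<close>.\<close>

definition coef :: "(point \<Rightarrow> complex) \<Rightarrow> (int \<times> int) \<times> int \<Rightarrow> complex" where
  "coef h k = (LINT \<xi>|cell. h \<xi> * cnj (expo k \<xi>))"

abbreviation vol :: real where
  "vol \<equiv> measure lebesgue Upsilon"

lemma vol_pos: "0 < vol"
proof -
  have "((\<chi> i. pi), pi) \<in> Upsilon" by (simp add: Upsilon_def Omega_def)
  then have "\<not> negligible Upsilon" using open_not_negligible[OF open_Upsilon] by blast
  then have "vol \<noteq> 0" using Upsilon_lmeasurable by (simp add: negligible_iff_measure)
  then show ?thesis using measure_nonneg[of lebesgue Upsilon] by linarith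
qed

definition L2 :: "(point \<Rightarrow> complex) \<Rightarrow> bool" where
  "L2 h \<longleftrightarrow> h \<in> borel_measurable cell \<and> integrable cell (\<lambda>\<xi>. (cmod (h \<xi>))\<^sup>2)"

lemma L2_of_real: "L2 (\<lambda>\<xi>. complex_of_real (f \<xi>)) \<longleftrightarrow> square_integrable_on f Upsilon"
proof -
  have "f \<in> borel_measurable cell" if "(\<lambda>\<xi>. complex_of_real (f \<xi>)) \<in> borel_measurable cell"
    using measurable_compose[OF that borel_measurable_Re] by simp
  moreover have "(\<lambda>\<xi>. complex_of_real (f \<xi>)) \<in> borel_measurable cell" if "f \<in> borel_measurable cell"
    using that by simp
  ultimately have meas: "(\<lambda>\<xi>. complex_of_real (f \<xi>)) \<in> borel_measurable cell \<longleftrightarrow> f \<in> borel_measurable cell"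
    by (rule iffI)
  show ?thesis unfolding L2_def square_integrable_on_cell_iff meas by simp
qed

lemma L2_bounded:
  assumes "h \<in> borel_measurable cell" "\<And>\<xi>. \<xi> \<in> Upsilon \<Longrightarrow> cmod (h \<xi>) \<le> B"
  shows "L2 h"
  unfolding L2_def
proof (intro conjI assms(1) integrable_cell_bounded)
  show "AE \<xi> in cell. \<bar>(cmod (h \<xi>))\<^sup>2\<bar> \<le> B\<^sup>2"
    by (rule AE_I2) (use assms(2) in \<open>auto intro!: power_mono\<close>)
qed (use assms(1) in auto)

lemma two_mult_le_squares: "2 * (x * y) \<le> x\<^sup>2 + (y::real)\<^sup>2"
  using sum_squares_bound[of x y] by (simp add: mult.assoc)

lemma L2_integrable_mult:
  assumes "L2 g" "L2 h"
  shows "integrable cell (\<lambda>\<xi>. g \<xi> * h \<xi>)"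
proof (rule Bochner_Integration.integrable_bound)
  show "integrable cell (\<lambda>\<xi>. (cmod (g \<xi>))\<^sup>2 + (cmod (h \<xi>))\<^sup>2)"
    using assms by (auto simp: L2_def)
  show "(\<lambda>\<xi>. g \<xi> * h \<xi>) \<in> borel_measurable cell" using assms by (auto simp: L2_def)
  have "x * y \<le> x\<^sup>2 + y\<^sup>2" if "0 \<le> x" "0 \<le> y" for x y :: real
    using two_mult_le_squares[of x y] mult_nonneg_nonneg[OF that] by linarith
  then show "AE \<xi> in cell. norm (g \<xi> * h \<xi>) \<le> norm ((cmod (g \<xi>))\<^sup>2 + (cmod (h \<xi>))\<^sup>2)"
    by (intro AE_I2) (simp add: norm_mult)
qed

lemma L2_cnj: "L2 h \<Longrightarrow> L2 (\<lambda>\<xi>. cnj (h \<xi>))"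
  unfolding L2_def
  by (auto intro: measurable_compose[OF _ borel_measurable_continuous_onI[OF linear_continuous_on[OF bounded_linear_cnj]]])

lemma L2_mult_expo: "L2 h \<Longrightarrow> L2 (\<lambda>\<xi>. h \<xi> * expo k \<xi>)"
  by (auto simp: L2_def norm_mult)

lemma L2_diff:
  assumes "L2 g" "L2 h"
  shows "L2 (\<lambda>\<xi>. g \<xi> - h \<xi>)"
  unfolding L2_def
proof (intro conjI)
  show m: "(\<lambda>\<xi>. g \<xi> - h \<xi>) \<in> borel_measurable cell" using assms by (auto simp: L2_def)
  show "integrable cell (\<lambda>\<xi>. (cmod (g \<xi> - h \<xi>))\<^sup>2)"
  proof (rule Bochner_Integration.integrable_bound)
    show "integrable cell (\<lambda>\<xi>. 2 * (cmod (g \<xi>))\<^sup>2 + 2 * (cmod (h \<xi>))\<^sup>2)"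
      using assms by (auto simp: L2_def)
    show "(\<lambda>\<xi>. (cmod (g \<xi> - h \<xi>))\<^sup>2) \<in> borel_measurable cell" using m by measurable
    have "(cmod (a - b))\<^sup>2 \<le> 2 * (cmod a)\<^sup>2 + 2 * (cmod b)\<^sup>2" for a b
    proof -
      have "(cmod (a - b))\<^sup>2 \<le> (cmod a + cmod b)\<^sup>2" by (intro power_mono norm_triangle_ineq4) auto
      also have "\<dots> \<le> 2 * (cmod a)\<^sup>2 + 2 * (cmod b)\<^sup>2"
        using two_mult_le_squares[of "cmod a" "cmod b"] by (simp add: power2_sum)
      finally show ?thesis .
    qed
    then show "AE \<xi> in cell. norm ((cmod (g \<xi> - h \<xi>))\<^sup>2) \<le> norm (2 * (cmod (g \<xi>))\<^sup>2 + 2 * (cmod (h \<xi>))\<^sup>2)"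
      by (intro AE_I2) simp
  qed
qed

lemma trig_sum_expo: "trig (\<lambda>\<xi>. \<Sum>k\<in>F. c k * expo k \<xi>)"
  by (rule trig_sum) (rule trig_expo)

lemma L2_trig:
  assumes "trig p"
  shows "L2 p"
proof -
  have "continuous_on (cbox 0 ((2 * pi) *\<^sub>R \<Sum>Basis)) p" by (rule continuous_trig[OF assms])
  then have "bounded (p ` cbox 0 ((2 * pi) *\<^sub>R \<Sum>Basis))"
    by (intro compact_imp_bounded compact_continuous_image) auto
  then obtain B where B: "\<forall>y\<in>p ` cbox 0 ((2 * pi) *\<^sub>R \<Sum>Basis). norm y \<le> B" unfolding bounded_iff by blast
  show ?thesis
  proof (rule L2_bounded)
    show "p \<in> borel_measurable cell" by (rule measurable_cell_continuous[OF continuous_trig[OF assms]])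
    show "cmod (p \<xi>) \<le> B" if "\<xi> \<in> Upsilon" for \<xi>
      using B that box_subset_cbox unfolding Upsilon_eq_box by blast
  qed
qed

lemma L2_expo: "L2 (expo k)"
  using L2_trig[OF trig_expo[of 1 k]] by simp

lemma integral_expo_cnj: "(LINT \<xi>|cell. expo k \<xi> * cnj (expo l \<xi>)) = (if k = l then of_real vol else 0)"
proof -
  have "expo k \<xi> * cnj (expo l \<xi>) = expo (k - l) \<xi>" for \<xi>
    using expo_add[of k "- l" \<xi>] by (simp add: expo_minus)
  then show ?thesis by (simp add: integral_expo)
qed

lemma integral_mult_sum_expo:
  assumes "L2 h"
  shows "(LINT \<xi>|cell. (\<Sum>k\<in>F. c k * expo k \<xi>) * h \<xi>) = (\<Sum>k\<in>F. c k * (LINT \<xi>|cell. h \<xi> * expo k \<xi>))"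
proof -
  have int: "integrable cell (\<lambda>\<xi>. c k * (h \<xi> * expo k \<xi>))" for k
    by (rule integrable_mult_right[OF L2_integrable_mult[OF assms L2_expo]])
  have "(LINT \<xi>|cell. (\<Sum>k\<in>F. c k * expo k \<xi>) * h \<xi>) = (LINT \<xi>|cell. (\<Sum>k\<in>F. c k * (h \<xi> * expo k \<xi>)))"
    by (simp add: sum_distrib_left mult_ac)
  also have "\<dots> = (\<Sum>k\<in>F. c k * (LINT \<xi>|cell. h \<xi> * expo k \<xi>))"
    by (subst Bochner_Integration.integral_sum[OF int]) simp
  finally show ?thesis .
qed

lemma coef_cnj: "(LINT \<xi>|cell. cnj (h \<xi>) * expo k \<xi>) = cnj (coef h k)"
proof -
  have "cnj (coef h k) = (LINT \<xi>|cell. cnj (h \<xi> * cnj (expo k \<xi>)))"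
    unfolding coef_def by (rule Bochner_Integration.integral_cnj[symmetric])
  then show ?thesis by simp
qed

lemma coef_trig_sum:
  fixes c :: "(int \<times> int) \<times> int \<Rightarrow> complex"
  assumes "finite F"
  shows "coef (\<lambda>\<xi>. \<Sum>k\<in>F. c k * expo k \<xi>) l = (if l \<in> F then vol * c l else 0)"
proof -
  have "coef (\<lambda>\<xi>. \<Sum>k\<in>F. c k * expo k \<xi>) l = (\<Sum>k\<in>F. c k * (LINT \<xi>|cell. cnj (expo l \<xi>) * expo k \<xi>))"
    unfolding coef_def by (rule integral_mult_sum_expo[OF L2_cnj[OF L2_expo]])
  also have "\<dots> = (\<Sum>k\<in>F. if k = l then vol * c l else 0)"
    by (intro sum.cong) (auto simp: mult.commute[of "cnj _"] integral_expo_cnj mult.commute)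
  also have "\<dots> = (if l \<in> F then vol * c l else 0)" using assms by simp
  finally show ?thesis .
qed

text \<open>Completing the square. Both Bessel's inequality and the optimality of partial Fourier
  sums can be read off, since c occurs only in the last, nonnegative term.\<close>

lemma L2_dist_trig_sum:
  fixes c :: "(int \<times> int) \<times> int \<Rightarrow> complex"
  assumes h: "L2 h" and F: "finite F"
  shows "(LINT \<xi>|cell. (cmod (h \<xi> - (\<Sum>k\<in>F. c k * expo k \<xi>)))\<^sup>2) =
    (LINT \<xi>|cell. (cmod (h \<xi>))\<^sup>2) - (\<Sum>k\<in>F. (cmod (coef h k))\<^sup>2) / vol
      + vol * (\<Sum>k\<in>F. (cmod (c k - coef h k / vol))\<^sup>2)"
proof -
  let ?P = "\<lambda>\<xi>. \<Sum>k\<in>F. c k * expo k \<xi>"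
  have P: "L2 ?P" by (rule L2_trig[OF trig_sum_expo])
  note ints = L2_integrable_mult[OF h L2_cnj[OF h]] L2_integrable_mult[OF h L2_cnj[OF P]]
    L2_integrable_mult[OF P L2_cnj[OF h]] L2_integrable_mult[OF P L2_cnj[OF P]]
  have Ph: "(LINT \<xi>|cell. ?P \<xi> * cnj (h \<xi>)) = (\<Sum>k\<in>F. c k * cnj (coef h k))"
    using integral_mult_sum_expo[OF L2_cnj[OF h], of c F] by (simp only: coef_cnj)
  have hP: "(LINT \<xi>|cell. h \<xi> * cnj (?P \<xi>)) = (\<Sum>k\<in>F. cnj (c k) * coef h k)"
  proof -
    have "(LINT \<xi>|cell. h \<xi> * cnj (?P \<xi>)) = (LINT \<xi>|cell. cnj (?P \<xi> * cnj (h \<xi>)))"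
      by (simp add: mult.commute)
    also have "\<dots> = cnj (\<Sum>k\<in>F. c k * cnj (coef h k))"
      unfolding Ph[symmetric] by (rule Bochner_Integration.integral_cnj)
    finally show ?thesis by simp
  qed
  have PP: "(LINT \<xi>|cell. ?P \<xi> * cnj (?P \<xi>)) = (\<Sum>k\<in>F. vol * (c k * cnj (c k)))"
    unfolding integral_mult_sum_expo[OF L2_cnj[OF P]] coef_cnj coef_trig_sum[OF F]
    by (intro sum.cong) auto
  have sq: "complex_of_real ((cmod z)\<^sup>2) = z * cnj z" for z
    by (rule complex_norm_square)
  have "complex_of_real (LINT \<xi>|cell. (cmod (h \<xi> - ?P \<xi>))\<^sup>2)
      = (LINT \<xi>|cell. (h \<xi> * cnj (h \<xi>) - h \<xi> * cnj (?P \<xi>)) - (?P \<xi> * cnj (h \<xi>) - ?P \<xi> * cnj (?P \<xi>)))"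
    unfolding integral_complex_of_real[symmetric] sq complex_cnj_diff by (simp only: algebra_simps)
  also have "\<dots> = ((LINT \<xi>|cell. h \<xi> * cnj (h \<xi>)) - (LINT \<xi>|cell. h \<xi> * cnj (?P \<xi>)))
      - ((LINT \<xi>|cell. ?P \<xi> * cnj (h \<xi>)) - (LINT \<xi>|cell. ?P \<xi> * cnj (?P \<xi>)))"
    using ints by (subst Bochner_Integration.integral_diff; (intro Bochner_Integration.integrable_diff)?)
      (simp_all only: Bochner_Integration.integral_diff)
  also have "(LINT \<xi>|cell. h \<xi> * cnj (h \<xi>)) = of_real (LINT \<xi>|cell. (cmod (h \<xi>))\<^sup>2)"
    unfolding integral_complex_of_real[symmetric] sq ..
  also have "of_real (LINT \<xi>|cell. (cmod (h \<xi>))\<^sup>2) - (LINT \<xi>|cell. h \<xi> * cnj (?P \<xi>))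
      - ((LINT \<xi>|cell. ?P \<xi> * cnj (h \<xi>)) - (LINT \<xi>|cell. ?P \<xi> * cnj (?P \<xi>)))
      = of_real (LINT \<xi>|cell. (cmod (h \<xi>))\<^sup>2)
        + (\<Sum>k\<in>F. vol * (c k * cnj (c k)) - cnj (c k) * coef h k - c k * cnj (coef h k))"
    unfolding hP Ph PP by (simp add: sum.distrib sum_subtractf)
  \<comment> \<open>The square is completed for each frequency separately, with minimum at
    \<open>coef h k / vol\<close>.\<close>
  also have "(\<Sum>k\<in>F. vol * (c k * cnj (c k)) - cnj (c k) * coef h k - c k * cnj (coef h k))
      = (\<Sum>k\<in>F. complex_of_real (vol * (cmod (c k - coef h k / vol))\<^sup>2 - (cmod (coef h k))\<^sup>2 / vol))"
    using vol_pos by (intro sum.cong refl) (simp add: sq field_simps del: of_real_power)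
  also have "of_real (LINT \<xi>|cell. (cmod (h \<xi>))\<^sup>2) + \<dots> = complex_of_real
      ((LINT \<xi>|cell. (cmod (h \<xi>))\<^sup>2) - (\<Sum>k\<in>F. (cmod (coef h k))\<^sup>2) / vol
      + vol * (\<Sum>k\<in>F. (cmod (c k - coef h k / vol))\<^sup>2))"
    by (simp add: sum_subtractf sum_distrib_left sum_divide_distrib)
  finally show ?thesis by (simp only: of_real_eq_iff)
qed

lemma Bessel:
  assumes "L2 h" "finite F"
  shows "(\<Sum>k\<in>F. (cmod (coef h k))\<^sup>2) \<le> vol * (LINT \<xi>|cell. (cmod (h \<xi>))\<^sup>2)"
proof -
  \<comment> \<open>With the optimal coefficients the last term of \<open>L2_dist_trig_sum\<close>
    vanishes.\<close>
  have "0 \<le> (LINT \<xi>|cell. (cmod (h \<xi> - (\<Sum>k\<in>F. (coef h k / vol) * expo k \<xi>)))\<^sup>2)" by simp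
  then show ?thesis using vol_pos
    unfolding L2_dist_trig_sum[OF assms] by (simp add: field_simps)
qed

lemma sum_le_esum: "finite F \<Longrightarrow> (\<Sum>k\<in>F. f k) \<le> esum f"
proof -
  assume "finite F"
  then have "(\<Sum>k\<in>F. f k) = (\<integral>\<^sup>+ k. f k \<partial>count_space F)" by (simp add: nn_integral_count_space_finite)
  also have "\<dots> = esum (\<lambda>k. f k * indicator F k)" by (simp add: nn_integral_count_space_indicator)
  also have "\<dots> \<le> esum f" by (intro nn_integral_mono) (simp add: indicator_def)
  finally show ?thesis .
qed

lemma esum_le_bound:
  assumes "\<And>F. finite F \<Longrightarrow> (\<Sum>k\<in>F. f k) \<le> B" "\<And>k. 0 \<le> f k"
  shows "esum (\<lambda>k. ennreal (f k)) < \<infinity>"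
proof -
  have "f summable_on UNIV"
    by (rule nonneg_bdd_above_summable_on) (use assms in \<open>auto simp: bdd_above_def\<close>)
  then show ?thesis using esum_finite_iff[of f] assms(2) by blast
qed

lemma Bessel_esum: "L2 h \<Longrightarrow> esum (\<lambda>k. ennreal ((cmod (coef h k))\<^sup>2)) < \<infinity>"
  by (rule esum_le_bound[OF Bessel]) auto

lemma L2_trig_dense_bounded:
  fixes s :: "point \<Rightarrow> real"
  assumes s: "s \<in> borel_measurable lebesgue" "\<And>\<xi>. \<bar>s \<xi>\<bar> \<le> B" and e: "0 < e"
  shows "\<exists>p. trig p \<and> (LINT \<xi>|cell. (cmod (of_real (s \<xi>) - p \<xi>))\<^sup>2) < e"
proof -
  obtain p where p: "\<And>n. trig (p n)" "\<And>n \<xi>. \<xi> \<in> Upsilon \<Longrightarrow> norm (p n \<xi>) \<le> B + 1"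
    "AE \<xi> in lebesgue. \<xi> \<in> Upsilon \<longrightarrow> (\<lambda>n. p n \<xi>) \<longlonglongrightarrow> of_real (s \<xi>)"
    using trig_approx_bounded[OF s] by blast
  have sm: "s \<in> borel_measurable cell" using s(1) by (rule measurable_restrict_space1)
  have "(\<lambda>n. LINT \<xi>|cell. (cmod (of_real (s \<xi>) - p n \<xi>))\<^sup>2) \<longlonglongrightarrow> (LINT \<xi>|cell. 0)"
  \<comment> \<open>The dominating constant adds the bound B of s and the bound \<open>B + 1\<close>
    of the approximations.\<close>
  proof (rule integral_dominated_convergence[where w = "\<lambda>_. (2 * B + 1)\<^sup>2"])
    show "(\<lambda>\<xi>. (cmod (of_real (s \<xi>) - p n \<xi>))\<^sup>2) \<in> borel_measurable cell" for n
      using sm measurable_cell_continuous[OF continuous_trig[OF p(1)]] by measurable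
    show "integrable cell (\<lambda>_. (2 * B + 1)\<^sup>2)"
      by (rule integrable_cell_bounded[where B = "(2 * B + 1)\<^sup>2"]) auto
    show "AE \<xi> in cell. (\<lambda>n. (cmod (of_real (s \<xi>) - p n \<xi>))\<^sup>2) \<longlonglongrightarrow> 0"
      unfolding AE_cell_iff using p(3)
    proof eventually_elim
      case (elim \<xi>)
      show ?case
      proof
        assume "\<xi> \<in> Upsilon"
        with elim have "(\<lambda>n. (cmod (of_real (s \<xi>) - p n \<xi>))\<^sup>2) \<longlonglongrightarrow> (cmod (of_real (s \<xi>) - of_real (s \<xi>)))\<^sup>2"
          by (intro tendsto_intros) auto
        then show "(\<lambda>n. (cmod (of_real (s \<xi>) - p n \<xi>))\<^sup>2) \<longlonglongrightarrow> 0" by simp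
      qed
    qed
    show "AE \<xi> in cell. norm ((cmod (of_real (s \<xi>) - p n \<xi>))\<^sup>2) \<le> (2 * B + 1)\<^sup>2" for n
    proof (rule AE_I2)
      fix \<xi> assume "\<xi> \<in> space cell"
      then have "cmod (of_real (s \<xi>) - p n \<xi>) \<le> 2 * B + 1"
        using norm_triangle_ineq4[of "complex_of_real (s \<xi>)" "p n \<xi>"] s(2)[of \<xi>] p(2)[of \<xi> n] by simp
      then show "norm ((cmod (of_real (s \<xi>) - p n \<xi>))\<^sup>2) \<le> (2 * B + 1)\<^sup>2"
        by (simp add: power_mono)
    qed
  qed auto
  then have "\<forall>\<^sub>F n in sequentially. (LINT \<xi>|cell. (cmod (of_real (s \<xi>) - p n \<xi>))\<^sup>2) < e"
    using e by (intro order_tendstoD(2)[of _ 0]) auto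
  then obtain n where "(LINT \<xi>|cell. (cmod (of_real (s \<xi>) - p n \<xi>))\<^sup>2) < e"
    by (auto simp: eventually_sequentially)
  then show ?thesis using p(1) by blast
qed

text \<open>Only an inequality for the convolution is needed: a trigonometric polynomial close to \<open>s\<close>
  in \<open>L\<^sup>2\<close> may be replaced by the partial Fourier sum over its frequencies, which is even closer.\<close>

lemma coef_mult_le:
  fixes s :: "point \<Rightarrow> real"
  assumes s: "s \<in> borel_measurable lebesgue" "\<And>\<xi>. \<bar>s \<xi>\<bar> \<le> B" and h: "L2 h"
  shows "ennreal (cmod (LINT \<xi>|cell. of_real (s \<xi>) * h \<xi>)) \<le>
    ennreal (1 / vol) * esum (\<lambda>k. ennreal (cmod (coef (\<lambda>\<xi>. of_real (s \<xi>)) k)) * ennreal (cmod (LINT \<xi>|cell. h \<xi> * expo k \<xi>)))"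
    (is "_ \<le> ennreal (1 / vol) * esum ?t")
proof (rule ennreal_le_epsilon)
  fix e :: real assume e: "0 < e"
  let ?s = "\<lambda>\<xi>. complex_of_real (s \<xi>)"
  define H where "H = (LINT \<xi>|cell. (cmod (h \<xi>))\<^sup>2)"
  have H: "0 \<le> H" by (simp add: H_def)
  \<comment> \<open>Chosen so that the final estimate d H + d^2 / d = d (H + 1) equals e; the 1
    avoids division by zero when h vanishes.\<close>
  define d where "d = e / (H + 1)"
  have d: "0 < d" using e H by (simp add: d_def)
  have sm: "?s \<in> borel_measurable cell" using measurable_restrict_space1[OF s(1), of Upsilon] by simp
  have s2: "L2 ?s" by (rule L2_bounded[OF sm]) (use s(2) in simp)
  obtain p where p: "trig p" "(LINT \<xi>|cell. (cmod (?s \<xi> - p \<xi>))\<^sup>2) < d\<^sup>2"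
    using L2_trig_dense_bounded[OF s, of "d\<^sup>2"] d by auto
  obtain F c where F: "finite F" "p = (\<lambda>\<xi>. \<Sum>k\<in>F. c k * expo k \<xi>)" using trig_finite_sum[OF p(1)] by blast
  let ?S = "\<lambda>\<xi>. \<Sum>k\<in>F. (coef ?s k / vol) * expo k \<xi>"
  have S2: "L2 ?S" by (rule L2_trig[OF trig_sum_expo])
  have diff2: "L2 (\<lambda>\<xi>. ?s \<xi> - ?S \<xi>)" by (rule L2_diff[OF s2 S2])
  \<comment> \<open>Among all sums over \<open>F\<close> the partial Fourier sum is closest in the
    mean, in particular closer than p.\<close>
  have "(LINT \<xi>|cell. (cmod (?s \<xi> - ?S \<xi>))\<^sup>2) \<le> (LINT \<xi>|cell. (cmod (?s \<xi> - p \<xi>))\<^sup>2)"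
    unfolding F(2) L2_dist_trig_sum[OF s2 F(1)] using vol_pos by (simp add: sum_nonneg)
  then have close: "(LINT \<xi>|cell. (cmod (?s \<xi> - ?S \<xi>))\<^sup>2) \<le> d\<^sup>2" using p(2) by simp
  have small: "cmod (LINT \<xi>|cell. (?s \<xi> - ?S \<xi>) * h \<xi>) \<le> e"
  proof -
    have "cmod (LINT \<xi>|cell. (?s \<xi> - ?S \<xi>) * h \<xi>) \<le> (LINT \<xi>|cell. cmod ((?s \<xi> - ?S \<xi>) * h \<xi>))"
      by (rule integral_norm_bound)
    \<comment> \<open>The weighted inequality xy \<le> d y^2 + x^2 / d takes the place of
      Cauchy-Schwarz for integrals.\<close>
    also have "\<dots> \<le> (LINT \<xi>|cell. d * (cmod (h \<xi>))\<^sup>2 + (cmod (?s \<xi> - ?S \<xi>))\<^sup>2 / d)"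
    proof (rule integral_mono)
      show "integrable cell (\<lambda>\<xi>. cmod ((?s \<xi> - ?S \<xi>) * h \<xi>))"
        using L2_integrable_mult[OF diff2 h] by simp
      show "integrable cell (\<lambda>\<xi>. d * (cmod (h \<xi>))\<^sup>2 + (cmod (?s \<xi> - ?S \<xi>))\<^sup>2 / d)"
        using h diff2 by (auto simp: L2_def)
      fix \<xi>
      have "x * y \<le> d * y\<^sup>2 + x\<^sup>2 / d" if "0 \<le> x" "0 \<le> y" for x y :: real
      proof -
        have "0 \<le> x * (d * y)" using that d by simp
        then have "x * (d * y) \<le> (d * y)\<^sup>2 + x\<^sup>2" using two_mult_le_squares[of x "d * y"] by linarith
        then show ?thesis using d by (simp add: field_simps power2_eq_square)
      qed
      then show "cmod ((?s \<xi> - ?S \<xi>) * h \<xi>) \<le> d * (cmod (h \<xi>))\<^sup>2 + (cmod (?s \<xi> - ?S \<xi>))\<^sup>2 / d"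
        by (simp only: norm_mult norm_ge_zero)
    qed
    also have "\<dots> = d * H + (LINT \<xi>|cell. (cmod (?s \<xi> - ?S \<xi>))\<^sup>2) / d"
      using h diff2 by (simp add: L2_def H_def)
    also have "\<dots> \<le> d * H + d\<^sup>2 / d" using close d by (intro add_left_mono divide_right_mono) auto
    also have "\<dots> = d * (H + 1)" using d by (simp add: power2_eq_square algebra_simps)
    also have "\<dots> = e" using H by (simp add: d_def)
    finally show ?thesis .
  qed
  have "(LINT \<xi>|cell. ?s \<xi> * h \<xi>) = (LINT \<xi>|cell. ?S \<xi> * h \<xi>) + (LINT \<xi>|cell. (?s \<xi> - ?S \<xi>) * h \<xi>)"
    by (subst Bochner_Integration.integral_add[symmetric, OF L2_integrable_mult[OF S2 h] L2_integrable_mult[OF diff2 h]])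
      (simp add: algebra_simps)
  also have "(LINT \<xi>|cell. ?S \<xi> * h \<xi>) = (\<Sum>k\<in>F. (coef ?s k / vol) * (LINT \<xi>|cell. h \<xi> * expo k \<xi>))"
    by (rule integral_mult_sum_expo[OF h])
  finally have split: "(LINT \<xi>|cell. ?s \<xi> * h \<xi>) = (\<Sum>k\<in>F. (coef ?s k / vol) * (LINT \<xi>|cell. h \<xi> * expo k \<xi>))
      + (LINT \<xi>|cell. (?s \<xi> - ?S \<xi>) * h \<xi>)" .
  have "cmod (LINT \<xi>|cell. ?s \<xi> * h \<xi>)
      \<le> cmod (\<Sum>k\<in>F. (coef ?s k / vol) * (LINT \<xi>|cell. h \<xi> * expo k \<xi>)) + e"
    unfolding split by (rule order_trans[OF norm_triangle_ineq add_left_mono[OF small]])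
  also have "\<dots> \<le> (\<Sum>k\<in>F. cmod ((coef ?s k / vol) * (LINT \<xi>|cell. h \<xi> * expo k \<xi>))) + e"
    by (intro add_right_mono norm_sum)
  also have "\<dots> = 1 / vol * (\<Sum>k\<in>F. cmod (coef ?s k) * cmod (LINT \<xi>|cell. h \<xi> * expo k \<xi>)) + e"
    using vol_pos by (simp add: norm_mult norm_divide sum_divide_distrib)
  finally have "ennreal (cmod (LINT \<xi>|cell. ?s \<xi> * h \<xi>))
      \<le> ennreal (1 / vol * (\<Sum>k\<in>F. cmod (coef ?s k) * cmod (LINT \<xi>|cell. h \<xi> * expo k \<xi>)) + e)"
    by (rule ennreal_leI)
  also have "\<dots> = ennreal (1 / vol) * (\<Sum>k\<in>F. ?t k) + ennreal e"
  proof -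
    have "(\<Sum>k\<in>F. ?t k) = ennreal (\<Sum>k\<in>F. cmod (coef ?s k) * cmod (LINT \<xi>|cell. h \<xi> * expo k \<xi>))"
      by (simp add: ennreal_mult[symmetric] sum_ennreal)
    then show ?thesis
      using vol_pos e ennreal_mult[of "1 / vol" "\<Sum>k\<in>F. cmod (coef ?s k) * cmod (LINT \<xi>|cell. h \<xi> * expo k \<xi>)"]
      by (subst ennreal_plus) (simp_all add: sum_nonneg)
  qed
  also have "\<dots> \<le> ennreal (1 / vol) * esum ?t + ennreal e"
    by (intro add_right_mono mult_left_mono sum_le_esum F(1)) simp
  finally show "ennreal (cmod (LINT \<xi>|cell. ?s \<xi> * h \<xi>)) \<le> ennreal (1 / vol) * esum ?t + ennreal e" .
qed

section \<open>The angular density\<close>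

declare Upsilon_sets(3) [measurable]

lemma AE_lborel_fst:
  assumes "AE x in (lborel :: (real^2) measure). P x"
  shows "AE \<xi> in (lborel :: point measure). P (fst \<xi>)"
proof -
  obtain N where N: "{x \<in> space lborel. \<not> P x} \<subseteq> N" "emeasure lborel N = 0" "N \<in> sets lborel"
    using assms by (rule AE_E)
  have "emeasure (lborel \<Otimes>\<^sub>M lborel) (N \<times> (UNIV :: real set)) = 0"
    using N(2,3) by (subst lborel.emeasure_pair_measure_Times) auto
  moreover have "N \<times> (UNIV :: real set) \<in> sets (lborel \<Otimes>\<^sub>M lborel)" using N(3) by (intro pair_measureI) auto
  ultimately have "N \<times> UNIV \<in> null_sets (lborel :: point measure)"
    unfolding lborel_prod null_sets_def by auto
  then show ?thesis by (rule AE_I') (use N(1) in auto)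
qed

lemma integral_cell_lborel:
  fixes u :: "point \<Rightarrow> 'b::{banach, second_countable_topology}"
  assumes "u \<in> borel_measurable borel"
  shows "(LINT \<xi>|cell. u \<xi>) = (LINT \<xi>|lborel. indicator Upsilon \<xi> *\<^sub>R u \<xi>)"
    and "integrable cell u \<longleftrightarrow> integrable lborel (\<lambda>\<xi>. indicator Upsilon \<xi> *\<^sub>R u \<xi>)"
proof -
  have m: "(\<lambda>\<xi>. indicator Upsilon \<xi> *\<^sub>R u \<xi>) \<in> borel_measurable lborel"
    using assms by simp
  show "(LINT \<xi>|cell. u \<xi>) = (LINT \<xi>|lborel. indicator Upsilon \<xi> *\<^sub>R u \<xi>)"
    by (subst integral_restrict_space) (auto simp: set_lebesgue_integral_def integral_completion[OF m])
  show "integrable cell u \<longleftrightarrow> integrable lborel (\<lambda>\<xi>. indicator Upsilon \<xi> *\<^sub>R u \<xi>)"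
    by (subst integrable_restrict_space) (auto simp: integrable_completion[OF m])
qed

lemma indicator_Upsilon: "indicator Upsilon (x, t) = (indicator Omega x * indicator {0<..<2 * pi} t :: real)"
  by (auto simp: indicator_def Upsilon_def)

lemma Omega_sets [measurable]: "Omega \<in> sets borel"
proof -
  have *: "Omega = box 0 (\<chi> i. 2 * pi)" by (auto simp: Omega_def mem_box_cart)
  show ?thesis unfolding * by (rule borel_open[OF open_box])
qed

lemma integral_cell_product:
  fixes A :: "real^2 \<Rightarrow> complex" and B :: "real \<Rightarrow> complex"
  assumes [measurable]: "A \<in> borel_measurable borel" "B \<in> borel_measurable borel"
    and int: "integrable cell (\<lambda>\<xi>. A (fst \<xi>) * B (snd \<xi>))"
  shows "(LINT \<xi>|cell. A (fst \<xi>) * B (snd \<xi>)) =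
    (LINT x|lborel. indicator Omega x *\<^sub>R A x) * (LINT t|lborel. indicator {0<..<2 * pi} t *\<^sub>R B t)"
proof -
  let ?u = "\<lambda>\<xi>. A (fst \<xi>) * B (snd \<xi>)"
  have m: "?u \<in> borel_measurable borel" by (simp add: borel_prod[symmetric])
  have int': "integrable (lborel \<Otimes>\<^sub>M lborel) (\<lambda>\<xi>. indicator Upsilon \<xi> *\<^sub>R ?u \<xi>)"
    using int unfolding integral_cell_lborel(2)[OF m] lborel_prod .
  have "(LINT \<xi>|cell. ?u \<xi>) = (LINT x|lborel. LINT t|lborel. indicator Upsilon (x, t) *\<^sub>R (A x * B t))"
    unfolding integral_cell_lborel(1)[OF m] using lborel_pair.integral_fst'[OF int'] by (simp add: lborel_prod)
  also have "\<dots> = (LINT x|lborel. (indicator Omega x *\<^sub>R A x) * (LINT t|lborel. indicator {0<..<2 * pi} t *\<^sub>R B t))"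
    by (simp add: indicator_Upsilon scaleR_conv_of_real mult_ac flip: integral_mult_right_zero)
  also have "\<dots> = (LINT x|lborel. indicator Omega x *\<^sub>R A x) * (LINT t|lborel. indicator {0<..<2 * pi} t *\<^sub>R B t)"
    by (rule integral_mult_left_zero)
  finally show ?thesis .
qed

lemma expo_Pair: "expo (k, m) (x, t) = expo (k, 0) (x, 0) * cis (of_int m * t)"
  by (simp add: expo_def inner_freq cis_mult)

lemma borel_measurable_expo_fst: "(\<lambda>x. expo k (x, 0)) \<in> borel_measurable borel"
  by (rule borel_measurable_continuous_onI, unfold expo_def) (intro continuous_intros)

text \<open>For nonzero m this follows from orthogonality on the cell: the integral of an
  exponential in theta factorises, and the factor over \<open>Omega\<close> is nonzero because the
  case m = 0 gives \<open>vol\<close>.\<close>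

lemma integral_cnj_cis:
  "(LINT t|lborel. indicator {0<..<2 * pi} t *\<^sub>R cnj (cis (of_int m * t))) = (if m = 0 then of_real (2 * pi) else 0)"
proof -
  have B: "(\<lambda>t. cnj (cis (of_int m * t))) \<in> borel_measurable borel" for m
    by (intro borel_measurable_continuous_onI continuous_intros)
  have int: "integrable cell (\<lambda>\<xi>. (1 :: complex) * cnj (cis (of_int m * snd \<xi>)))" for m
  proof -
    have "L2 (\<lambda>\<xi>. cnj (expo (0, m) \<xi>))" by (rule L2_cnj[OF L2_expo])
    from L2_integrable_mult[OF L2_expo[of 0] this] show ?thesis by (simp add: expo_def inner_freq)
  qed
  have zero: "(LINT t|lborel. indicator {0<..<2 * pi} t *\<^sub>R cnj (cis (of_int 0 * t))) = of_real (2 * pi)"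
    by (simp add: scaleR_conv_of_real)
  have eq: "(if m = 0 then of_real vol else 0) = (LINT x|lborel. indicator Omega x *\<^sub>R (1 :: complex)) *
      (LINT t|lborel. indicator {0<..<2 * pi} t *\<^sub>R cnj (cis (of_int m * t)))" for m
    using integral_cell_product[OF _ B int, of m] integral_expo_cnj[of 0 "(0, m)"]
    by (auto simp: expo_def inner_freq zero_prod_def)
  show ?thesis
  proof (cases "m = 0")
    case True
    then show ?thesis using zero by simp
  next
    case False
    have "(LINT x|lborel. indicator Omega x *\<^sub>R (1 :: complex)) \<noteq> 0" using eq[of 0] vol_pos by auto
    then show ?thesis using eq[of m] False by simp
  qed
qed

text \<open>Replaces the slice integrals by a function on the whole space that is measurable and
  bounded everywhere. Its coefficients with m \<noteq> 0 vanish since it depends on x only; for m =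
  0 Fubini gives those of f, and 2 pi is the length of the theta interval.\<close>

lemma angular_density_version:
  fixes f :: "point \<Rightarrow> real"
  assumes f: "integrable cell f" and range: "AE x in lebesgue. angular_density f x \<in> {0..1}"
  shows "\<exists>s. s \<in> borel_measurable lebesgue \<and> (\<forall>\<xi>. \<bar>s \<xi>\<bar> \<le> 1) \<and>
    (AE \<xi> in lebesgue. \<xi> \<in> Upsilon \<longrightarrow> s \<xi> = angular_density f (fst \<xi>)) \<and>
    (\<forall>k m. coef (\<lambda>\<xi>. of_real (s \<xi>)) (k, m) = (if m = 0 then 2 * pi * coef (\<lambda>\<xi>. of_real (f \<xi>)) (k, 0) else 0))"
proof -
  define g where "g \<xi> = indicator Upsilon \<xi> * f \<xi>" for \<xi>
  have g: "integrable lebesgue g"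
    using f by (simp add: g_def[abs_def] integrable_restrict_space)
  \<comment> \<open>f is only Lebesgue measurable, whereas iterated integration over the product
    measure calls for a Borel version.\<close>
  then obtain g' where g': "g' \<in> borel_measurable lborel" "AE \<xi> in lborel. g \<xi> = g' \<xi>"
    using completion_ex_borel_measurable_real[of g lborel] by auto
  define F where "F \<xi> = indicator Upsilon \<xi> * g' \<xi>" for \<xi>
  have Fm[measurable]: "F \<in> borel_measurable borel" using g'(1) by (simp add: F_def[abs_def])
  have gF: "AE \<xi> in lborel. g \<xi> = F \<xi>" using g'(2) by eventually_elim (auto simp: g_def F_def indicator_def)
  have gF': "AE \<xi> in lebesgue. g \<xi> = F \<xi>" using gF by (rule AE_completion)
  have Fi: "integrable lborel F"
  proof -
    have "integrable lebesgue F"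
      by (rule integrable_cong_AE_imp[OF g _ gF']) (simp add: measurable_completion)
    then show ?thesis by (subst (asm) integrable_completion) auto
  qed
  have Fi': "integrable (lborel \<Otimes>\<^sub>M lborel) F" using Fi by (simp add: lborel_prod)
  define R where "R x = (LINT t|lborel. F (x, t))" for x
  have Rm[measurable]: "R \<in> borel_measurable borel"
  proof -
    have "(\<lambda>x. LINT t|lborel. F (x, t)) \<in> borel_measurable lborel"
      by (rule lborel.borel_measurable_lebesgue_integral) (simp add: lborel_prod case_prod_eta)
    then show ?thesis by (simp add: R_def[abs_def])
  qed
  have R_Omega: "indicator Omega x * R x = R x" for x
  proof (cases "x \<in> Omega")
    case False
    then have "F (x, t) = 0" for t by (simp add: F_def Upsilon_def)
    then show ?thesis by (simp add: R_def)
  qed simp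
  have "AE x in lborel. AE t in lborel. g (x, t) = F (x, t)"
    by (rule lborel_pair.AE_pair, subst lborel_prod) (rule gF)
  then have R_AE: "AE x in lborel. x \<in> Omega \<longrightarrow> angular_density f x = R x"
  proof eventually_elim
    case (elim x)
    show ?case
    proof
      assume x: "x \<in> Omega"
      have Fx: "(\<lambda>t. F (x, t)) \<in> borel_measurable borel" by simp
      have Fx': "(\<lambda>t. F (x, t)) \<in> borel_measurable lebesgue" using Fx by (simp add: measurable_completion)
      have ae: "AE t in lebesgue. F (x, t) = g (x, t)" using AE_completion[OF elim] by eventually_elim simp
      have gx: "(\<lambda>t. g (x, t)) \<in> borel_measurable lebesgue"
        by (rule borel_measurable_AE[OF Fx' ae])
      have "angular_density f x = (LINT t|lebesgue. g (x, t))"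
        unfolding angular_density_def set_lebesgue_integral_def g_def
        using x by (intro Bochner_Integration.integral_cong) (auto simp: indicator_Upsilon)
      also have "\<dots> = (LINT t|lebesgue. F (x, t))"
        by (rule integral_cong_AE[OF gx Fx']) (use ae in \<open>auto elim: eventually_mono\<close>)
      also have "\<dots> = R x" unfolding R_def using Fx by (intro integral_completion) simp
      finally show "angular_density f x = R x" .
    qed
  qed
  \<comment> \<open>Clamping gives the bound at every point; by the range hypothesis it changes
    nothing almost everywhere on the cell.\<close>
  define s where "s \<xi> = max 0 (min 1 (R (fst \<xi>)))" for \<xi> :: point
  have sb: "s \<in> borel_measurable borel"
    unfolding s_def[abs_def] by (simp add: borel_prod[symmetric])
  have sm: "s \<in> borel_measurable lebesgue" using sb by (simp add: measurable_completion)
  have s1: "\<bar>s \<xi>\<bar> \<le> 1" for \<xi> by (simp add: s_def)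
  have "AE x in lborel. x \<in> Omega \<longrightarrow> angular_density f x = R x \<and> R x \<in> {0..1}"
    using R_AE range[unfolded AE_completion_iff] by eventually_elim auto
  then have sR: "AE \<xi> in lebesgue. \<xi> \<in> Upsilon \<longrightarrow> angular_density f (fst \<xi>) = R (fst \<xi>) \<and> s \<xi> = R (fst \<xi>)"
    by (intro AE_completion, drule_tac AE_lborel_fst) (auto elim!: eventually_mono simp: Upsilon_def s_def)
  have coef_s: "coef (\<lambda>\<xi>. of_real (s \<xi>)) (k, m) = (if m = 0 then 2 * pi * coef (\<lambda>\<xi>. of_real (f \<xi>)) (k, 0) else 0)" for k m
  proof -
    let ?E = "\<lambda>x. cnj (expo (k, 0) (x, 0))"
    let ?A = "\<lambda>x. of_real (R x) * ?E x"
    let ?B = "\<lambda>t. cnj (cis (of_int m * t))"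
    have E[measurable]: "?E \<in> borel_measurable borel"
      using measurable_compose[OF borel_measurable_expo_fst borel_measurable_continuous_onI[OF linear_continuous_on[OF bounded_linear_cnj]]] .
    have A[measurable]: "?A \<in> borel_measurable borel" by simp
    have B[measurable]: "?B \<in> borel_measurable borel"
      by (intro borel_measurable_continuous_onI continuous_intros)
    have uAB: "(\<lambda>\<xi>. ?A (fst \<xi>) * ?B (snd \<xi>)) \<in> borel_measurable (borel :: point measure)"
      by (simp add: borel_prod[symmetric])
    have AE_eq: "AE \<xi> in cell. of_real (s \<xi>) * cnj (expo (k, m) \<xi>) = ?A (fst \<xi>) * ?B (snd \<xi>)"
      unfolding AE_cell_iff using sR
    proof eventually_elim
      case (elim \<xi>)
      then show ?case using expo_Pair[of k m "fst \<xi>" "snd \<xi>"] by (simp add: mult.assoc)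
    qed
    have sL2: "L2 (\<lambda>\<xi>. of_real (s \<xi>))"
      by (rule L2_bounded[where B = 1]) (use measurable_restrict_space1[OF sm, of Upsilon] s1 in auto)
    have int_s: "integrable cell (\<lambda>\<xi>. of_real (s \<xi>) * cnj (expo (k, m) \<xi>))"
      by (rule L2_integrable_mult[OF sL2 L2_cnj[OF L2_expo]])
    have mAB: "(\<lambda>\<xi>. ?A (fst \<xi>) * ?B (snd \<xi>)) \<in> borel_measurable cell"
      using uAB by (intro measurable_restrict_space1) (simp add: measurable_completion)
    have int_AB: "integrable cell (\<lambda>\<xi>. ?A (fst \<xi>) * ?B (snd \<xi>))"
      by (rule integrable_cong_AE_imp[OF int_s mAB AE_eq])
    have "coef (\<lambda>\<xi>. of_real (s \<xi>)) (k, m) = (LINT \<xi>|cell. ?A (fst \<xi>) * ?B (snd \<xi>))"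
      unfolding coef_def by (rule integral_cong_AE[OF borel_measurable_integrable[OF int_s] mAB AE_eq])
    also have "\<dots> = (LINT x|lborel. indicator Omega x *\<^sub>R ?A x) * (if m = 0 then of_real (2 * pi) else 0)"
      by (subst integral_cell_product[OF A B int_AB]) (simp only: integral_cnj_cis)
    also have "(LINT x|lborel. indicator Omega x *\<^sub>R ?A x) = (LINT x|lborel. ?A x)"
    proof (rule Bochner_Integration.integral_cong[OF refl])
      fix x
      have "indicator Omega x *\<^sub>R ?A x = of_real (indicator Omega x * R x) * ?E x"
        by (simp add: scaleR_conv_of_real mult.assoc)
      then show "indicator Omega x *\<^sub>R ?A x = ?A x" by (simp only: R_Omega)
    qed
    also have "(LINT x|lborel. ?A x) = coef (\<lambda>\<xi>. of_real (f \<xi>)) (k, 0)"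
    proof -
      let ?u = "\<lambda>\<xi>. of_real (F \<xi>) * ?E (fst \<xi>)"
      have "(\<lambda>\<xi>. ?E (fst \<xi>)) \<in> borel_measurable (borel :: point measure)" by (simp add: borel_prod[symmetric])
      then have um: "?u \<in> borel_measurable borel" by simp
      have ui: "integrable (lborel \<Otimes>\<^sub>M lborel) ?u"
        by (rule Bochner_Integration.integrable_bound[OF Fi'])
          (use um in \<open>auto simp: lborel_prod norm_mult\<close>)
      have fE: "integrable cell (\<lambda>\<xi>. of_real (f \<xi>) * cnj (expo (k, 0) \<xi>))"
      proof -
        have "integrable cell (\<lambda>\<xi>. complex_of_real (f \<xi>))" using f by simp
        from integrable_mult_expo[OF this, of "- (k, 0)"] show ?thesis by (simp only: expo_minus)
      qed
      have umc: "?u \<in> borel_measurable cell"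
        using um by (intro measurable_restrict_space1) (simp add: measurable_completion)
      have "coef (\<lambda>\<xi>. of_real (f \<xi>)) (k, 0) = (LINT \<xi>|cell. ?u \<xi>)"
        unfolding coef_def
      proof (rule integral_cong_AE[OF borel_measurable_integrable[OF fE] umc])
        show "AE \<xi> in cell. of_real (f \<xi>) * cnj (expo (k, 0) \<xi>) = ?u \<xi>"
          unfolding AE_cell_iff using gF'
        proof eventually_elim
          case (elim \<xi>)
          then show ?case using expo_Pair[of k 0 "fst \<xi>" "snd \<xi>"] by (auto simp: g_def)
        qed
      qed
      also have "\<dots> = (LINT \<xi>|lborel. ?u \<xi>)"
        unfolding integral_cell_lborel(1)[OF um]
        by (rule Bochner_Integration.integral_cong) (auto simp: F_def indicator_def)
      also have "\<dots> = (LINT x|lborel. LINT t|lborel. ?u (x, t))"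
        using lborel_pair.integral_fst'[OF ui] by (simp add: lborel_prod)
      also have "\<dots> = (LINT x|lborel. ?A x)" by (simp add: R_def)
      finally show ?thesis ..
    qed
    finally show ?thesis by simp
  qed
  have "AE \<xi> in lebesgue. \<xi> \<in> Upsilon \<longrightarrow> s \<xi> = angular_density f (fst \<xi>)"
    using sR by eventually_elim simp
  then show ?thesis using sm s1 coef_s by blast
qed

section \<open>The equation in Fourier space\<close>

lemma wave_add_pi: "wave k (c + pi) \<xi> = - wave k c \<xi>"
  by (simp add: wave_def add.assoc[symmetric])

lemma integrable_cell_complex: "integrable cell h \<Longrightarrow> integrable cell (\<lambda>\<xi>. complex_of_real (h \<xi>))"
  by simp

lemma coef_of_real:
  assumes "integrable cell h"
  shows "coef (\<lambda>\<xi>. of_real (h \<xi>)) k = Complex (LINT \<xi>|cell. h \<xi> * wave k 0 \<xi>) (LINT \<xi>|cell. h \<xi> * wave k (pi / 2) \<xi>)"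
proof -
  have "wave k (- pi / 2) \<xi> = - wave k (pi / 2) \<xi>" for \<xi>
    using wave_add_pi[of k "- pi / 2" \<xi>] by simp
  then have eq: "(LINT \<xi>|cell. h \<xi> * wave k (- pi / 2) \<xi>) = - (LINT \<xi>|cell. h \<xi> * wave k (pi / 2) \<xi>)" by simp
  have "coef (\<lambda>\<xi>. of_real (h \<xi>)) k = cnj (LINT \<xi>|cell. of_real (h \<xi>) * expo k \<xi>)"
    using coef_cnj[of "\<lambda>\<xi>. of_real (h \<xi>)" k] by simp
  then show ?thesis unfolding integral_expo_eq_waves[OF assms] eq by (simp add: complex_eq_iff)
qed

lemma L2_H1_per: "f \<in> H1_per \<Longrightarrow> L2 (\<lambda>\<xi>. of_real (f \<xi>))"
  by (simp add: L2_of_real H1_per_def)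

lemma L2_weak_partial: "f \<in> H1_per \<Longrightarrow> b \<in> Basis \<Longrightarrow> L2 (\<lambda>\<xi>. of_real (weak_partial b f \<xi>))"
  by (simp add: L2_of_real H1_per_def)

lemma L2_of_real_integrable:
  assumes "L2 (\<lambda>\<xi>. of_real (h \<xi>))"
  shows "integrable cell h"
  by (rule square_integrable_imp_integrable) (use assms in \<open>simp_all add: L2_of_real square_integrable_on_cell_iff\<close>)

text \<open>The derivative exchanges cosine and sine coefficients up to sign and multiplies both by
  \<open>b \<bullet> freq k\<close>; the modulus sees only this factor.\<close>

lemma cmod_coef_weak_partial:
  assumes f: "f \<in> H1_per" and b: "b \<in> Basis"
  shows "(cmod (coef (\<lambda>\<xi>. of_real (weak_partial b f \<xi>)) k))\<^sup>2 = (b \<bullet> freq k)\<^sup>2 * (cmod (coef (\<lambda>\<xi>. of_real (f \<xi>)) k))\<^sup>2"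
proof -
  have "wave k (0 + pi / 2) = wave k (pi / 2)" "wave k (pi / 2 + pi / 2) = (\<lambda>\<xi>. - wave k 0 \<xi>)"
    using wave_add_pi[of k 0] by (auto simp: fun_eq_iff)
  then show ?thesis
    unfolding coef_of_real[OF L2_of_real_integrable[OF L2_weak_partial[OF f b]]]
      coef_of_real[OF L2_of_real_integrable[OF L2_H1_per[OF f]]] integral_weak_partial_wave[OF f b]
    by (simp add: cmod_power2 power_mult_distrib algebra_simps)
qed

lemma inner_Basis_freq:
  "(axis 1 1, 0) \<bullet> freq k = of_int (fst (fst k))" "(axis 2 1, 0) \<bullet> freq k = of_int (snd (fst k))"
  "(0, 1) \<bullet> freq k = of_int (snd k)"
  by (simp_all add: freq_def inner_axis')

text \<open>Cauchy-Schwarz for four summands: the difference of the two sides is the sum of the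
  squares of the six pairwise differences.\<close>

lemma wt_square_le: "(wt k n)\<^sup>2 \<le> 4 * (1 + (of_int (fst k))\<^sup>2 + (of_int (snd k))\<^sup>2 + (of_int n)\<^sup>2)"
proof -
  have "(1 + a + b + c)\<^sup>2 \<le> 4 * (1 + a\<^sup>2 + b\<^sup>2 + c\<^sup>2)" for a b c :: real
  proof -
    have "0 \<le> (1 - a)\<^sup>2 + (1 - b)\<^sup>2 + (1 - c)\<^sup>2 + (a - b)\<^sup>2 + (a - c)\<^sup>2 + (b - c)\<^sup>2" by simp
    also have "\<dots> = 4 * (1 + a\<^sup>2 + b\<^sup>2 + c\<^sup>2) - (1 + a + b + c)\<^sup>2" by (simp add: power2_eq_square algebra_simps)
    finally show ?thesis by simp
  qed
  from this[of "\<bar>of_int (fst k)\<bar>" "\<bar>of_int (snd k)\<bar>" "\<bar>of_int n\<bar>"] show ?thesis by (simp add: wt_def)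
qed

text \<open>Bessel's inequality for f and its three weak derivatives: membership in
  \<open>H1_per\<close> is one power of the weight in l^2.\<close>

lemma energy_finite:
  assumes f: "f \<in> H1_per"
  defines "u \<equiv> \<lambda>k n. ennreal (cmod (coef (\<lambda>\<xi>. of_real (f \<xi>)) (k, n)))"
  shows "esum (\<lambda>n. esum (\<lambda>k. (ennreal (wt k n) * u k n)\<^sup>2)) < \<infinity>"
proof -
  let ?a = "\<lambda>k. (cmod (coef (\<lambda>\<xi>. of_real (f \<xi>)) k))\<^sup>2"
  let ?b = "\<lambda>b k. (cmod (coef (\<lambda>\<xi>. of_real (weak_partial b f \<xi>)) k))\<^sup>2"
  let ?b1 = "?b (axis 1 1, 0)" and ?b2 = "?b (axis 2 1, 0)" and ?b3 = "?b (0, 1)"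
  have B: "(axis 1 1, 0) \<in> (Basis :: point set)" "(axis 2 1, 0) \<in> (Basis :: point set)" "(0, 1) \<in> (Basis :: point set)"
    by (auto simp: Basis_point)
  have le: "(ennreal (wt k n) * u k n)\<^sup>2
      \<le> 4 * (ennreal (?a (k, n)) + ennreal (?b1 (k, n)) + ennreal (?b2 (k, n)) + ennreal (?b3 (k, n)))" for k n
  proof -
    have "(wt k n)\<^sup>2 * ?a (k, n)
        \<le> 4 * (1 + (of_int (fst k))\<^sup>2 + (of_int (snd k))\<^sup>2 + (of_int n)\<^sup>2) * ?a (k, n)"
      by (intro mult_right_mono wt_square_le) simp
    also have "\<dots> = 4 * (?a (k, n) + ?b1 (k, n) + ?b2 (k, n) + ?b3 (k, n))"
      unfolding cmod_coef_weak_partial[OF f B(1)] cmod_coef_weak_partial[OF f B(2)] cmod_coef_weak_partial[OF f B(3)]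
        inner_Basis_freq by (simp add: algebra_simps)
    finally have "ennreal ((wt k n)\<^sup>2 * ?a (k, n)) \<le> ennreal (4 * (?a (k, n) + ?b1 (k, n) + ?b2 (k, n) + ?b3 (k, n)))"
      by (rule ennreal_leI)
    then show ?thesis using wt_pos[of k n]
      by (simp add: u_def power_mult_distrib ennreal_power ennreal_mult ennreal_plus)
  qed
  have "esum (\<lambda>n. esum (\<lambda>k. (ennreal (wt k n) * u k n)\<^sup>2)) = esum (\<lambda>(k, n). (ennreal (wt k n) * u k n)\<^sup>2)"
    unfolding esum_prod by (rule esum_swap)
  also have "\<dots> \<le> esum (\<lambda>k. 4 * (ennreal (?a k) + ennreal (?b1 k) + ennreal (?b2 k) + ennreal (?b3 k)))"
  proof (rule nn_integral_mono)
    fix p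
    show "(case p of (k, n) \<Rightarrow> (ennreal (wt k n) * u k n)\<^sup>2)
        \<le> 4 * (ennreal (?a p) + ennreal (?b1 p) + ennreal (?b2 p) + ennreal (?b3 p))"
      using le[of "fst p" "snd p"] by (simp only: split_def prod.collapse)
  qed
  also have "\<dots> = 4 * (esum (\<lambda>k. ennreal (?a k)) + esum (\<lambda>k. ennreal (?b1 k)) + esum (\<lambda>k. ennreal (?b2 k)) + esum (\<lambda>k. ennreal (?b3 k)))"
    by (simp add: nn_integral_cmult nn_integral_add)
  also have "\<dots> < \<infinity>"
    using Bessel_esum[OF L2_H1_per[OF f]] Bessel_esum[OF L2_weak_partial[OF f B(1)]]
      Bessel_esum[OF L2_weak_partial[OF f B(2)]] Bessel_esum[OF L2_weak_partial[OF f B(3)]]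
    by (simp add: ennreal_mult_less_top)
  finally show ?thesis .
qed

lemma measurable_cell_AE:
  fixes u w :: "point \<Rightarrow> real"
  assumes "u \<in> borel_measurable cell" "AE \<xi> in cell. u \<xi> = w \<xi>"
  shows "w \<in> borel_measurable cell"
proof -
  have "(\<lambda>\<xi>. if \<xi> \<in> Upsilon then u \<xi> else 0) \<in> borel_measurable lebesgue"
    using assms(1) by (simp add: borel_measurable_if)
  then have "(\<lambda>\<xi>. if \<xi> \<in> Upsilon then w \<xi> else 0) \<in> borel_measurable lebesgue"
    by (rule borel_measurable_AE) (use assms(2) in \<open>auto simp: AE_cell_iff elim!: eventually_mono\<close>)
  then show ?thesis by (simp add: borel_measurable_if)
qed

text \<open>Meant for integrands containing \<open>angular_density\<close>, whose measurability is
  not known beforehand; completeness of Lebesgue measure supplies it.\<close>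

lemma integral_cell_cong_AE:
  fixes u w :: "point \<Rightarrow> real"
  assumes "integrable cell u" "AE \<xi> in cell. w \<xi> = u \<xi>"
  shows "(LINT \<xi>|cell. w \<xi>) = (LINT \<xi>|cell. u \<xi>)"
proof (rule integral_cong_AE[OF measurable_cell_AE borel_measurable_integrable[OF assms(1)] assms(2)])
  show "u \<in> borel_measurable cell" using assms(1) by auto
  show "AE \<xi> in cell. u \<xi> = w \<xi>" using assms(2) by eventually_elim simp
qed

lemma set_integral_cell: "(LINT \<xi>:Upsilon|lebesgue. u \<xi>) = (LINT \<xi>|cell. (u \<xi> :: real))"
  by (subst integral_restrict_space) (auto simp: set_lebesgue_integral_def)

text \<open>Test with the wave itself. One factor of the frequency comes from differentiating the
  wave, the other from integrating by parts against f, and together they form the symbol of the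
  diffusion.\<close>

lemma weak_solution_wave:
  assumes f: "f \<in> H1_per" and sol: "weak_solution Pe De f"
    and s: "s \<in> borel_measurable lebesgue" "\<And>\<xi>. \<bar>s \<xi>\<bar> \<le> 1"
    "AE \<xi> in lebesgue. \<xi> \<in> Upsilon \<longrightarrow> s \<xi> = angular_density f (fst \<xi>)"
  shows "(De * ((of_int (fst (fst k)))\<^sup>2 + (of_int (snd (fst k)))\<^sup>2) + (of_int (snd k))\<^sup>2) * (LINT \<xi>|cell. f \<xi> * wave k c \<xi>)
    = Pe * (LINT \<xi>|cell. (1 - s \<xi>) * f \<xi> * (of_int (fst (fst k)) * cos (snd \<xi>) + of_int (snd (fst k)) * sin (snd \<xi>)) * wave k (c + pi / 2) \<xi>)"
proof -
  let ?b1 = "(axis 1 1, 0) :: point" and ?b2 = "(axis 2 1, 0) :: point" and ?b3 = "(0, 1) :: point"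
  have B: "?b1 \<in> Basis" "?b2 \<in> Basis" "?b3 \<in> Basis" by (auto simp: Basis_point)
  let ?k1 = "real_of_int (fst (fst k))" and ?k2 = "real_of_int (snd (fst k))" and ?n = "real_of_int (snd k)"
  let ?\<phi> = "wave k c" and ?w = "wave k (c + pi / 2)"
  let ?I = "LINT \<xi>|cell. f \<xi> * wave k c \<xi>"
  have wp: "AE \<xi> in cell. weak_partial b ?\<phi> \<xi> = (b \<bullet> freq k) * ?w \<xi>" if "b \<in> Basis" for b
    unfolding AE_cell_iff using AE_weak_partial_wave[OF that, of k c] by eventually_elim simp
  have fint: "integrable cell f" by (rule L2_of_real_integrable[OF L2_H1_per[OF f]])
  have gint: "integrable cell (\<lambda>\<xi>. weak_partial b f \<xi> * ?w \<xi>)" if "b \<in> Basis" for b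
    by (rule integrable_mult_wave[OF L2_of_real_integrable[OF L2_weak_partial[OF f that]]])
  \<comment> \<open>Two phase shifts by pi / 2 reverse the sign of the wave, which cancels the minus
    of the integration by parts.\<close>
  have parts: "(LINT \<xi>|cell. weak_partial b f \<xi> * ?w \<xi>) = (b \<bullet> freq k) * ?I" if "b \<in> Basis" for b
  proof -
    have "wave k (c + pi / 2 + pi / 2) = (\<lambda>\<xi>. - wave k c \<xi>)"
      using wave_add_pi[of k c] by (auto simp: fun_eq_iff add.assoc)
    then show ?thesis unfolding integral_weak_partial_wave[OF f that] by simp
  qed
  have eqn: "Pe * (LINT \<xi>|cell. (1 - angular_density f (fst \<xi>)) * f \<xi> * (e_dir (snd \<xi>) \<bullet> grad_x ?\<phi> \<xi>)) =
     De * (LINT \<xi>|cell. grad_x f \<xi> \<bullet> grad_x ?\<phi> \<xi>) + (LINT \<xi>|cell. partial_theta f \<xi> * partial_theta ?\<phi> \<xi>)"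
    using sol wave_H1_per[of k c] unfolding weak_solution_def set_integral_cell by blast
  have "(LINT \<xi>|cell. partial_theta f \<xi> * partial_theta ?\<phi> \<xi>) = (LINT \<xi>|cell. ?n * (weak_partial ?b3 f \<xi> * ?w \<xi>))"
  proof (rule integral_cell_cong_AE)
    show "integrable cell (\<lambda>\<xi>. ?n * (weak_partial ?b3 f \<xi> * ?w \<xi>))" using gint[OF B(3)] by simp
    show "AE \<xi> in cell. partial_theta f \<xi> * partial_theta ?\<phi> \<xi> = ?n * (weak_partial ?b3 f \<xi> * ?w \<xi>)"
      using wp[OF B(3)] by eventually_elim (simp add: partial_theta_def inner_Basis_freq)
  qed
  then have I3: "(LINT \<xi>|cell. partial_theta f \<xi> * partial_theta ?\<phi> \<xi>) = ?n\<^sup>2 * ?I"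
    by (simp add: parts[OF B(3)] inner_Basis_freq power2_eq_square)
  have "(LINT \<xi>|cell. grad_x f \<xi> \<bullet> grad_x ?\<phi> \<xi>)
      = (LINT \<xi>|cell. ?k1 * (weak_partial ?b1 f \<xi> * ?w \<xi>) + ?k2 * (weak_partial ?b2 f \<xi> * ?w \<xi>))"
  proof (rule integral_cell_cong_AE)
    show "integrable cell (\<lambda>\<xi>. ?k1 * (weak_partial ?b1 f \<xi> * ?w \<xi>) + ?k2 * (weak_partial ?b2 f \<xi> * ?w \<xi>))"
      using gint[OF B(1)] gint[OF B(2)] by simp
    show "AE \<xi> in cell. grad_x f \<xi> \<bullet> grad_x ?\<phi> \<xi>
        = ?k1 * (weak_partial ?b1 f \<xi> * ?w \<xi>) + ?k2 * (weak_partial ?b2 f \<xi> * ?w \<xi>)"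
      using wp[OF B(1)] wp[OF B(2)]
      by eventually_elim (simp add: grad_x_def inner_vec_def sum_2 inner_Basis_freq)
  qed
  then have I2: "(LINT \<xi>|cell. grad_x f \<xi> \<bullet> grad_x ?\<phi> \<xi>) = (?k1\<^sup>2 + ?k2\<^sup>2) * ?I"
    using gint[OF B(1)] gint[OF B(2)]
    by (simp add: parts[OF B(1)] parts[OF B(2)] inner_Basis_freq power2_eq_square algebra_simps)
  have I1: "(LINT \<xi>|cell. (1 - angular_density f (fst \<xi>)) * f \<xi> * (e_dir (snd \<xi>) \<bullet> grad_x ?\<phi> \<xi>))
      = (LINT \<xi>|cell. (1 - s \<xi>) * f \<xi> * (?k1 * cos (snd \<xi>) + ?k2 * sin (snd \<xi>)) * ?w \<xi>)"
  proof (rule integral_cell_cong_AE)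
    show "integrable cell (\<lambda>\<xi>. (1 - s \<xi>) * f \<xi> * (?k1 * cos (snd \<xi>) + ?k2 * sin (snd \<xi>)) * ?w \<xi>)"
    proof (rule integrable_mult_wave, rule Bochner_Integration.integrable_bound)
      show "integrable cell (\<lambda>\<xi>. 2 * (\<bar>?k1\<bar> + \<bar>?k2\<bar>) * f \<xi>)" using fint by simp
      have "(\<lambda>\<xi>::point. ?k1 * cos (snd \<xi>) + ?k2 * sin (snd \<xi>)) \<in> borel_measurable cell"
        by (rule measurable_cell_continuous) (intro continuous_intros)
      then show "(\<lambda>\<xi>. (1 - s \<xi>) * f \<xi> * (?k1 * cos (snd \<xi>) + ?k2 * sin (snd \<xi>))) \<in> borel_measurable cell"
        using measurable_restrict_space1[OF s(1), of Upsilon] borel_measurable_integrable[OF fint] by simp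
      show "AE \<xi> in cell. norm ((1 - s \<xi>) * f \<xi> * (?k1 * cos (snd \<xi>) + ?k2 * sin (snd \<xi>)))
          \<le> norm (2 * (\<bar>?k1\<bar> + \<bar>?k2\<bar>) * f \<xi>)"
      proof (rule AE_I2)
        fix \<xi>
        have "\<bar>1 - s \<xi>\<bar> \<le> 2" using s(2)[of \<xi>] by linarith
        moreover have "\<bar>?k1 * cos (snd \<xi>) + ?k2 * sin (snd \<xi>)\<bar> \<le> \<bar>?k1\<bar> + \<bar>?k2\<bar>"
          by (rule order_trans[OF abs_triangle_ineq]) (simp add: abs_mult add_mono mult_left_le)
        ultimately have "\<bar>1 - s \<xi>\<bar> * \<bar>?k1 * cos (snd \<xi>) + ?k2 * sin (snd \<xi>)\<bar> * \<bar>f \<xi>\<bar> \<le> 2 * (\<bar>?k1\<bar> + \<bar>?k2\<bar>) * \<bar>f \<xi>\<bar>"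
          by (intro mult_right_mono mult_mono) auto
        then show "norm ((1 - s \<xi>) * f \<xi> * (?k1 * cos (snd \<xi>) + ?k2 * sin (snd \<xi>)))
            \<le> norm (2 * (\<bar>?k1\<bar> + \<bar>?k2\<bar>) * f \<xi>)"
          by (simp add: abs_mult mult_ac)
      qed
    qed
    show "AE \<xi> in cell. (1 - angular_density f (fst \<xi>)) * f \<xi> * (e_dir (snd \<xi>) \<bullet> grad_x ?\<phi> \<xi>)
        = (1 - s \<xi>) * f \<xi> * (?k1 * cos (snd \<xi>) + ?k2 * sin (snd \<xi>)) * ?w \<xi>"
      using wp[OF B(1)] wp[OF B(2)] s(3)[folded AE_cell_iff]
      by eventually_elim
        (simp add: grad_x_def e_dir_def inner_vec_def sum_2 inner_Basis_freq algebra_simps)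
  qed
  show ?thesis using eqn unfolding I1 I2 I3 by (simp add: algebra_simps)
qed

lemma L2_mult_cnj_expo: "L2 h \<Longrightarrow> L2 (\<lambda>\<xi>. h \<xi> * cnj (expo k \<xi>))"
  using L2_mult_expo[of h "- k"] by (simp add: expo_minus)

lemma L2_of_real_bounded:
  assumes "s \<in> borel_measurable lebesgue" "\<And>\<xi>. \<bar>s \<xi>\<bar> \<le> B"
  shows "L2 (\<lambda>\<xi>. of_real (s \<xi>))"
  by (rule L2_bounded[where B = B]) (use measurable_restrict_space1[OF assms(1), of Upsilon] assms(2) in auto)

lemma esum_single: "esum (\<lambda>m. if m = a then f m else 0) = f a"
proof -
  have "esum (\<lambda>m. if m = a then f m else 0) = esum (\<lambda>m. f m * indicator {a} m)"
    by (intro nn_integral_cong) (auto simp: indicator_def)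
  also have "\<dots> = (\<integral>\<^sup>+ m. f m \<partial>count_space {a})" by (simp add: nn_integral_count_space_indicator)
  also have "\<dots> = f a" by (simp add: nn_integral_count_space_finite)
  finally show ?thesis .
qed

section \<open>Coefficients of the drift term\<close>

text \<open>rho has only the frequencies (l, 0), so the convolution over three frequencies collapses
  to one over l. In the constant, 1 is for f itself, 2 pi comes from the coefficients of rho and 1 /
  vol from the missing normalisation.\<close>

lemma coef_product_le:
  fixes f s :: "point \<Rightarrow> real"
  assumes f: "L2 (\<lambda>\<xi>. of_real (f \<xi>))" and s: "s \<in> borel_measurable lebesgue" "\<And>\<xi>. \<bar>s \<xi>\<bar> \<le> 1"
    and cs: "\<And>k m. coef (\<lambda>\<xi>. of_real (s \<xi>)) (k, m) = (if m = 0 then 2 * pi * coef (\<lambda>\<xi>. of_real (f \<xi>)) (k, 0) else 0)"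
  defines "u \<equiv> \<lambda>k n. ennreal (cmod (coef (\<lambda>\<xi>. of_real (f \<xi>)) (k, n)))"
  shows "ennreal (cmod (coef (\<lambda>\<xi>. of_real ((1 - s \<xi>) * f \<xi>)) (k, n)))
    \<le> ennreal (1 + 2 * pi / vol) * (u k n + esum (\<lambda>l. u l 0 * u (k - l) n))"
proof -
  let ?f = "\<lambda>\<xi>. complex_of_real (f \<xi>)" and ?s = "\<lambda>\<xi>. complex_of_real (s \<xi>)"
  let ?h = "\<lambda>\<xi>. ?f \<xi> * cnj (expo (k, n) \<xi>)"
  have h: "L2 ?h" by (rule L2_mult_cnj_expo[OF f])
  have s2: "L2 ?s" by (rule L2_of_real_bounded[OF s])
  have "integrable cell ?h" using L2_integrable_mult[OF h L2_expo[of 0]] by simp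
  then have "coef (\<lambda>\<xi>. of_real ((1 - s \<xi>) * f \<xi>)) (k, n) = (LINT \<xi>|cell. ?h \<xi>) - (LINT \<xi>|cell. ?s \<xi> * ?h \<xi>)"
    unfolding coef_def
    by (subst Bochner_Integration.integral_diff[symmetric, OF _ L2_integrable_mult[OF s2 h]])
      (simp_all add: algebra_simps)
  then have "cmod (coef (\<lambda>\<xi>. of_real ((1 - s \<xi>) * f \<xi>)) (k, n)) \<le> cmod (coef ?f (k, n)) + cmod (LINT \<xi>|cell. ?s \<xi> * ?h \<xi>)"
    using norm_triangle_ineq4 by (simp add: coef_def)
  then have "ennreal (cmod (coef (\<lambda>\<xi>. of_real ((1 - s \<xi>) * f \<xi>)) (k, n))) \<le> u k n + ennreal (cmod (LINT \<xi>|cell. ?s \<xi> * ?h \<xi>))"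
    unfolding u_def ennreal_plus[OF norm_ge_zero norm_ge_zero, symmetric] by (rule ennreal_leI)
  also have "ennreal (cmod (LINT \<xi>|cell. ?s \<xi> * ?h \<xi>))
      \<le> ennreal (1 / vol) * esum (\<lambda>l. ennreal (cmod (coef ?s l)) * ennreal (cmod (LINT \<xi>|cell. ?h \<xi> * expo l \<xi>)))"
    by (rule coef_mult_le[OF s h])
  also have "esum (\<lambda>l. ennreal (cmod (coef ?s l)) * ennreal (cmod (LINT \<xi>|cell. ?h \<xi> * expo l \<xi>)))
      = esum (\<lambda>(l, m :: int). if m = 0 then ennreal (2 * pi) * (u l 0 * u (k - l) n) else 0)"
  proof (rule nn_integral_cong)
    fix p :: "(int \<times> int) \<times> int"
    obtain l m where p: "p = (l, m)" by (cases p)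
    show "ennreal (cmod (coef ?s p)) * ennreal (cmod (LINT \<xi>|cell. ?h \<xi> * expo p \<xi>))
        = (case p of (l, m) \<Rightarrow> if m = 0 then ennreal (2 * pi) * (u l 0 * u (k - l) n) else 0)"
    proof (cases "m = 0")
      case True
      have "cnj (expo (k, n) \<xi>) * expo (l, 0) \<xi> = cnj (expo (k - l, n) \<xi>)" for \<xi>
        using expo_add[of "(k, n)" "- (l, 0)" \<xi>] expo_minus[of "(l, 0)" \<xi>] by simp
      then have "(LINT \<xi>|cell. ?h \<xi> * expo (l, 0) \<xi>) = coef ?f (k - l, n)"
        by (simp add: coef_def mult.assoc)
      then show ?thesis using True p
        by (simp add: cs u_def norm_mult ennreal_mult mult.assoc)
    next
      case False
      then show ?thesis using p by (simp add: cs)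
    qed
  qed
  also have "\<dots> = esum (\<lambda>l. ennreal (2 * pi) * (u l 0 * u (k - l) n))"
    unfolding esum_prod by (subst esum_single) simp
  also have "\<dots> = ennreal (2 * pi) * esum (\<lambda>l. u l 0 * u (k - l) n)"
    by (simp add: nn_integral_cmult)
  also have "ennreal (1 / vol) * (ennreal (2 * pi) * esum (\<lambda>l. u l 0 * u (k - l) n))
      = ennreal (2 * pi / vol) * esum (\<lambda>l. u l 0 * u (k - l) n)"
    using vol_pos by (simp add: mult.assoc[symmetric] ennreal_mult[symmetric])
  also have "u k n + ennreal (2 * pi / vol) * esum (\<lambda>l. u l 0 * u (k - l) n)
      \<le> ennreal (1 + 2 * pi / vol) * u k n + ennreal (1 + 2 * pi / vol) * esum (\<lambda>l. u l 0 * u (k - l) n)"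
  proof (rule add_mono)
    have "ennreal 1 * u k n \<le> ennreal (1 + 2 * pi / vol) * u k n"
      using vol_pos by (intro mult_right_mono ennreal_leI) auto
    then show "u k n \<le> ennreal (1 + 2 * pi / vol) * u k n" by simp
    show "ennreal (2 * pi / vol) * esum (\<lambda>l. u l 0 * u (k - l) n) \<le> ennreal (1 + 2 * pi / vol) * esum (\<lambda>l. u l 0 * u (k - l) n)"
      by (intro mult_right_mono ennreal_leI) auto
  qed
  finally show ?thesis by (simp only: distrib_left add_left_mono)
qed

text \<open>a cos + b sin is twice the real part of \<open>A\<close> exp(i theta) with
  \<open>A\<close> = (a - i b) / 2, so multiplying by it shifts n by one in each direction.\<close>

lemma coef_drift_le:
  fixes G :: "point \<Rightarrow> real"
  assumes G: "integrable cell G"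
  shows "cmod (coef (\<lambda>\<xi>. of_real (G \<xi> * (a * cos (snd \<xi>) + b * sin (snd \<xi>)))) (k, n))
    \<le> (\<bar>a\<bar> + \<bar>b\<bar>) * (cmod (coef (\<lambda>\<xi>. of_real (G \<xi>)) (k, n - 1)) + cmod (coef (\<lambda>\<xi>. of_real (G \<xi>)) (k, n + 1)))"
proof -
  let ?G = "\<lambda>\<xi>. complex_of_real (G \<xi>)"
  define A where "A = Complex (a / 2) (- b / 2)"
  have int: "integrable cell (\<lambda>\<xi>. ?G \<xi> * cnj (expo l \<xi>))" for l
    using integrable_mult_expo[OF integrable_cell_complex[OF G], of "- l"] by (simp only: expo_minus)
  have cs: "complex_of_real (a * cos t + b * sin t) = A * cis t + cnj A * cnj (cis t)" for t
    by (simp add: A_def complex_eq_iff algebra_simps)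
  have e: "expo (0, 1) \<xi> = cis (snd \<xi>)" for \<xi> by (simp add: expo_def inner_freq)
  have e1: "cis (snd \<xi>) * cnj (expo (k, n) \<xi>) = cnj (expo (k, n - 1) \<xi>)" for \<xi>
    using expo_add[of "(k, n)" "- (0, 1)" \<xi>] expo_minus[of "(0, 1)" \<xi>] by (simp add: e mult.commute)
  have e2: "cnj (cis (snd \<xi>)) * cnj (expo (k, n) \<xi>) = cnj (expo (k, n + 1) \<xi>)" for \<xi>
    using expo_add[of "(k, n)" "(0, 1)" \<xi>] by (simp add: e mult.commute)
  have "of_real (G \<xi> * (a * cos (snd \<xi>) + b * sin (snd \<xi>))) * cnj (expo (k, n) \<xi>)
      = A * (?G \<xi> * cnj (expo (k, n - 1) \<xi>)) + cnj A * (?G \<xi> * cnj (expo (k, n + 1) \<xi>))" for \<xi>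
    unfolding of_real_mult cs e1[symmetric] e2[symmetric] by (simp only: algebra_simps)
  then have "coef (\<lambda>\<xi>. of_real (G \<xi> * (a * cos (snd \<xi>) + b * sin (snd \<xi>)))) (k, n)
      = A * coef ?G (k, n - 1) + cnj A * coef ?G (k, n + 1)"
    unfolding coef_def using int by simp
  then have "cmod (coef (\<lambda>\<xi>. of_real (G \<xi> * (a * cos (snd \<xi>) + b * sin (snd \<xi>)))) (k, n))
      \<le> cmod A * cmod (coef ?G (k, n - 1)) + cmod A * cmod (coef ?G (k, n + 1))"
    using norm_triangle_ineq[of "A * coef ?G (k, n - 1)" "cnj A * coef ?G (k, n + 1)"] by (simp add: norm_mult)
  also have "\<dots> = cmod A * (cmod (coef ?G (k, n - 1)) + cmod (coef ?G (k, n + 1)))" by (simp add: distrib_left)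
  also have "\<dots> \<le> (\<bar>a\<bar> + \<bar>b\<bar>) * (cmod (coef ?G (k, n - 1)) + cmod (coef ?G (k, n + 1)))"
  proof (rule mult_right_mono)
    have "cmod A \<le> \<bar>Re A\<bar> + \<bar>Im A\<bar>" by (rule cmod_le)
    then show "cmod A \<le> \<bar>a\<bar> + \<bar>b\<bar>" by (simp add: A_def)
  qed simp
  finally show ?thesis .
qed

section \<open>Ellipticity and the gain of one power\<close>

text \<open>Ellipticity: q dominates \<open>min De 1\<close> times the squared length of the
  frequency, whereas the weight times |k1| + |k2|, the size of the drift symbol, grows only
  quadratically.\<close>

lemma symbol_bound:
  fixes De :: real
  assumes "De > 0" "(k, n) \<noteq> (0, 0)"
  defines "q \<equiv> De * ((of_int (fst k))\<^sup>2 + (of_int (snd k))\<^sup>2) + (of_int n)\<^sup>2"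
  shows "0 < q" "wt k n * (\<bar>of_int (fst k)\<bar> + \<bar>of_int (snd k)\<bar>) \<le> 6 / min De 1 * q"
proof -
  let ?x = "real_of_int (fst k)" and ?y = "real_of_int (snd k)" and ?z = "real_of_int n"
  let ?s = "\<bar>?x\<bar> + \<bar>?y\<bar>"
  have nz: "?x \<noteq> 0 \<or> ?y \<noteq> 0 \<or> ?z \<noteq> 0" using assms(2) by (auto simp: prod_eq_iff)
  have m: "0 < min De 1" "min De 1 \<le> De" "min De 1 \<le> 1" using assms(1) by auto
  have "min De 1 * (?x\<^sup>2 + ?y\<^sup>2) \<le> De * (?x\<^sup>2 + ?y\<^sup>2)" "min De 1 * ?z\<^sup>2 \<le> 1 * ?z\<^sup>2"
    using m by (intro mult_right_mono; simp)+
  then have q: "min De 1 * (?x\<^sup>2 + ?y\<^sup>2 + ?z\<^sup>2) \<le> q" by (simp add: q_def distrib_left)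
  have "0 < ?x\<^sup>2 + ?y\<^sup>2 + ?z\<^sup>2"
    using nz by (auto simp: add_pos_nonneg add_nonneg_pos)
  then show "0 < q" by (rule less_le_trans[OF mult_pos_pos[OF m(1)] q])
  \<comment> \<open>Frequencies are integers, so the linear term produced by the 1 in the weight is
    absorbed by the quadratic ones.\<close>
  have int_sq: "\<bar>real_of_int i\<bar> \<le> (real_of_int i)\<^sup>2" for i :: int
  proof (cases "i = 0")
    case False
    then have "1 \<le> \<bar>i\<bar>" by linarith
    then have "1 \<le> real_of_int \<bar>i\<bar>" by linarith
    then have "1 \<le> \<bar>real_of_int i\<bar>" by simp
    then have "\<bar>real_of_int i\<bar> * 1 \<le> \<bar>real_of_int i\<bar> * \<bar>real_of_int i\<bar>"
      by (intro mult_left_mono) auto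
    then show ?thesis by (simp add: power2_eq_square)
  qed simp
  \<comment> \<open>The linear term costs w, the square 2 w, and the cross term another 2 w together
    with z2; hence the 5.\<close>
  have combine: "(1 + a + b + c) * (a + b) \<le> 5 * w + z2"
    if "a + b \<le> w" "(a + b) * (a + b) \<le> 2 * w" "2 * (c * (a + b)) \<le> z2 + (a + b) * (a + b)" "0 \<le> c * (a + b)"
    for a b c w z2 :: real
  proof -
    have "(1 + a + b + c) * (a + b) = (a + b) + (a + b) * (a + b) + c * (a + b)" by (simp add: algebra_simps)
    then show ?thesis using that by linarith
  qed
  have "wt k n * ?s \<le> 5 * (?x\<^sup>2 + ?y\<^sup>2) + ?z\<^sup>2"
    unfolding wt_def
  proof (rule combine)
    show "?s \<le> ?x\<^sup>2 + ?y\<^sup>2" using int_sq[of "fst k"] int_sq[of "snd k"] by linarith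
    show "?s * ?s \<le> 2 * (?x\<^sup>2 + ?y\<^sup>2)"
      using two_mult_le_squares[of "\<bar>?x\<bar>" "\<bar>?y\<bar>"] by (simp add: power2_eq_square algebra_simps)
    show "2 * (\<bar>?z\<bar> * ?s) \<le> ?z\<^sup>2 + ?s * ?s"
      using two_mult_le_squares[of "\<bar>?z\<bar>" ?s] by (simp only: power2_abs power2_eq_square[of ?s])
  qed simp
  also have "\<dots> \<le> 6 * (?x\<^sup>2 + ?y\<^sup>2 + ?z\<^sup>2)"
  proof -
    have "6 * (?x\<^sup>2 + ?y\<^sup>2 + ?z\<^sup>2) = (5 * (?x\<^sup>2 + ?y\<^sup>2) + ?z\<^sup>2) + (?x\<^sup>2 + ?y\<^sup>2 + 5 * ?z\<^sup>2)"
      by (simp add: algebra_simps)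
    then show ?thesis by simp
  qed
  also have "\<dots> \<le> 6 * (q / min De 1)" using q m(1) by (simp add: field_simps)
  finally show "wt k n * ?s \<le> 6 / min De 1 * q" by simp
qed

text \<open>For nonzero frequencies the equation can be divided by the symbol. The drift bound then
  brings in n - 1 and n + 1, and the product bound turns the coefficients of (1 - rho) f into
  \<open>v\<close>.\<close>

lemma coefficient_gain:
  assumes De: "De > 0" and f: "f \<in> H1_per" and sol: "weak_solution Pe De f"
    and range: "AE x in lebesgue. angular_density f x \<in> {0..1}"
  defines "u \<equiv> \<lambda>k n. ennreal (cmod (coef (\<lambda>\<xi>. of_real (f \<xi>)) (k, n)))"
  defines "v \<equiv> \<lambda>k n. u k n + esum (\<lambda>l. u l 0 * u (k - l) n)"
  shows "\<exists>C. \<forall>k n. u k n \<le> ennreal C * (ennreal (1 / wt k n) * (v k (n - 1) + v k n + v k (n + 1)))"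
proof -
  have f2: "L2 (\<lambda>\<xi>. of_real (f \<xi>))" by (rule L2_H1_per[OF f])
  have fint: "integrable cell f" by (rule L2_of_real_integrable[OF f2])
  obtain s where s: "s \<in> borel_measurable lebesgue" "\<And>\<xi>. \<bar>s \<xi>\<bar> \<le> 1"
    "AE \<xi> in lebesgue. \<xi> \<in> Upsilon \<longrightarrow> s \<xi> = angular_density f (fst \<xi>)"
    "\<And>k m. coef (\<lambda>\<xi>. of_real (s \<xi>)) (k, m) = (if m = 0 then 2 * pi * coef (\<lambda>\<xi>. of_real (f \<xi>)) (k, 0) else 0)"
    using angular_density_version[OF fint range] by blast
  define G where "G \<xi> = (1 - s \<xi>) * f \<xi>" for \<xi>
  let ?g = "\<lambda>k n. cmod (coef (\<lambda>\<xi>. of_real (G \<xi>)) (k, n))"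
  let ?D = "1 + 2 * pi / vol"
  have g_le: "ennreal (?g k n) \<le> ennreal ?D * v k n" for k n
    unfolding G_def v_def u_def by (rule coef_product_le[OF f2 s(1,2,4)])
  have Gint: "integrable cell G"
  proof (rule Bochner_Integration.integrable_bound)
    show "integrable cell (\<lambda>\<xi>. 2 * f \<xi>)" using fint by simp
    show "G \<in> borel_measurable cell"
      using measurable_restrict_space1[OF s(1), of Upsilon] borel_measurable_integrable[OF fint]
      by (simp add: G_def[abs_def])
    have "\<bar>1 - s \<xi>\<bar> \<le> 2" for \<xi> using s(2)[of \<xi>] by linarith
    then show "AE \<xi> in cell. norm (G \<xi>) \<le> norm (2 * f \<xi>)"
      by (intro AE_I2) (simp add: G_def abs_mult mult_right_mono)
  qed
  define M where "M = 6 * \<bar>Pe\<bar> / min De 1"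
  have M: "0 \<le> M" using De by (simp add: M_def)
  have D: "0 \<le> ?D" using vol_pos by simp
  define C where "C = 1 + M * ?D"
  have C: "1 \<le> C" "M * ?D \<le> C" using M D by (auto simp: C_def)
  have main: "u k n \<le> ennreal C * (ennreal (1 / wt k n) * (v k (n - 1) + v k n + v k (n + 1)))" for k n
  proof (cases "(k, n) = (0, 0)")
    \<comment> \<open>The symbol vanishes at frequency zero, where the weight is 1 and the bound is
      trivial. The middle term \<open>v k n\<close> and the summand 1 in \<open>C\<close> serve this
      case.\<close>
    case True
    then have wt1: "wt k n = 1" by (simp add: wt_def)
    have "u k n \<le> v k n" by (simp add: v_def)
    also have "\<dots> \<le> v k (n - 1) + v k n + v k (n + 1)" by (metis add.commute add.left_commute add_increasing order_refl zero_le)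
    also have "\<dots> = ennreal 1 * (v k (n - 1) + v k n + v k (n + 1))" by simp
    also have "\<dots> \<le> ennreal C * (v k (n - 1) + v k n + v k (n + 1))"
      by (intro mult_right_mono ennreal_leI C) simp
    finally show ?thesis by (simp add: wt1)
  next
    case False
    let ?k1 = "real_of_int (fst k)" and ?k2 = "real_of_int (snd k)"
    let ?q = "De * (?k1\<^sup>2 + ?k2\<^sup>2) + (of_int n)\<^sup>2"
    let ?H = "\<lambda>\<xi>::point. G \<xi> * (?k1 * cos (snd \<xi>) + ?k2 * sin (snd \<xi>))"
    let ?c = "coef (\<lambda>\<xi>. of_real (f \<xi>)) (k, n)"
    note q = symbol_bound[OF De False]
    have trig_meas: "(\<lambda>\<xi>::point. ?k1 * cos (snd \<xi>) + ?k2 * sin (snd \<xi>)) \<in> borel_measurable cell"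
      by (rule measurable_cell_continuous) (intro continuous_intros)
    have Hint: "integrable cell ?H"
    proof (rule Bochner_Integration.integrable_bound)
      show "integrable cell (\<lambda>\<xi>. (\<bar>?k1\<bar> + \<bar>?k2\<bar>) * G \<xi>)" using Gint by simp
      show "?H \<in> borel_measurable cell" using trig_meas borel_measurable_integrable[OF Gint] by simp
      show "AE \<xi> in cell. norm (?H \<xi>) \<le> norm ((\<bar>?k1\<bar> + \<bar>?k2\<bar>) * G \<xi>)"
      proof (rule AE_I2)
        fix \<xi> :: point
        have "\<bar>?k1 * cos (snd \<xi>) + ?k2 * sin (snd \<xi>)\<bar> \<le> \<bar>?k1\<bar> + \<bar>?k2\<bar>"
          by (rule order_trans[OF abs_triangle_ineq]) (simp add: abs_mult add_mono mult_left_le)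
        then have "\<bar>?k1 * cos (snd \<xi>) + ?k2 * sin (snd \<xi>)\<bar> * \<bar>G \<xi>\<bar> \<le> (\<bar>?k1\<bar> + \<bar>?k2\<bar>) * \<bar>G \<xi>\<bar>"
          by (rule mult_right_mono) simp
        then show "norm (?H \<xi>) \<le> norm ((\<bar>?k1\<bar> + \<bar>?k2\<bar>) * G \<xi>)" by (simp add: abs_mult mult.commute)
      qed
    qed
    have eqn: "?q * (LINT \<xi>|cell. f \<xi> * wave (k, n) c \<xi>) = Pe * (LINT \<xi>|cell. ?H \<xi> * wave (k, n) (c + pi / 2) \<xi>)" for c
      using weak_solution_wave[OF f sol s(1-3), of "(k, n)" c] by (simp add: G_def)
    \<comment> \<open>The phases 0 and pi / 2 give the real and imaginary parts of one complex
      identity, in which the phase shift becomes the factor -i.\<close>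
    have "wave (k, n) (pi / 2 + pi / 2) = (\<lambda>\<xi>. - wave (k, n) 0 \<xi>)"
      using wave_add_pi[of "(k, n)" 0] by (auto simp: fun_eq_iff)
    then have "?q * (LINT \<xi>|cell. f \<xi> * wave (k, n) 0 \<xi>) = Pe * (LINT \<xi>|cell. ?H \<xi> * wave (k, n) (pi / 2) \<xi>)"
      "?q * (LINT \<xi>|cell. f \<xi> * wave (k, n) (pi / 2) \<xi>) = - Pe * (LINT \<xi>|cell. ?H \<xi> * wave (k, n) 0 \<xi>)"
      using eqn[of 0] eqn[of "pi / 2"] by simp_all
    then have "complex_of_real ?q * ?c = - \<i> * of_real Pe * coef (\<lambda>\<xi>. of_real (?H \<xi>)) (k, n)"
      unfolding coef_of_real[OF fint] coef_of_real[OF Hint] by (simp add: complex_eq_iff)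
    then have "cmod (complex_of_real ?q * ?c) = \<bar>Pe\<bar> * cmod (coef (\<lambda>\<xi>. of_real (?H \<xi>)) (k, n))"
      by (simp add: norm_mult)
    then have "?q * cmod ?c = \<bar>Pe\<bar> * cmod (coef (\<lambda>\<xi>. of_real (?H \<xi>)) (k, n))"
      by (simp only: norm_mult norm_of_real abs_of_pos[OF q(1)])
    also have "\<dots> \<le> \<bar>Pe\<bar> * ((\<bar>?k1\<bar> + \<bar>?k2\<bar>) * (?g k (n - 1) + ?g k (n + 1)))"
      by (intro mult_left_mono coef_drift_le[OF Gint]) simp
    finally have "wt k n * (?q * cmod ?c) \<le> wt k n * (\<bar>Pe\<bar> * ((\<bar>?k1\<bar> + \<bar>?k2\<bar>) * (?g k (n - 1) + ?g k (n + 1))))"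
      using wt_pos[of k n] by (intro mult_left_mono) auto
    also have "\<dots> = \<bar>Pe\<bar> * (?g k (n - 1) + ?g k (n + 1)) * (wt k n * (\<bar>?k1\<bar> + \<bar>?k2\<bar>))" by (simp only: mult_ac)
    also have "\<dots> \<le> \<bar>Pe\<bar> * (?g k (n - 1) + ?g k (n + 1)) * (6 / min De 1 * ?q)"
      by (intro mult_left_mono q(2)) simp
    also have "\<dots> = ?q * (M * (?g k (n - 1) + ?g k (n + 1)))"
      by (simp only: M_def times_divide_eq_left times_divide_eq_right mult_ac)
    finally have "?q * (wt k n * cmod ?c) \<le> ?q * (M * (?g k (n - 1) + ?g k (n + 1)))" by (simp only: mult_ac)
    then have "wt k n * cmod ?c \<le> M * (?g k (n - 1) + ?g k (n + 1))" using q(1) by (simp only: mult_le_cancel_left_pos)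
    then have "cmod ?c \<le> M * ((1 / wt k n) * (?g k (n - 1) + ?g k (n + 1)))"
      using wt_pos[of k n] by (simp add: field_simps)
    then have "u k n \<le> ennreal (M * ((1 / wt k n) * (?g k (n - 1) + ?g k (n + 1))))"
      unfolding u_def by (rule ennreal_leI)
    also have "\<dots> = ennreal M * (ennreal (1 / wt k n) * (ennreal (?g k (n - 1)) + ennreal (?g k (n + 1))))"
    proof -
      have a: "0 \<le> 1 / wt k n" using wt_pos[of k n] by simp
      have b: "0 \<le> ?g k (n - 1) + ?g k (n + 1)" by simp
      show ?thesis
        by (simp only: ennreal_mult[OF M mult_nonneg_nonneg[OF a b]] ennreal_mult[OF a b] ennreal_plus[OF norm_ge_zero norm_ge_zero])
    qed
    also have "\<dots> \<le> ennreal M * (ennreal (1 / wt k n) * (ennreal ?D * v k (n - 1) + ennreal ?D * v k (n + 1)))"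
      by (intro mult_left_mono add_mono g_le) auto
    also have "\<dots> = ennreal (M * ?D) * (ennreal (1 / wt k n) * (v k (n - 1) + v k (n + 1)))"
      by (simp only: ennreal_mult[OF M D]) (simp only: distrib_left mult_ac)
    also have "\<dots> \<le> ennreal C * (ennreal (1 / wt k n) * (v k (n - 1) + v k n + v k (n + 1)))"
      by (intro mult_mono ennreal_leI C(2) mult_left_mono add_mono) auto
    finally show ?thesis .
  qed
  then show ?thesis by blast
qed

lemma coef_rapid_decay:
  assumes De: "De > 0" and f: "f \<in> H1_per" and sol: "weak_solution Pe De f"
    and range: "AE x in lebesgue. angular_density f x \<in> {0..1}"
  shows "\<exists>B. \<forall>k n. wt k n ^ s * cmod (coef (\<lambda>\<xi>. of_real (f \<xi>)) (k, n)) \<le> B"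
proof -
  define u where "u k n = ennreal (cmod (coef (\<lambda>\<xi>. of_real (f \<xi>)) (k, n)))" for k n
  define v where "v k n = u k n + esum (\<lambda>l. u l 0 * u (k - l) n)" for k n
  obtain C where C: "\<And>k n. u k n \<le> ennreal C * (ennreal (1 / wt k n) * (v k (n - 1) + v k n + v k (n + 1)))"
    using coefficient_gain[OF De f sol range] unfolding v_def u_def by blast
  have en: "esum (\<lambda>n. esum (\<lambda>k. (ennreal (wt k n) * u k n)\<^sup>2)) < \<infinity>"
    using energy_finite[OF f] by (simp add: u_def)
  \<comment> \<open>\<open>Suc s\<close> rather than s, because the weighted bounds start at power
    one while s may be 0 here; weights are at least 1, so nothing is lost.\<close>
  define S where "S = esum (\<lambda>n. esum (\<lambda>k. (ennreal (wt k n ^ Suc s) * u k n)\<^sup>2))"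
  have S: "S < \<infinity>"
    unfolding S_def by (rule esum_weighted_power[OF v_def en C]) simp
  have "(wt k n ^ s * cmod (coef (\<lambda>\<xi>. of_real (f \<xi>)) (k, n)))\<^sup>2 \<le> enn2real S" for k n
  proof -
    let ?c = "cmod (coef (\<lambda>\<xi>. of_real (f \<xi>)) (k, n))"
    have "(ennreal (wt k n ^ Suc s) * u k n)\<^sup>2 \<le> S"
      unfolding S_def
      by (rule order_trans[OF esum_ge[of "\<lambda>k. (ennreal (wt k n ^ Suc s) * u k n)\<^sup>2" k]
            esum_ge[of "\<lambda>n. esum (\<lambda>k. (ennreal (wt k n ^ Suc s) * u k n)\<^sup>2)" n]])
    also have "(ennreal (wt k n ^ Suc s) * u k n)\<^sup>2 = ennreal ((wt k n ^ Suc s * ?c)\<^sup>2)"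
      using wt_pos[of k n] by (simp only: u_def ennreal_mult[symmetric] ennreal_power zero_le_power less_imp_le norm_ge_zero mult_nonneg_nonneg)
    finally have "(wt k n ^ Suc s * ?c)\<^sup>2 \<le> enn2real S"
      using S by (metis enn2real_ennreal enn2real_mono infinity_ennreal_def zero_le_power2)
    moreover have "(wt k n ^ s * ?c)\<^sup>2 \<le> (wt k n ^ Suc s * ?c)\<^sup>2"
      using wt_pos[of k n] wt_ge_1[of k n] by (intro power_mono mult_right_mono power_increasing) auto
    ultimately show ?thesis by linarith
  qed
  then have "wt k n ^ s * cmod (coef (\<lambda>\<xi>. of_real (f \<xi>)) (k, n)) \<le> sqrt (enn2real S)" for k n
    by (intro real_le_rsqrt)
  then show ?thesis by blast
qed

section \<open>Rapidly decaying Fourier series\<close>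

text \<open>Rapidly decreasing sequences; the class is closed under multiplication by frequencies,
  so the series they define can be differentiated any number of times.\<close>

definition rapid :: "((int \<times> int) \<times> int \<Rightarrow> complex) \<Rightarrow> bool" where
  "rapid a \<longleftrightarrow> (\<forall>s. \<exists>B. \<forall>k. wt (fst k) (snd k) ^ s * cmod (a k) \<le> B)"

definition fseries :: "((int \<times> int) \<times> int \<Rightarrow> complex) \<Rightarrow> point \<Rightarrow> complex" where
  "fseries a \<xi> = (\<Sum>\<^sub>\<infinity>k. a k * expo k \<xi>)"

definition partial_coef :: "point \<Rightarrow> ((int \<times> int) \<times> int \<Rightarrow> complex) \<Rightarrow> (int \<times> int) \<times> int \<Rightarrow> complex" where
  "partial_coef b a k = \<i> * of_real (b \<bullet> freq k) * a k"

text \<open>5 = 3 + 2: an inverse cube for the two-dimensional k and an inverse square, weakened to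
  the exponent 3/2, for n.\<close>

lemma summable_wt_power: "(\<lambda>k. 1 / wt (fst k) (snd k) ^ 5) summable_on UNIV"
proof -
  let ?p = "\<lambda>n::int. (1 + \<bar>of_int n\<bar>) powr (-3/2 :: real)"
  have le: "1 / wt k n ^ 5 \<le> (1 / wt k 0 ^ 3) * ?p n" for k n
  proof -
    let ?N = "1 + \<bar>of_int n :: real\<bar>"
    have "wt k 0 ^ 3 * ?N ^ 2 \<le> wt k n ^ 3 * wt k n ^ 2"
      by (intro mult_mono power_mono) (auto simp: wt_def)
    then have "1 / wt k n ^ 5 \<le> 1 / (wt k 0 ^ 3 * ?N ^ 2)"
      using wt_pos[of k 0] wt_pos[of k n]
      by (intro divide_left_mono) (auto simp: power_add[symmetric] intro!: mult_pos_pos add_pos_nonneg)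
    also have "\<dots> = (1 / wt k 0 ^ 3) * (1 / ?N ^ 2)" by simp
    also have "\<dots> \<le> (1 / wt k 0 ^ 3) * ?p n"
    proof (rule mult_left_mono)
      have "1 / ?N ^ 2 = 1 / ?N powr 2" by simp
      also have "\<dots> = ?N powr (- 2)" by (rule powr_minus_divide[symmetric])
      also have "\<dots> \<le> ?p n" by (intro powr_mono) auto
      finally show "1 / ?N ^ 2 \<le> ?p n" .
    qed (use wt_pos[of k 0] in auto)
    finally show ?thesis .
  qed
  have "esum (\<lambda>k. ennreal (1 / wt (fst k) (snd k) ^ 5)) \<le> esum (\<lambda>(k, n). ennreal (1 / wt k 0 ^ 3) * ennreal (?p n))"
  proof (rule nn_integral_mono)
    fix p
    show "ennreal (1 / wt (fst p) (snd p) ^ 5) \<le> (case p of (k, n) \<Rightarrow> ennreal (1 / wt k 0 ^ 3) * ennreal (?p n))"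
      using ennreal_leI[OF le[of "fst p" "snd p"]] wt_pos[of "fst p" 0]
      by (simp only: split_def ennreal_mult[symmetric] powr_ge_zero divide_nonneg_pos zero_less_power zero_le_one)
  qed
  also have "\<dots> = esum (\<lambda>k. ennreal (1 / wt k 0 ^ 3)) * esum (\<lambda>n. ennreal (?p n))"
    by (simp add: esum_prod nn_integral_cmult nn_integral_multc)
  also have "\<dots> < \<infinity>" using esum_wt_cube esum_int_powr by (simp add: ennreal_mult_less_top)
  finally have fin: "esum (\<lambda>k. ennreal (1 / wt (fst k) (snd k) ^ 5)) < \<infinity>" .
  have "0 \<le> 1 / wt (fst k) (snd k) ^ 5" for k using wt_pos[of "fst k" "snd k"] by simp
  from esum_finite_iff[of "\<lambda>k. 1 / wt (fst k) (snd k) ^ 5", OF this] fin show ?thesis by blast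
qed

lemma rapid_summable:
  assumes "rapid a"
  shows "(\<lambda>k. wt (fst k) (snd k) ^ s * cmod (a k)) summable_on UNIV"
proof -
  obtain B where B: "\<And>k. wt (fst k) (snd k) ^ (s + 5) * cmod (a k) \<le> B"
    using assms unfolding rapid_def by blast
  show ?thesis
  proof (rule summable_on_comparison_test[OF summable_on_cmult_right[OF summable_wt_power, of B]])
    fix k
    have p: "0 < wt (fst k) (snd k)" by (rule wt_pos)
    show "wt (fst k) (snd k) ^ s * cmod (a k) \<le> B * (1 / wt (fst k) (snd k) ^ 5)"
      using B[of k] p by (simp add: power_add field_simps)
    show "0 \<le> wt (fst k) (snd k) ^ s * cmod (a k)" using p by simp
  qed
qed

lemma rapid_abs_summable: "rapid a \<Longrightarrow> (\<lambda>k. cmod (a k)) summable_on UNIV"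
  using rapid_summable[of a 0] by simp

lemma has_sum_fseries:
  assumes "rapid a"
  shows "((\<lambda>k. a k * expo k \<xi>) has_sum fseries a \<xi>) UNIV"
proof -
  have "(\<lambda>k. cmod (a k * expo k \<xi>)) summable_on UNIV"
    using rapid_abs_summable[OF assms] by (simp add: norm_mult)
  then show ?thesis unfolding fseries_def by (rule has_sum_infsum[OF abs_summable_summable])
qed

lemma norm_freq_le: "norm (freq k) \<le> wt (fst k) (snd k)"
proof -
  have "norm (freq k) \<le> (\<Sum>b\<in>Basis. \<bar>freq k \<bullet> b\<bar>)" by (rule norm_le_l1)
  also have "\<dots> = \<bar>of_int (fst (fst k))\<bar> + \<bar>of_int (snd (fst k))\<bar> + \<bar>of_int (snd k)\<bar>"
    by (simp add: Basis_point_eq inner_commute[of "freq k"] inner_Basis_freq axis_eq_axis)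
  finally show ?thesis by (simp add: wt_def)
qed

lemma rapid_partial_coef:
  assumes "rapid a" "b \<in> Basis"
  shows "rapid (partial_coef b a)"
  unfolding rapid_def
proof
  fix s
  obtain B where B: "\<And>k. wt (fst k) (snd k) ^ Suc s * cmod (a k) \<le> B"
    using assms(1) unfolding rapid_def by blast
  have "wt (fst k) (snd k) ^ s * cmod (partial_coef b a k) \<le> B" for k
  proof -
    have "\<bar>b \<bullet> freq k\<bar> \<le> wt (fst k) (snd k)"
      using Basis_le_norm[OF assms(2), of "freq k"] norm_freq_le[of k] by (simp add: inner_commute)
    then have "cmod (partial_coef b a k) \<le> wt (fst k) (snd k) * cmod (a k)"
      by (simp add: partial_coef_def norm_mult mult_right_mono)
    then have "wt (fst k) (snd k) ^ s * cmod (partial_coef b a k) \<le> wt (fst k) (snd k) ^ s * (wt (fst k) (snd k) * cmod (a k))"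
      using wt_pos[of "fst k" "snd k"] by (intro mult_left_mono) auto
    then show ?thesis using B[of k] by (simp add: mult_ac)
  qed
  then show "\<exists>B. \<forall>k. wt (fst k) (snd k) ^ s * cmod (partial_coef b a k) \<le> B" by blast
qed

lemma has_sum_finite_sum:
  fixes f :: "'i \<Rightarrow> 'j \<Rightarrow> 'b::{topological_comm_monoid_add}"
  shows "finite I \<Longrightarrow> (\<And>i. i \<in> I \<Longrightarrow> (f i has_sum s i) A) \<Longrightarrow> ((\<lambda>k. \<Sum>i\<in>I. f i k) has_sum (\<Sum>i\<in>I. s i)) A"
  by (induction I rule: finite_induct) (auto intro: has_sum_add has_sum_0)

lemma has_sum_diff:
  fixes f g :: "'i \<Rightarrow> 'b::topological_ab_group_add"
  assumes "(f has_sum s) A" "(g has_sum t) A"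
  shows "((\<lambda>k. f k - g k) has_sum (s - t)) A"
  using has_sum_add[OF assms(1) has_sum_uminus[THEN iffD2], of g "- t"] assms(2) by simp

lemma cis_quadratic_remainder: "cmod (cis t - 1 - \<i> * of_real t) \<le> t\<^sup>2"
proof -
  have "\<bar>sin t - t\<bar> \<le> t\<^sup>2 / 2"
    using Maclaurin_sin_bound[of t 2] by (simp add: numeral_2_eq_2 sin_coeff_def field_simps)
  moreover have "\<bar>cos t - 1\<bar> \<le> t\<^sup>2 / 2"
  proof -
    have "cos t = 1 - 2 * (sin (t / 2))\<^sup>2" using cos_double_sin[of "t / 2"] by simp
    moreover have "(sin (t / 2))\<^sup>2 \<le> (t / 2)\<^sup>2"
      using abs_sin_x_le_abs_x[of "t / 2"] by (simp only: abs_le_square_iff)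
    ultimately show ?thesis by (simp add: power_divide)
  qed
  moreover have "cmod (cis t - 1 - \<i> * of_real t) \<le> \<bar>cos t - 1\<bar> + \<bar>sin t - t\<bar>"
    using cmod_le[of "cis t - 1 - \<i> * of_real t"] by simp
  ultimately show ?thesis by linarith
qed

text \<open>The second-order remainders of the exponentials are summed directly. Each is at most the
  squared weight times |h|^2, and rapid decay makes the total \<open>M * (norm h)^2\<close>.\<close>

lemma fseries_has_derivative:
  assumes a: "rapid a"
  shows "(fseries a has_derivative (\<lambda>h. \<Sum>b\<in>Basis. (h \<bullet> b) *\<^sub>R fseries (partial_coef b a) \<xi>)) (at \<xi>)"
proof -
  let ?D = "\<lambda>h. \<Sum>b\<in>Basis. (h \<bullet> b) *\<^sub>R fseries (partial_coef b a) \<xi>"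
  define M where "M = (\<Sum>\<^sub>\<infinity>k. wt (fst k) (snd k) ^ 2 * cmod (a k))"
  have rem: "cmod (fseries a (\<xi> + h) - fseries a \<xi> - ?D h) \<le> M * (norm h)\<^sup>2" for h
  proof -
    let ?t = "\<lambda>k. a k * expo k (\<xi> + h) - a k * expo k \<xi> - (\<Sum>b\<in>Basis. of_real (h \<bullet> b) * (partial_coef b a k * expo k \<xi>))"
    have hs: "(?t has_sum (fseries a (\<xi> + h) - fseries a \<xi> - ?D h)) UNIV"
    proof (rule has_sum_diff[OF has_sum_diff[OF has_sum_fseries[OF a] has_sum_fseries[OF a]]])
      show "((\<lambda>k. \<Sum>b\<in>Basis. of_real (h \<bullet> b) * (partial_coef b a k * expo k \<xi>)) has_sum ?D h) UNIV"
        unfolding scaleR_conv_of_real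
        by (rule has_sum_finite_sum[OF finite_Basis]) (intro has_sum_cmult_right has_sum_fseries rapid_partial_coef a)
    qed
    have bound: "cmod (?t k) \<le> (wt (fst k) (snd k) ^ 2 * cmod (a k)) * (norm h)\<^sup>2" for k
    proof -
      let ?x = "freq k \<bullet> h"
      have "(\<Sum>b\<in>Basis. of_real (h \<bullet> b) * (partial_coef b a k * expo k \<xi>))
          = \<i> * of_real (\<Sum>b\<in>Basis. (h \<bullet> b) * (freq k \<bullet> b)) * (a k * expo k \<xi>)"
        by (simp add: partial_coef_def sum_distrib_left sum_distrib_right mult_ac inner_commute[of _ "freq k"])
      also have "(\<Sum>b\<in>Basis. (h \<bullet> b) * (freq k \<bullet> b)) = ?x"
        unfolding inner_commute[of "freq k" h] by (rule euclidean_inner[symmetric])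
      finally have "?t k = a k * expo k \<xi> * (cis ?x - 1 - \<i> * of_real ?x)"
        by (simp add: expo_def inner_add_right cis_mult[symmetric] algebra_simps)
      then have "cmod (?t k) = cmod (a k) * cmod (cis ?x - 1 - \<i> * of_real ?x)"
        by (simp add: norm_mult)
      also have "\<dots> \<le> cmod (a k) * ?x\<^sup>2" by (intro mult_left_mono cis_quadratic_remainder) simp
      also have "\<dots> \<le> cmod (a k) * (wt (fst k) (snd k) * norm h)\<^sup>2"
      proof (intro mult_left_mono)
        have "\<bar>?x\<bar> \<le> norm (freq k) * norm h" by (rule Cauchy_Schwarz_ineq2)
        also have "\<dots> \<le> wt (fst k) (snd k) * norm h" by (intro mult_right_mono norm_freq_le) simp
        finally show "?x\<^sup>2 \<le> (wt (fst k) (snd k) * norm h)\<^sup>2" by (metis abs_ge_zero power2_abs power_mono)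
      qed simp
      finally show ?thesis by (simp add: power_mult_distrib mult_ac)
    qed
    have sumM: "(\<lambda>k. (wt (fst k) (snd k) ^ 2 * cmod (a k)) * (norm h)\<^sup>2) summable_on UNIV"
      by (rule summable_on_cmult_left[OF rapid_summable[OF a]])
    have abs: "(\<lambda>k. cmod (?t k)) summable_on UNIV"
      by (rule summable_on_comparison_test[OF sumM bound]) simp
    have "cmod (fseries a (\<xi> + h) - fseries a \<xi> - ?D h) \<le> (\<Sum>\<^sub>\<infinity>k. cmod (?t k))"
      using norm_infsum_bound[OF abs] infsumI[OF hs] by simp
    also have "\<dots> \<le> (\<Sum>\<^sub>\<infinity>k. (wt (fst k) (snd k) ^ 2 * cmod (a k)) * (norm h)\<^sup>2)"
      by (rule infsum_mono[OF abs sumM bound])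
    also have "\<dots> = M * (norm h)\<^sup>2"
      unfolding M_def by (rule infsum_cmult_left) (rule rapid_summable[OF a])
    finally show ?thesis .
  qed
  show ?thesis unfolding has_derivative_at
  proof
    show "bounded_linear ?D"
      by (intro bounded_linear_sum bounded_linear_scaleR_left[THEN bounded_linear_compose] bounded_linear_inner_left)
    have "((\<lambda>h::point. M * norm h) \<longlongrightarrow> M * norm (0 :: point)) (at 0)"
      by (rule tendsto_mult[OF tendsto_const tendsto_norm[OF tendsto_ident_at]])
    then have lim: "((\<lambda>h::point. M * norm h) \<longlongrightarrow> 0) (at 0)" by simp
    show "((\<lambda>h. cmod (fseries a (\<xi> + h) - fseries a \<xi> - ?D h) / norm h) \<longlongrightarrow> 0) (at 0)"
    proof (rule Lim_null_comparison[OF _ lim])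
      show "\<forall>\<^sub>F h in at 0. norm (cmod (fseries a (\<xi> + h) - fseries a \<xi> - ?D h) / norm h) \<le> M * norm h"
        unfolding eventually_at_filter
      proof (intro always_eventually allI impI)
        fix h :: point assume "h \<noteq> 0"
        then show "norm (cmod (fseries a (\<xi> + h) - fseries a \<xi> - ?D h) / norm h) \<le> M * norm h"
          using rem[of h] by (simp add: divide_le_eq power2_eq_square mult.assoc)
      qed
    qed
  qed
qed

lemma continuous_fseries:
  assumes "rapid a"
  shows "continuous_on UNIV (fseries a)"
  by (intro continuous_at_imp_continuous_on ballI has_derivative_continuous[OF fseries_has_derivative[OF assms]])

text \<open>Each partial derivative is again the real part of a series with rapidly decreasing
  coefficients, so the induction runs over all of them at once.\<close>

lemma C_k_Re_fseries: "rapid a \<Longrightarrow> C_k n (\<lambda>\<xi>. Re (fseries a \<xi>))"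
proof (induction n arbitrary: a)
  case 0
  show ?case using continuous_on_Re[OF continuous_fseries[OF 0]] by simp
next
  case (Suc n)
  have "((\<lambda>\<xi>. Re (fseries a \<xi>)) has_derivative (\<lambda>h. Re (\<Sum>b\<in>Basis. (h \<bullet> b) *\<^sub>R fseries (partial_coef b a) \<xi>))) (at \<xi>)" for \<xi>
    by (rule bounded_linear.has_derivative[OF bounded_linear_Re fseries_has_derivative[OF Suc.prems]])
  then show ?case
  proof (rule C_k_Suc_I)
    fix b :: point assume b: "b \<in> Basis"
    have "(\<Sum>b'\<in>Basis. (b \<bullet> b') *\<^sub>R fseries (partial_coef b' a) \<xi>) = fseries (partial_coef b a) \<xi>" for \<xi>
      using b by (simp add: inner_Basis if_distrib[of "\<lambda>c. c *\<^sub>R _"] cong: if_cong)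
    then show "C_k n (\<lambda>\<xi>. Re (\<Sum>b'\<in>Basis. (b \<bullet> b') *\<^sub>R fseries (partial_coef b' a) \<xi>))"
      using Suc.IH[OF rapid_partial_coef[OF Suc.prems b]] by simp
  qed
qed

lemma expo_lattice: "expo k (\<xi> + lattice l) = expo k \<xi>"
proof -
  have "cos (freq k \<bullet> (\<xi> + lattice l)) = cos (freq k \<bullet> \<xi>)" "sin (freq k \<bullet> (\<xi> + lattice l)) = sin (freq k \<bullet> \<xi>)"
    using wave_lattice[of k 0 \<xi> l] wave_lattice[of k "- pi / 2" \<xi> l]
    by (simp_all add: wave_def inner_commute cos_diff)
  then show ?thesis by (simp add: expo_def complex_eq_iff)
qed

lemma periodic_Re_fseries: "periodic (\<lambda>\<xi>. Re (fseries a \<xi>))"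
  unfolding periodic_def
proof (intro ballI allI)
  fix b \<xi> :: point assume "b \<in> Basis"
  then obtain l where "(2 * pi) *\<^sub>R b = lattice l" by (rule lattice_Basis)
  then show "Re (fseries a (\<xi> + (2 * pi) *\<^sub>R b)) = Re (fseries a \<xi>)"
    by (simp add: fseries_def expo_lattice)
qed

section \<open>Recovering a function from its coefficients\<close>

text \<open>Partial sums approximate uniformly, with error at most the tail of the absolute sum, and
  once they include k their k-th coefficient is exactly \<open>vol * a k\<close>.\<close>

lemma coef_fseries:
  fixes a :: "(int \<times> int) \<times> int \<Rightarrow> complex"
  assumes a: "rapid a"
  shows "L2 (fseries a)" "coef (fseries a) k = vol * a k"
proof -
  define T where "T = (\<Sum>\<^sub>\<infinity>k. cmod (a k))"
  have T: "((\<lambda>k. cmod (a k)) has_sum T) UNIV"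
    unfolding T_def by (rule has_sum_infsum[OF rapid_abs_summable[OF a]])
  have tail: "cmod (fseries a \<xi> - (\<Sum>k\<in>F. a k * expo k \<xi>)) \<le> T - (\<Sum>k\<in>F. cmod (a k))" if F: "finite F" for F \<xi>
  proof -
    have "((\<lambda>k. a k * expo k \<xi>) has_sum (fseries a \<xi> - (\<Sum>k\<in>F. a k * expo k \<xi>))) (UNIV - F)"
      by (rule has_sum_Diff[OF has_sum_fseries[OF a] has_sum_finite[OF F]]) simp
    moreover have T': "((\<lambda>k. cmod (a k)) has_sum (T - (\<Sum>k\<in>F. cmod (a k)))) (UNIV - F)"
      by (rule has_sum_Diff[OF T has_sum_finite[OF F]]) simp
    ultimately show ?thesis
      using norm_infsum_bound[of "\<lambda>k. a k * expo k \<xi>" "UNIV - F"]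
      by (simp add: norm_mult infsumI has_sum_imp_summable)
  qed
  show L: "L2 (fseries a)"
    by (rule L2_bounded[where B = T, OF measurable_cell_continuous[OF continuous_fseries[OF a]]])
      (use tail[of "{}"] in simp)
  have "cmod (coef (fseries a) k - vol * a k) \<le> 0 + e" if e: "0 < e" for e
  proof -
    have "0 < e / vol" using e vol_pos by simp
    with T have "\<forall>\<^sub>F F in finite_subsets_at_top UNIV. dist (\<Sum>k\<in>F. cmod (a k)) T < e / vol"
      unfolding has_sum_def by (auto simp: tendsto_iff)
    then obtain F0 where F0: "finite F0" "\<And>F. finite F \<Longrightarrow> F0 \<subseteq> F \<Longrightarrow> dist (\<Sum>k\<in>F. cmod (a k)) T < e / vol"
      unfolding eventually_finite_subsets_at_top by auto
    define F where "F = insert k F0"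
    have F12: "finite F" "k \<in> F" using F0(1) by (auto simp: F_def)
    have "dist (\<Sum>k\<in>F. cmod (a k)) T < e / vol" by (rule F0(2)[OF F12(1)]) (auto simp: F_def)
    then have F3: "T - (\<Sum>k\<in>F. cmod (a k)) \<le> e / vol" unfolding dist_real_def by linarith
    note F = F12 F3
    let ?S = "\<lambda>\<xi>. \<Sum>k\<in>F. a k * expo k \<xi>"
    have S: "L2 ?S" by (rule L2_trig[OF trig_sum_expo])
    have "coef (fseries a) k - vol * a k = coef (fseries a) k - coef ?S k"
      using F(1,2) by (simp add: coef_trig_sum)
    also have "\<dots> = (LINT \<xi>|cell. (fseries a \<xi> - ?S \<xi>) * cnj (expo k \<xi>))"
      unfolding coef_def left_diff_distrib
      by (rule Bochner_Integration.integral_diff[symmetric, OF L2_integrable_mult[OF L L2_cnj[OF L2_expo]] L2_integrable_mult[OF S L2_cnj[OF L2_expo]]])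
    finally have "cmod (coef (fseries a) k - vol * a k) \<le> (LINT \<xi>|cell. cmod ((fseries a \<xi> - ?S \<xi>) * cnj (expo k \<xi>)))"
      by (simp only: integral_norm_bound)
    also have "\<dots> \<le> (LINT \<xi>|cell. e / vol)"
    proof (rule integral_mono)
      show "integrable cell (\<lambda>\<xi>. cmod ((fseries a \<xi> - ?S \<xi>) * cnj (expo k \<xi>)))"
        using L2_integrable_mult[OF L2_diff[OF L S] L2_cnj[OF L2_expo]] by simp
      show "integrable cell (\<lambda>\<xi>. e / vol)"
        by (rule integrable_cell_bounded[where B = "\<bar>e / vol\<bar>"]) auto
      fix \<xi>
      show "cmod ((fseries a \<xi> - ?S \<xi>) * cnj (expo k \<xi>)) \<le> e / vol"
        using order_trans[OF tail[OF F(1), of \<xi>] F(3)] by (simp add: norm_mult)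
    qed
    also have "\<dots> = e" using vol_pos by (simp add: measure_restrict_space)
    finally show ?thesis by simp
  qed
  then have "cmod (coef (fseries a) k - vol * a k) \<le> 0" by (rule field_le_epsilon)
  then show "coef (fseries a) k = vol * a k" by simp
qed

text \<open>\<open>fourier_uniqueness\<close> concerns real functions and G need not be known to be
  real. The real part of the difference is handled through the difference and its conjugate; all
  coefficients of both vanish.\<close>

lemma fourier_uniqueness_coef:
  fixes f :: "point \<Rightarrow> real" and G :: "point \<Rightarrow> complex"
  assumes f: "L2 (\<lambda>\<xi>. of_real (f \<xi>))" and G: "L2 G"
    and eq: "\<And>k. coef (\<lambda>\<xi>. of_real (f \<xi>)) k = coef G k"
  shows "AE \<xi> in cell. f \<xi> = Re (G \<xi>)"
proof -
  let ?d = "\<lambda>\<xi>. complex_of_real (f \<xi>) - G \<xi>"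
  let ?h = "\<lambda>\<xi>. f \<xi> - Re (G \<xi>)"
  have d: "L2 ?d" by (rule L2_diff[OF f G])
  have int_d: "integrable cell ?d" using L2_integrable_mult[OF d L2_expo[of 0]] by simp
  have int_h: "integrable cell ?h" using integrable_Re[OF int_d] by simp
  have zero: "(LINT \<xi>|cell. ?d \<xi> * cnj (expo k \<xi>)) = 0" for k
  proof -
    have "(LINT \<xi>|cell. ?d \<xi> * cnj (expo k \<xi>)) = coef (\<lambda>\<xi>. of_real (f \<xi>)) k - coef G k"
      unfolding coef_def left_diff_distrib
      by (rule Bochner_Integration.integral_diff[OF L2_integrable_mult[OF f L2_cnj[OF L2_expo]] L2_integrable_mult[OF G L2_cnj[OF L2_expo]]])
    then show ?thesis by (simp add: eq)
  qed
  have zero': "(LINT \<xi>|cell. ?d \<xi> * expo k \<xi>) = 0" for k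
    using zero[of "- k"] by (simp add: expo_minus)
  have zero'': "(LINT \<xi>|cell. cnj (?d \<xi>) * expo k \<xi>) = 0" for k
    using coef_cnj[of ?d k] zero[of k] by (simp add: coef_def)
  have "(LINT \<xi>|cell. of_real (?h \<xi>) * expo k \<xi>) = 0" for k
  proof -
    have "of_real (?h \<xi>) * expo k \<xi> = (?d \<xi> * expo k \<xi> + cnj (?d \<xi>) * expo k \<xi>) / 2" for \<xi>
      by (simp add: complex_eq_iff algebra_simps)
    then have "(LINT \<xi>|cell. of_real (?h \<xi>) * expo k \<xi>)
        = (LINT \<xi>|cell. (?d \<xi> * expo k \<xi> + cnj (?d \<xi>) * expo k \<xi>) / 2)"
      by (simp only:)
    also have "\<dots> = (LINT \<xi>|cell. ?d \<xi> * expo k \<xi> + cnj (?d \<xi>) * expo k \<xi>) / 2"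
      by (rule integral_divide_zero)
    also have "(LINT \<xi>|cell. ?d \<xi> * expo k \<xi> + cnj (?d \<xi>) * expo k \<xi>) = 0"
      by (subst Bochner_Integration.integral_add[OF L2_integrable_mult[OF d L2_expo] L2_integrable_mult[OF L2_cnj[OF d] L2_expo]])
        (simp only: zero' zero'' add_0)
    finally show ?thesis by simp
  qed
  from fourier_uniqueness[OF int_h this] show ?thesis by simp
qed

theorem theorem5:
  fixes Pe De :: real and f :: "point \<Rightarrow> real"
  assumes "De > 0"
    and "f \<in> H1_per"
    and "AE \<xi> in lebesgue. f \<xi> \<ge> 0"
    and "AE x in lebesgue. angular_density f x \<in> {0..1}"
    and "weak_solution Pe De f"
  shows "\<exists>g. smooth g \<and> periodic g \<and> (AE \<xi> in lebesgue. f \<xi> = g \<xi>)"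
proof -
  define a where "a k = coef (\<lambda>\<xi>. of_real (f \<xi>)) k / vol" for k
  define g where "g \<xi> = Re (fseries a \<xi>)" for \<xi>
  have a: "rapid a"
    unfolding rapid_def
  proof
    fix s
    obtain B where B: "\<And>k n. wt k n ^ s * cmod (coef (\<lambda>\<xi>. of_real (f \<xi>)) (k, n)) \<le> B"
      using coef_rapid_decay[OF assms(1,2,5,4), of s] by blast
    have "wt (fst k) (snd k) ^ s * cmod (a k) \<le> B / vol" for k
      using divide_right_mono[OF B[of "fst k" "snd k"], of vol] vol_pos by (simp add: a_def norm_divide)
    then show "\<exists>B. \<forall>k. wt (fst k) (snd k) ^ s * cmod (a k) \<le> B" by blast
  qed
  have "AE \<xi> in cell. f \<xi> = g \<xi>"
    unfolding g_def
    by (rule fourier_uniqueness_coef[OF L2_H1_per[OF assms(2)] coef_fseries(1)[OF a]])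
      (use vol_pos in \<open>simp add: coef_fseries(2)[OF a] a_def\<close>)
  then have cell: "AE \<xi> in lebesgue. \<xi> \<in> Upsilon \<longrightarrow> f \<xi> = g \<xi>" by (simp only: AE_cell_iff)
  have per: "ae_periodic f" using assms(2) by (simp add: H1_per_def)
  \<comment> \<open>Equality on one cell spreads to the whole space: f is periodic almost everywhere
    along the lattice, g everywhere.\<close>
  have "AE \<xi> in lebesgue. f \<xi> = g \<xi>"
  proof (rule AE_from_cells)
    fix l
    show "AE \<xi> in lebesgue. \<xi> \<in> Upsilon \<longrightarrow> f (\<xi> + lattice l) = g (\<xi> + lattice l)"
      using cell ae_periodic_lattice[OF per, of l]
      by eventually_elim (simp add: g_def fseries_def expo_lattice)
  qed
  moreover have "smooth g"
    unfolding smooth_def g_def[abs_def] using C_k_Re_fseries[OF a] by blast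
  moreover have "periodic g" unfolding g_def[abs_def] by (rule periodic_Re_fseries)
  ultimately show ?thesis by blast
qed

end
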